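(* Let $D$ be a Krull-type domain. Then $\operatorname{Int}(D)$ is a PvMD if and only if $\operatorname{Int}(D_0)$ is a Prüfer domain.
   Context: For an integral domain $D$ with quotient field $K$: $\operatorname{Int}(D)=\{g\in K[X]:g(D)\subseteq D\}$, and for a prime $P$ of $D$, $\operatorname{Int}(D)_P$ denotes the localization of $\operatorname{Int}(D)$ at the multiplicative set $D\setminus P$. For a nonzero fractional ideal $I$: $(D:I)=\{x\in K:xI\subseteq D\}$, $I^v=(D:(D:I))$, $I^t=\bigcup\{J^v:J\subseteq I \text{ finitely generated}\}$; $I$ is a $t$-ideal if $I=(0)$ or $I=I^t$; $t\text{-Spec}(D)$ is the set of prime $t$-ideals; $t$-maximal ideals are $t$-ideals maximal among proper $t$-ideals. $D$ is a PvMD if $D_{\mathfrak m}$ is a valuation domain for all $t$-maximal $\mathfrak m$. $D$ is Krull-type if it is the intersection of a family $\mathcal V$ of valuation overrings each of which is a localization $D_{\mathfrak p}$ at a prime, with $\mathcal V$ locally finite (each nonzero $x\in D$ is a nonunit in only finitely many members of $\mathcal V$). Set $\Lambda_0=\{P\in t\text{-Spec}(D):\operatorname{Int}(D)_P\neq D_P[X]\}$ and $D_0=\bigcap_{P\in\Lambda_0}D_P$ (with $D_0=K$ if $\Lambda_0=\emptyset$). *)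

theory Defs
  imports "HOL-Computational_Algebra.Polynomial" "HOL-Computational_Algebra.Fraction_Field"
begin

text \<open>Integral domains are represented as subrings R of a field of type 'b.
  The quotient field of R is the set of quotients inside 'b.\<close>

definition subring :: "'b::field set \<Rightarrow> bool" where
  "subring R \<longleftrightarrow> 0 \<in> R \<and> 1 \<in> R \<and>
     (\<forall>x\<in>R. \<forall>y\<in>R. x + y \<in> R \<and> x - y \<in> R \<and> x * y \<in> R)"

definition quot_field :: "'b::field set \<Rightarrow> 'b set" where
  "quot_field R = {a / b | a b. a \<in> R \<and> b \<in> R \<and> b \<noteq> 0}"

definition is_ideal :: "'b::field set \<Rightarrow> 'b set \<Rightarrow> bool" where
  "is_ideal R I \<longleftrightarrow> I \<subseteq> R \<and> 0 \<in> I \<and>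
     (\<forall>x\<in>I. \<forall>y\<in>I. x + y \<in> I) \<and> (\<forall>r\<in>R. \<forall>x\<in>I. r * x \<in> I)"

definition prime_ideal :: "'b::field set \<Rightarrow> 'b set \<Rightarrow> bool" where
  "prime_ideal R P \<longleftrightarrow> is_ideal R P \<and> P \<noteq> R \<and>
     (\<forall>a\<in>R. \<forall>b\<in>R. a * b \<in> P \<longrightarrow> a \<in> P \<or> b \<in> P)"

definition maximal_ideal :: "'b::field set \<Rightarrow> 'b set \<Rightarrow> bool" where
  "maximal_ideal R M \<longleftrightarrow> is_ideal R M \<and> M \<noteq> R \<and>
     (\<forall>J. is_ideal R J \<and> J \<noteq> R \<and> M \<subseteq> J \<longrightarrow> J = M)"

definition loc :: "'b::field set \<Rightarrow> 'b set \<Rightarrow> 'b set" where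
  "loc R P = {a / s | a s. a \<in> R \<and> s \<in> R - P}"

definition valuation_domain :: "'b::field set \<Rightarrow> bool" where
  "valuation_domain V \<longleftrightarrow> subring V \<and>
     (\<forall>x\<in>quot_field V. x \<noteq> 0 \<longrightarrow> x \<in> V \<or> inverse x \<in> V)"

definition colon :: "'b::field set \<Rightarrow> 'b set \<Rightarrow> 'b set" where
  "colon R I = {x \<in> quot_field R. \<forall>y\<in>I. x * y \<in> R}"

definition v_op :: "'b::field set \<Rightarrow> 'b set \<Rightarrow> 'b set" where
  "v_op R I = colon R (colon R I)"

definition gen_mod :: "'b::field set \<Rightarrow> 'b set \<Rightarrow> 'b set" where
  "gen_mod R F = {(\<Sum>x\<in>F. c x * x) | c. \<forall>x\<in>F. c x \<in> R}"

definition t_op :: "'b::field set \<Rightarrow> 'b set \<Rightarrow> 'b set" where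
  "t_op R I = \<Union>{v_op R (gen_mod R F) | F. finite F \<and> F \<subseteq> I \<and> F - {0} \<noteq> {}}"

definition t_ideal :: "'b::field set \<Rightarrow> 'b set \<Rightarrow> bool" where
  "t_ideal R I \<longleftrightarrow> is_ideal R I \<and> (I = {0} \<or> I = t_op R I)"

definition t_Spec :: "'b::field set \<Rightarrow> 'b set set" where
  "t_Spec R = {P. prime_ideal R P \<and> t_ideal R P}"

definition t_maximal :: "'b::field set \<Rightarrow> 'b set \<Rightarrow> bool" where
  "t_maximal R M \<longleftrightarrow> t_ideal R M \<and> M \<noteq> R \<and>
     (\<forall>J. t_ideal R J \<and> J \<noteq> R \<and> M \<subseteq> J \<longrightarrow> J = M)"

definition PvMD :: "'b::field set \<Rightarrow> bool" where
  "PvMD R \<longleftrightarrow> subring R \<and> (\<forall>M. t_maximal R M \<longrightarrow> valuation_domain (loc R M))"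

definition Pruefer :: "'b::field set \<Rightarrow> bool" where
  "Pruefer R \<longleftrightarrow> subring R \<and> (\<forall>M. maximal_ideal R M \<longrightarrow> valuation_domain (loc R M))"

definition Krull_type :: "'b::field set \<Rightarrow> bool" where
  "Krull_type R \<longleftrightarrow> subring R \<and> (\<exists>\<P>. (\<forall>P\<in>\<P>. prime_ideal R P \<and> valuation_domain (loc R P)) \<and>
     R = quot_field R \<inter> \<Inter>(loc R ` \<P>) \<and>
     (\<forall>x\<in>R - {0}. finite {P\<in>\<P>. inverse x \<notin> loc R P}))"

definition IntPoly :: "'a::field set \<Rightarrow> 'a poly set" where
  "IntPoly D = {g. (\<forall>i. coeff g i \<in> quot_field D) \<and> (\<forall>d\<in>D. poly g d \<in> D)}"

definition IntPoly_loc :: "'a::field set \<Rightarrow> 'a set \<Rightarrow> 'a poly set" where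
  "IntPoly_loc D P = {smult (inverse s) g | g s. g \<in> IntPoly D \<and> s \<in> D - P}"

definition poly_over :: "'a::field set \<Rightarrow> 'a poly set" where
  "poly_over A = {g. \<forall>i. coeff g i \<in> A}"

definition Lambda0 :: "'a::field set \<Rightarrow> 'a set set" where
  "Lambda0 D = {P \<in> t_Spec D. IntPoly_loc D P \<noteq> poly_over (loc D P)}"

definition D0 :: "'a::field set \<Rightarrow> 'a set" where
  "D0 D = (if Lambda0 D = {} then quot_field D else \<Inter>(loc D ` Lambda0 D))"

text \<open>Int(D) viewed as a domain inside its quotient field K(X) (here 'a poly fract).\<close>
definition IntDom :: "'a::field set \<Rightarrow> 'a poly fract set" where
  "IntDom D = (\<lambda>g. Fract g 1) ` IntPoly D"

end

theory Submission
  imports Defs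
begin

text \<open>
  Both properties are equivalent to: \<open>D\<^sub>P\<close> is a discrete valuation ring for every \<open>P \<in> \<Lambda>\<^sub>0\<close>.

  By interpolation at nodes that are distinct modulo \<open>P\<close>, respectively at the powers of an element, a prime \<open>P\<close>
  of \<open>\<Lambda>\<^sub>0\<close> has a finite residue field and a principal ideal \<open>PD\<^sub>P = aD\<^sub>P\<close>. In particular \<open>P\<close> is maximal,
  so it belongs to the given family and powers of \<open>a\<close> can be cleared away from the other members of the
  family. Let \<open>T\<close> be a set of representatives modulo \<open>P\<close>. The iterates of \<open>\<theta>(X) = (\<Prod>t\<in>T. X - t) / a\<close> read off
  \<open>a\<close>-adic digits, which yields polynomials that are units exactly on a given residue class modulo \<open>a\<^sup>n\<close>.

  If some \<open>D\<^sub>P\<close> is not discrete, choose \<open>d \<noteq> 0\<close> divisible by all powers of \<open>a\<close>. These polynomials show that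
  \<open>{g. g(0) \<in> P}\<close> is a prime t-ideal, and neither \<open>X/d\<close> nor \<open>d/X\<close> lies in the localization at it.
  The same holds over \<open>D\<^sub>0\<close>, so both properties fail.

  If all \<open>D\<^sub>P\<close> are discrete, let \<open>M\<close> be a t-maximal ideal of \<open>Int(D)\<close>, or a maximal ideal of \<open>Int(D\<^sub>0)\<close>. If \<open>M\<close>
  contracts to \<open>0\<close>, its localization is one of \<open>K[X]\<close>. If it contracts to some \<open>P \<in> \<Lambda>\<^sub>0\<close>, two polynomials
  satisfying a Bezout relation can be compared on a small residue class singled out by \<open>M\<close>.
  The remaining case occurs only for t-maximal \<open>M\<close>: there \<open>Int(D) \<subseteq> D\<^sub>p[X]\<close> for all members \<open>p\<close> of the
  family above the contraction \<open>q\<close>, and by Gauss' lemma \<open>M\<close> has no element of \<open>D[X]\<close> with a coefficient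
  outside \<open>q\<close>, so that the localization is the Gauss extension of \<open>D\<^sub>q\<close>.
\<close>

subsection \<open>Subrings, primes and localizations\<close>

lemma subring_zero: "subring R \<Longrightarrow> 0 \<in> R"
  and subring_one: "subring R \<Longrightarrow> 1 \<in> R"
  and subring_add: "subring R \<Longrightarrow> x \<in> R \<Longrightarrow> y \<in> R \<Longrightarrow> x + y \<in> R"
  and subring_diff: "subring R \<Longrightarrow> x \<in> R \<Longrightarrow> y \<in> R \<Longrightarrow> x - y \<in> R"
  and subring_mult: "subring R \<Longrightarrow> x \<in> R \<Longrightarrow> y \<in> R \<Longrightarrow> x * y \<in> R"
  by (auto simp: subring_def)

lemma subring_minus: "subring R \<Longrightarrow> x \<in> R \<Longrightarrow> - x \<in> R"
  using subring_diff[of R 0 x] by (simp add: subring_zero)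

lemma subring_power: "subring R \<Longrightarrow> x \<in> R \<Longrightarrow> x ^ n \<in> R"
  by (induction n) (auto intro: subring_one subring_mult)

lemma subring_sum: "subring R \<Longrightarrow> (\<And>i. i \<in> A \<Longrightarrow> f i \<in> R) \<Longrightarrow> sum f A \<in> R"
  by (induction A rule: infinite_finite_induct) (auto intro: subring_zero subring_add)

lemma subring_prod: "subring R \<Longrightarrow> (\<And>i. i \<in> A \<Longrightarrow> f i \<in> R) \<Longrightarrow> prod f A \<in> R"
  by (induction A rule: infinite_finite_induct) (auto intro: subring_one subring_mult)

lemmas subring_intros = subring_zero subring_one subring_add subring_diff subring_mult
  subring_minus subring_power subring_sum subring_prod

lemma subring_poly:
  assumes "subring R" "\<And>i. coeff f i \<in> R" "x \<in> R"
  shows "poly f x \<in> R"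
  unfolding poly_altdef using assms by (intro subring_intros) auto

lemma quot_fieldI: "a \<in> R \<Longrightarrow> b \<in> R \<Longrightarrow> b \<noteq> 0 \<Longrightarrow> a / b \<in> quot_field R"
  by (auto simp: quot_field_def)

lemma subset_quot_field: "subring R \<Longrightarrow> x \<in> R \<Longrightarrow> x \<in> quot_field R"
  using quot_fieldI[of x R 1] by (simp add: subring_one)

lemma prime_ideal_mem: "prime_ideal R P \<Longrightarrow> x \<in> P \<Longrightarrow> x \<in> R"
  and prime_ideal_zero: "prime_ideal R P \<Longrightarrow> 0 \<in> P"
  and prime_ideal_add: "prime_ideal R P \<Longrightarrow> x \<in> P \<Longrightarrow> y \<in> P \<Longrightarrow> x + y \<in> P"
  and prime_ideal_mult: "prime_ideal R P \<Longrightarrow> r \<in> R \<Longrightarrow> x \<in> P \<Longrightarrow> r * x \<in> P"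
  and prime_ideal_prime: "prime_ideal R P \<Longrightarrow> x \<in> R \<Longrightarrow> y \<in> R \<Longrightarrow> x * y \<in> P \<Longrightarrow> x \<in> P \<or> y \<in> P"
  by (auto simp: prime_ideal_def is_ideal_def)

lemma prime_ideal_mult2: "prime_ideal R P \<Longrightarrow> r \<in> R \<Longrightarrow> x \<in> P \<Longrightarrow> x * r \<in> P"
  using prime_ideal_mult by (metis mult.commute)

lemma ideal_one_imp_eq: "is_ideal R I \<Longrightarrow> 1 \<in> I \<Longrightarrow> I = R"
  unfolding is_ideal_def by (metis mult.right_neutral subsetI subset_antisym)

lemma prime_ideal_one: "prime_ideal R P \<Longrightarrow> 1 \<notin> P"
  using ideal_one_imp_eq by (auto simp: prime_ideal_def)

lemma prime_ideal_minus: "subring R \<Longrightarrow> prime_ideal R P \<Longrightarrow> x \<in> P \<Longrightarrow> - x \<in> P"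
  using prime_ideal_mult[of R P "-1" x] by (simp add: subring_minus subring_one)

lemma prime_ideal_diff: "subring R \<Longrightarrow> prime_ideal R P \<Longrightarrow> x \<in> P \<Longrightarrow> y \<in> P \<Longrightarrow> x - y \<in> P"
  using prime_ideal_add[of R P x "-y"] prime_ideal_minus[of R P y] by simp

lemma prime_ideal_notin_mult:
  "prime_ideal R P \<Longrightarrow> x \<in> R - P \<Longrightarrow> y \<in> R - P \<Longrightarrow> x * y \<notin> P"
  using prime_ideal_prime by blast

lemma prime_ideal_power: "subring R \<Longrightarrow> prime_ideal R P \<Longrightarrow> x \<in> R \<Longrightarrow> x ^ n \<in> P \<Longrightarrow> x \<in> P"
proof (induction n)
  case (Suc n)
  then show ?case using prime_ideal_prime[of R P x "x ^ n"] by (auto intro: subring_intros)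
qed (simp add: prime_ideal_one)

lemma prime_ideal_prod:
  assumes "subring R" "prime_ideal R P" "finite A" "\<And>i. i \<in> A \<Longrightarrow> f i \<in> R" "prod f A \<in> P"
  shows "\<exists>i\<in>A. f i \<in> P"
  using assms(3-5)
proof (induction A rule: finite_induct)
  case (insert x F)
  then have "f x \<in> P \<or> prod f F \<in> P"
    using assms(1,2) by (intro prime_ideal_prime[of R P]) (auto intro: subring_prod)
  then show ?case using insert by auto
qed (use assms prime_ideal_one in auto)

lemma zero_prime_ideal: "subring R \<Longrightarrow> prime_ideal R {0}"
  using subring_one[of R] by (auto simp: prime_ideal_def is_ideal_def subring_def)

lemma loc_zero: "loc R {0} = quot_field R"
  by (auto simp: loc_def quot_field_def)

lemma locI: "a \<in> R \<Longrightarrow> s \<in> R \<Longrightarrow> s \<notin> P \<Longrightarrow> a / s \<in> loc R P"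
  by (auto simp: loc_def)

lemma locE:
  assumes "x \<in> loc R P" "prime_ideal R P"
  obtains a s where "x = a / s" "a \<in> R" "s \<in> R" "s \<notin> P" "s \<noteq> 0"
  using assms prime_ideal_zero by (fastforce simp: loc_def)

lemma loc_mem: "subring R \<Longrightarrow> prime_ideal R P \<Longrightarrow> x \<in> R \<Longrightarrow> x \<in> loc R P"
  using locI[of x R 1 P] by (simp add: subring_one prime_ideal_one)

lemma loc_sub_quot: "prime_ideal R P \<Longrightarrow> x \<in> loc R P \<Longrightarrow> x \<in> quot_field R"
  by (elim locE) (auto intro: quot_fieldI)

lemma subring_loc:
  assumes "subring R" "prime_ideal R P"
  shows "subring (loc R P)"
  unfolding subring_def
proof (intro conjI ballI)
  fix x y assume "x \<in> loc R P" "y \<in> loc R P"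
  then obtain a s b t where *: "x = a / s" "a \<in> R" "s \<in> R" "s \<notin> P" "s \<noteq> 0"
      "y = b / t" "b \<in> R" "t \<in> R" "t \<notin> P" "t \<noteq> 0"
    using assms(2) by (metis locE)
  have st: "s * t \<notin> P" using * prime_ideal_prime[OF assms(2)] by blast
  have "x + y = (a * t + b * s) / (s * t)" "x - y = (a * t - b * s) / (s * t)" "x * y = (a * b) / (s * t)"
    using * by (auto simp: field_simps)
  then show "x + y \<in> loc R P" "x - y \<in> loc R P" "x * y \<in> loc R P"
    using * st assms(1) by (auto intro!: locI intro: subring_intros)
qed (use loc_mem[OF assms subring_zero[OF assms(1)]] loc_mem[OF assms subring_one[OF assms(1)]] in auto)

lemma subring_quot: "subring R \<Longrightarrow> subring (quot_field R)"
  using subring_loc[OF _ zero_prime_ideal] by (simp add: loc_zero)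

lemma quot_inverse:
  assumes "subring R" "x \<in> quot_field R"
  shows "inverse x \<in> quot_field R"
proof -
  obtain a b where *: "x = a / b" "a \<in> R" "b \<in> R" "b \<noteq> 0"
    using assms(2) by (auto simp: quot_field_def)
  show ?thesis
  proof (cases "a = 0")
    case True
    then show ?thesis using * assms by (auto intro: subring_intros subring_quot)
  next
    case False
    then show ?thesis using * quot_fieldI[of b R a] by simp
  qed
qed

lemma quot_divide: "subring R \<Longrightarrow> x \<in> quot_field R \<Longrightarrow> y \<in> quot_field R \<Longrightarrow> x / y \<in> quot_field R"
  unfolding divide_inverse by (intro subring_mult subring_quot quot_inverse)

lemma quot_field_mono: "A \<subseteq> B \<Longrightarrow> quot_field A \<subseteq> quot_field B"
  by (auto simp: quot_field_def)

lemma quot_field_idem: "subring R \<Longrightarrow> quot_field (quot_field R) = quot_field R"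
  using quot_divide[of R] subset_quot_field[OF subring_quot, of R] by (fastforce simp: quot_field_def[of "quot_field R"])

lemma quot_field_between:
  assumes "subring R" "R \<subseteq> S" "S \<subseteq> quot_field R"
  shows "quot_field S = quot_field R"
  using quot_field_mono[OF assms(2)] quot_field_mono[OF assms(3)] quot_field_idem[OF assms(1)] by blast

lemma quot_field_loc: "subring R \<Longrightarrow> prime_ideal R P \<Longrightarrow> quot_field (loc R P) = quot_field R"
  by (rule quot_field_between) (auto intro: loc_mem loc_sub_quot)

lemma inverse_mem_loc:
  assumes "subring R" "prime_ideal R P" "x \<in> R" "x \<noteq> 0"
  shows "inverse x \<in> loc R P \<longleftrightarrow> x \<notin> P"
proof
  assume "inverse x \<in> loc R P"
  then obtain a s where *: "inverse x = a / s" "a \<in> R" "s \<in> R" "s \<notin> P" "s \<noteq> 0"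
    using assms(2) by (metis locE)
  then have "s = x * a" using assms(4) by (auto simp: field_simps)
  then show "x \<notin> P" using * assms prime_ideal_mult2 by metis
next
  assume "x \<notin> P"
  then show "inverse x \<in> loc R P" using locI[OF subring_one[OF assms(1)], of x P] assms by (simp add: inverse_eq_divide)
qed

lemma loc_divide_unit:
  assumes "subring R" "prime_ideal R P" "x \<in> loc R P" "s \<in> R" "s \<notin> P"
  shows "x / s \<in> loc R P"
  using subring_mult[OF subring_loc[OF assms(1,2)] assms(3) locI[OF subring_one[OF assms(1)] assms(4,5)]]
  by simp

lemma loc_mono: "Q \<subseteq> P \<Longrightarrow> loc R P \<subseteq> loc R Q"
  by (auto simp: loc_def)

lemma common_denominator:
  assumes "subring R" "prime_ideal R P" "finite S" "S \<subseteq> loc R P"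
  shows "\<exists>s\<in>R - P. \<forall>x\<in>S. s * x \<in> R"
  using assms(3,4)
proof (induction S rule: finite_induct)
  case empty
  then show ?case using assms prime_ideal_one subring_one by blast
next
  case (insert x F)
  then obtain s where s: "s \<in> R - P" "\<forall>x\<in>F. s * x \<in> R" by auto
  obtain a t where x: "x = a / t" "a \<in> R" "t \<in> R" "t \<notin> P" "t \<noteq> 0"
    using insert assms(2) by (metis insert_subset locE)
  have "\<forall>y\<in>insert x F. (t * s) * y \<in> R"
  proof
    fix y assume y: "y \<in> insert x F"
    show "(t * s) * y \<in> R"
    proof (cases "y = x")
      case True
      then have "(t * s) * y = s * a" using x by (simp add: mult.assoc)
      moreover have "s * a \<in> R" using s x assms(1) by (auto intro: subring_mult)
      ultimately show ?thesis by (simp only:)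
    next
      case False
      then have "t * (s * y) \<in> R" using y s x assms(1) by (auto intro: subring_mult)
      then show ?thesis by (simp add: mult.assoc)
    qed
  qed
  moreover have "t * s \<in> R - P" using s x assms prime_ideal_notin_mult[OF assms(2), of t s] by (auto intro: subring_mult)
  ultimately show ?case by blast
qed

lemma common_denominator_poly:
  assumes "subring R" "prime_ideal R P" "finite S" "S \<subseteq> poly_over (loc R P)"
  shows "\<exists>s\<in>R - P. \<forall>f\<in>S. smult s f \<in> poly_over R"
proof -
  define C where "C = (\<Union>f\<in>S. set (coeffs f))"
  have "finite C" using assms(3) by (simp add: C_def)
  moreover have "C \<subseteq> loc R P"
    using assms(4) by (fastforce simp: C_def poly_over_def coeffs_def split: if_splits)
  ultimately obtain s where s: "s \<in> R - P" "\<forall>x\<in>C. s * x \<in> R"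
    using common_denominator[OF assms(1,2)] by blast
  have "s * coeff f i \<in> R" if "f \<in> S" for f i
  proof (cases "coeff f i = 0")
    case True
    then show ?thesis by (simp add: subring_zero[OF assms(1)])
  next
    case False
    then have "coeff f i \<in> set (coeffs f)" using range_coeff[of f] by blast
    then show ?thesis using s(2) that by (auto simp: C_def)
  qed
  then show ?thesis using s(1) by (auto simp: poly_over_def)
qed

section \<open>Valuation domains and Gauss' lemma\<close>

lemma valuation_domainD:
  assumes "valuation_domain V" "x \<in> quot_field V" "y \<in> quot_field V" "x \<noteq> 0" "y \<noteq> 0"
  shows "x / y \<in> V \<or> y / x \<in> V"
proof -
  have "x / y \<in> quot_field V" using assms quot_divide by (auto simp: valuation_domain_def)
  then show ?thesis using assms by (auto simp: valuation_domain_def)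
qed

lemma valuation_domain_loc_mono:
  assumes "subring R" "prime_ideal R P" "prime_ideal R Q" "Q \<subseteq> P" "valuation_domain (loc R P)"
  shows "valuation_domain (loc R Q)"
  using assms loc_mono[OF assms(4), of R] subring_loc[OF assms(1,3)]
  by (auto simp: valuation_domain_def quot_field_loc)

text \<open>The relation \<open>A * C' = B * C\<close> rewrites the quotient of \<open>A\<close> and
  \<open>B\<close> as that of \<open>C\<close> and \<open>C'\<close>, and whichever of these lies
  outside \<open>N\<close> serves as a denominator. In this form the test involves elements of
  \<open>R\<close> only, so it can be carried out on polynomials.\<close>

lemma valuation_loc_criterion:
  assumes "subring R" "prime_ideal R N"
    and *: "\<And>A B. A \<in> R \<Longrightarrow> B \<in> R \<Longrightarrow> A \<noteq> 0 \<Longrightarrow> B \<noteq> 0 \<Longrightarrow>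
          \<exists>C\<in>R. \<exists>C'\<in>R. A * C' = B * C \<and> (C \<notin> N \<or> C' \<notin> N)"
  shows "valuation_domain (loc R N)"
  unfolding valuation_domain_def
proof (intro conjI ballI impI)
  fix x assume "x \<in> quot_field (loc R N)" "x \<noteq> 0"
  then obtain A B where AB: "x = A / B" "A \<in> R" "B \<in> R" "A \<noteq> 0" "B \<noteq> 0"
    using assms by (auto simp: quot_field_loc) (auto simp: quot_field_def)
  then obtain C C' where C: "C \<in> R" "C' \<in> R" "A * C' = B * C" "C \<notin> N \<or> C' \<notin> N"
    using * by blast
  have "C \<noteq> 0 \<and> C' \<noteq> 0" using C AB prime_ideal_zero[OF assms(2)] by auto
  then have "x = C / C'" "inverse x = C' / C" using C AB by (auto simp: field_simps)
  then show "x \<in> loc R N \<or> inverse x \<in> loc R N" using C locI by metis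
qed (use assms subring_loc in auto)

text \<open>Divisibility by \<open>V\<close> is a total preorder, so a finite set has a member of
  least valuation. It serves as the content of a polynomial and as the generator of a finitely
  generated ideal.\<close>

lemma valuation_min_element:
  assumes "valuation_domain V" "finite S" "S \<subseteq> quot_field V" "\<exists>x\<in>S. x \<noteq> 0"
  shows "\<exists>c\<in>S. c \<noteq> 0 \<and> (\<forall>x\<in>S. x / c \<in> V)"
  using assms(2-4)
proof (induction S rule: finite_induct)
  case (insert x F)
  have V: "subring V" using assms by (simp add: valuation_domain_def)
  show ?case
  proof (cases "\<exists>x\<in>F. x \<noteq> 0")
    case False
    then have "y / x \<in> V" if "y \<in> insert x F" for y
      using that insert False subring_one[OF V] subring_zero[OF V] by (cases "y = x") auto
    moreover have "x \<noteq> 0" using False insert by auto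
    ultimately show ?thesis by blast
  next
    case True
    then obtain c where c: "c \<in> F" "c \<noteq> 0" "\<forall>x\<in>F. x / c \<in> V" using insert by auto
    show ?thesis
    proof (cases "x / c \<in> V")
      case True
      then show ?thesis using c by auto
    next
      case False
      then have "x \<noteq> 0" using subring_zero[OF V] by auto
      then have "c / x \<in> V" using False valuation_domainD[OF assms(1), of x c] insert c by auto
      then have "\<forall>y\<in>F. (y / c) * (c / x) \<in> V" using c V subring_mult by blast
      then show ?thesis using \<open>x \<noteq> 0\<close> c V subring_one by (auto intro!: bexI[of _ x])
    qed
  qed
qed auto

text \<open>One of \<open>x\<close>, \<open>y\<close> divides the other, so if the sum were a unit,
  the divisor would be one too. Zero is listed separately among the nonunits because
  \<open>inverse 0 = 0\<close> lies in \<open>V\<close>.\<close>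

lemma subring_nonunit_add:
  assumes "valuation_domain V" "x \<in> V" "y \<in> V" "inverse x \<notin> V \<or> x = 0" "inverse y \<notin> V \<or> y = 0"
  shows "inverse (x + y) \<notin> V \<or> x + y = 0"
proof (rule ccontr)
  have V: "subring V" using assms by (simp add: valuation_domain_def)
  assume *: "\<not> (inverse (x + y) \<notin> V \<or> x + y = 0)"
  then have nz: "x \<noteq> 0" "y \<noteq> 0" using assms by auto
  consider "x / y \<in> V" | "y / x \<in> V"
    using valuation_domainD[OF assms(1) subset_quot_field[OF V assms(2)] subset_quot_field[OF V assms(3)] nz] by auto
  then show False
  proof cases
    case 1
    have "inverse y = (x / y + 1) * inverse (x + y)" using nz * by (simp add: field_simps)
    then show False using 1 * nz assms V by (metis subring_add subring_mult subring_one)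
  next
    case 2
    have "inverse x = (y / x + 1) * inverse (x + y)" using nz * by (simp add: field_simps)
    then show False using 2 * nz assms V by (metis subring_add subring_mult subring_one)
  qed
qed

lemma nonunit_sum:
  assumes "valuation_domain V" "\<And>i. i \<in> A \<Longrightarrow> f i \<in> V \<and> (inverse (f i) \<notin> V \<or> f i = 0)"
  shows "sum f A \<in> V \<and> (inverse (sum f A) \<notin> V \<or> sum f A = 0)"
proof -
  have V: "subring V" using assms by (simp add: valuation_domain_def)
  show ?thesis using assms(2)
  proof (induction A rule: infinite_finite_induct)
    case (insert i F)
    then have "f i \<in> V" "sum f F \<in> V" "inverse (f i) \<notin> V \<or> f i = 0" "inverse (sum f F) \<notin> V \<or> sum f F = 0"
      by blast+
    then show ?case
      using subring_nonunit_add[OF assms(1), of "f i" "sum f F"] subring_add[OF V] insert(1,2) by simp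
  qed (use V subring_zero in auto)
qed

lemma nonunit_mult:
  assumes "subring V" "x \<in> V" "y \<in> V" "inverse x \<notin> V \<or> x = 0"
  shows "inverse (x * y) \<notin> V \<or> x * y = 0"
proof (rule ccontr)
  assume *: "\<not> ?thesis"
  then have "y * inverse (x * y) \<in> V" using assms subring_mult by blast
  moreover have "y * inverse (x * y) = inverse x" using * by (simp add: nonzero_inverse_mult_distrib)
  ultimately have "inverse x \<in> V" by metis
  then show False using * assms by auto
qed

text \<open>At the product of the first unit coefficients exactly one summand of the convolution is a unit.\<close>
lemma unit_coeff_mult:
  fixes f g :: "'b::field poly"
  assumes V: "valuation_domain V" and f: "f \<in> poly_over V" and g: "g \<in> poly_over V"
    and uf: "\<exists>i. coeff f i \<noteq> 0 \<and> inverse (coeff f i) \<in> V"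
    and ug: "\<exists>i. coeff g i \<noteq> 0 \<and> inverse (coeff g i) \<in> V"
  shows "\<exists>i. coeff (f * g) i \<noteq> 0 \<and> inverse (coeff (f * g) i) \<in> V"
proof -
  have sV: "subring V" using V by (simp add: valuation_domain_def)
  define u where "u x \<longleftrightarrow> x \<noteq> 0 \<and> inverse x \<in> V" for x
  define i where "i = (LEAST i. u (coeff f i))"
  define j where "j = (LEAST i. u (coeff g i))"
  have i: "u (coeff f i)" using uf LeastI_ex[of "\<lambda>i. u (coeff f i)"] by (simp add: u_def i_def)
  have j: "u (coeff g j)" using ug LeastI_ex[of "\<lambda>i. u (coeff g i)"] by (simp add: u_def j_def)
  have li: "\<not> u (coeff f k)" if "k < i" for k using that not_less_Least by (auto simp: i_def)
  have lj: "\<not> u (coeff g k)" if "k < j" for k using that not_less_Least by (auto simp: j_def)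
  have cf: "coeff f k \<in> V" "coeff g k \<in> V" for k using f g by (auto simp: poly_over_def)
  let ?t = "\<lambda>k. coeff f k * coeff g (i + j - k)"
  have split: "coeff (f * g) (i + j) = ?t i + sum ?t ({..i+j} - {i})"
    unfolding coeff_mult by (subst sum.remove[of _ i]) auto
  have rest: "sum ?t ({..i+j} - {i}) \<in> V \<and> (inverse (sum ?t ({..i+j} - {i})) \<notin> V \<or> sum ?t ({..i+j} - {i}) = 0)"
  proof (rule nonunit_sum[OF V])
    fix k assume k: "k \<in> {..i+j} - {i}"
    have "inverse (?t k) \<notin> V \<or> ?t k = 0"
    proof (cases "k < i")
      case True
      then show ?thesis using li[of k] nonunit_mult[OF sV cf(1)[of k] cf(2)[of "i+j-k"]] by (auto simp: u_def)
    next
      case False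
      then have "i + j - k < j" using k by auto
      then show ?thesis using lj[of "i+j-k"] nonunit_mult[OF sV cf(2)[of "i+j-k"] cf(1)[of k]]
        by (auto simp: u_def mult.commute)
    qed
    then show "?t k \<in> V \<and> (inverse (?t k) \<notin> V \<or> ?t k = 0)" using cf sV subring_mult by blast
  qed
  have u: "u (?t i)" using i j sV by (auto simp: u_def intro: subring_mult)
  have tV: "?t i \<in> V" using cf sV subring_mult by blast
  have "u (coeff (f * g) (i + j))"
  proof (rule ccontr)
    assume "\<not> u (coeff (f * g) (i + j))"
    then have n: "inverse (coeff (f * g) (i + j)) \<notin> V \<or> coeff (f * g) (i + j) = 0" by (auto simp: u_def)
    let ?r = "sum ?t ({..i+j} - {i})"
    have "inverse (- ?r) \<notin> V \<or> - ?r = 0"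
      using rest subring_minus[OF sV, of "- inverse ?r"] by auto
    then have "inverse (coeff (f * g) (i + j) + - ?r) \<notin> V \<or> coeff (f * g) (i + j) + - ?r = 0"
      using rest tV n split by (intro subring_nonunit_add[OF V]) (auto intro: subring_intros sV)
    then show False using u split by (simp add: u_def)
  qed
  then show ?thesis by (auto simp: u_def)
qed

text \<open>Gauss' lemma: dividing \<open>z\<close> by a coefficient \<open>c\<close> of least
  valuation leaves a polynomial with a unit coefficient, whose product with \<open>f\<close> again
  has a unit coefficient. That coefficient of \<open>z * f\<close> is \<open>c\<close> times a unit,
  which forces \<open>c\<close> into \<open>V\<close>.\<close>

lemma gauss_cancel:
  fixes z f :: "'b::field poly"
  assumes V: "valuation_domain V" and z: "z \<in> poly_over (quot_field V)" and f: "f \<in> poly_over V"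
    and uf: "\<exists>i. coeff f i \<noteq> 0 \<and> inverse (coeff f i) \<in> V"
    and zf: "z * f \<in> poly_over V"
  shows "z \<in> poly_over V"
proof (cases "z = 0")
  case True
  then show ?thesis using V by (auto simp: poly_over_def valuation_domain_def intro: subring_zero)
next
  case False
  have sV: "subring V" using V by (simp add: valuation_domain_def)
  have fin: "finite (range (coeff z))" by (simp add: range_coeff)
  obtain c where c: "c \<in> range (coeff z)" "c \<noteq> 0" "\<forall>x\<in>range (coeff z). x / c \<in> V"
    using valuation_min_element[OF V fin] z False by (auto simp: poly_over_def poly_eq_iff)
  define z' where "z' = smult (1/c) z"
  have z': "z = smult c z'" using c by (simp add: z'_def)
  have "z' \<in> poly_over V" using c(3) by (auto simp: z'_def poly_over_def)
  moreover obtain k where "coeff z k = c" using c(1) by auto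
  then have "\<exists>i. coeff z' i \<noteq> 0 \<and> inverse (coeff z' i) \<in> V"
    using c sV subring_one by (auto simp: z'_def intro!: exI[of _ k])
  ultimately obtain i where i: "coeff (z' * f) i \<noteq> 0" "inverse (coeff (z' * f) i) \<in> V"
    using unit_coeff_mult[OF V _ f _ uf] by blast
  have "coeff (z * f) i * inverse (coeff (z' * f) i) \<in> V" using i zf sV by (auto simp: poly_over_def intro: subring_mult)
  then have "c \<in> V" using i by (simp add: z' mult.assoc)
  then show ?thesis using \<open>z' \<in> poly_over V\<close> sV by (auto simp: z' poly_over_def intro: subring_mult)
qed

subsection \<open>Polynomials and interpolation\<close>

lemma poly_over_const: "subring A \<Longrightarrow> c \<in> A \<Longrightarrow> [:c:] \<in> poly_over A"
  by (auto simp: poly_over_def coeff_pCons subring_zero split: nat.splits)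

lemma poly_over_X: "subring A \<Longrightarrow> [:0, 1:] \<in> poly_over A"
  by (auto simp: poly_over_def coeff_pCons subring_zero subring_one split: nat.splits)

lemma poly_over_zero: "subring A \<Longrightarrow> 0 \<in> poly_over A"
  by (simp add: poly_over_def subring_zero)

lemma poly_over_one: "subring A \<Longrightarrow> 1 \<in> poly_over A"
  using poly_over_const[of A 1] by (simp add: subring_one one_pCons)

lemma poly_over_add: "subring A \<Longrightarrow> f \<in> poly_over A \<Longrightarrow> g \<in> poly_over A \<Longrightarrow> f + g \<in> poly_over A"
  by (simp add: poly_over_def subring_add)

lemma poly_over_diff: "subring A \<Longrightarrow> f \<in> poly_over A \<Longrightarrow> g \<in> poly_over A \<Longrightarrow> f - g \<in> poly_over A"
  by (simp add: poly_over_def subring_diff)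

lemma poly_over_smult: "subring A \<Longrightarrow> c \<in> A \<Longrightarrow> f \<in> poly_over A \<Longrightarrow> smult c f \<in> poly_over A"
  by (simp add: poly_over_def subring_mult)

lemma poly_over_mult: "subring A \<Longrightarrow> f \<in> poly_over A \<Longrightarrow> g \<in> poly_over A \<Longrightarrow> f * g \<in> poly_over A"
  by (auto simp: poly_over_def coeff_mult intro!: subring_sum subring_mult)

lemma poly_over_prod: "subring A \<Longrightarrow> (\<And>i. i \<in> I \<Longrightarrow> f i \<in> poly_over A) \<Longrightarrow> prod f I \<in> poly_over A"
  by (induction I rule: infinite_finite_induct) (auto intro: poly_over_one poly_over_mult)

lemma poly_over_power: "subring A \<Longrightarrow> f \<in> poly_over A \<Longrightarrow> f ^ n \<in> poly_over A"
  by (induction n) (auto intro: poly_over_one poly_over_mult)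

lemma poly_over_mono: "A \<subseteq> B \<Longrightarrow> poly_over A \<subseteq> poly_over B"
  by (auto simp: poly_over_def)

lemma poly_over_eval: "subring A \<Longrightarrow> f \<in> poly_over A \<Longrightarrow> x \<in> A \<Longrightarrow> poly f x \<in> A"
  by (auto simp: poly_over_def intro: subring_poly)

lemmas poly_over_intros = poly_over_const poly_over_X poly_over_zero poly_over_one poly_over_add
  poly_over_diff poly_over_smult poly_over_mult poly_over_prod poly_over_power

lemma poly_over_denominator:
  assumes "subring R" "finite S" "S \<subseteq> poly_over (quot_field R)"
  shows "\<exists>s\<in>R - {0}. \<forall>f\<in>S. smult s f \<in> poly_over R"
  using common_denominator_poly[OF assms(1) zero_prime_ideal[OF assms(1)] assms(2)] assms(3)
  by (simp add: loc_zero)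

text \<open>Euclid's algorithm over the subfield \<open>K\<close>. The polynomials \<open>A'\<close>
  and \<open>B'\<close> are \<open>A\<close> and \<open>B\<close> divided by their greatest common
  divisor; the relation \<open>A * B' = B * A'\<close> also covers the case that one of them is
  zero.\<close>

lemma poly_over_bezout:
  assumes K: "subring K" and inv: "\<And>x. x \<in> K \<Longrightarrow> inverse x \<in> K"
    and "A \<in> poly_over K" "B \<in> poly_over K"
  shows "\<exists>A'\<in>poly_over K. \<exists>B'\<in>poly_over K. \<exists>u\<in>poly_over K. \<exists>w\<in>poly_over K.
    u * A' + w * B' = 1 \<and> A * B' = B * A'"
  using assms(3,4)
\<comment> \<open>Unlike the degree, the number of coefficients distinguishes zero from a nonzero
  constant, so it also drops when a remainder vanishes.\<close>
proof (induction "length (coeffs A) + length (coeffs B)" arbitrary: A B rule: less_induct)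
  case less
  have step: "\<exists>A'\<in>poly_over K. \<exists>B'\<in>poly_over K. \<exists>u\<in>poly_over K. \<exists>w\<in>poly_over K.
    u * A' + w * B' = 1 \<and> A * B' = B * A'"
    if sm: "length (coeffs A) + length (coeffs B) \<le> n"
      and IH: "\<And>A B. length (coeffs A) + length (coeffs B) < n \<Longrightarrow> A \<in> poly_over K \<Longrightarrow> B \<in> poly_over K \<Longrightarrow>
        \<exists>A'\<in>poly_over K. \<exists>B'\<in>poly_over K. \<exists>u\<in>poly_over K. \<exists>w\<in>poly_over K.
          u * A' + w * B' = 1 \<and> A * B' = B * A'"
      and AB: "A \<in> poly_over K" "B \<in> poly_over K" and deg: "degree B \<le> degree A" and nz: "A \<noteq> 0" "B \<noteq> 0"
    for A B :: "'a poly" and n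
  proof -
    \<comment> \<open>A single division step: this monomial multiple of \<open>B\<close> cancels the
      leading term of \<open>A\<close>.\<close>
    define q where "q = monom (lead_coeff A * inverse (lead_coeff B)) (degree A - degree B)"
    have q: "q \<in> poly_over K"
      using AB inv K by (auto simp: q_def poly_over_def intro!: subring_intros)
    define C where "C = A - q * B"
    have C: "C \<in> poly_over K" using AB q K by (auto simp: C_def intro: poly_over_intros)
    have "degree q \<le> degree A - degree B" by (simp add: q_def degree_monom_le)
    then have "degree (q * B) \<le> degree A" using degree_mult_le[of q B] deg by linarith
    then have dC: "degree C \<le> degree A" unfolding C_def by (intro degree_diff_le) auto
    have "coeff (q * B) (degree A) = lead_coeff A"
      using nz deg by (simp add: q_def coeff_monom_mult)
    then have "coeff C (degree A) = 0" by (simp add: C_def)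
    then have "C = 0 \<or> degree C < degree A" using dC leading_coeff_neq_0[of C] by (cases "degree C = degree A") auto
    then have "length (coeffs C) < length (coeffs A)"
      using nz by (cases "C = 0") (auto simp: length_coeffs_degree)
    then obtain A' B' u w where *: "A' \<in> poly_over K" "B' \<in> poly_over K" "u \<in> poly_over K" "w \<in> poly_over K"
       "u * A' + w * B' = 1" "C * B' = B * A'"
      using IH[OF _ C AB(2)] sm by auto
    have "u * (A' + q * B') + (w - u * q) * B' = 1" using *(5) by (simp add: algebra_simps)
    moreover have "A * B' = B * (A' + q * B')" using *(6) by (simp add: C_def algebra_simps)
    moreover have "A' + q * B' \<in> poly_over K" "w - u * q \<in> poly_over K"
      using * q K by (auto intro: poly_over_intros)
    ultimately show ?thesis using * by blast
  qed
  consider "B = 0" | "A = 0" | "A \<noteq> 0" "B \<noteq> 0" "degree B \<le> degree A" | "A \<noteq> 0" "B \<noteq> 0" "degree A \<le> degree B"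
    by linarith
  then show ?case
  proof cases
    case 1
    then show ?thesis using K by (intro bexI[of _ 1] bexI[of _ 0]) (auto intro: poly_over_intros)
  next
    case 2
    then show ?thesis
      by (intro bexI[of _ 0] bexI[of _ 1] bexI[of _ 0] bexI[of _ 1]) (auto intro: poly_over_intros K)
  next
    case 3
    then show ?thesis using step[OF le_refl less.hyps less.prems] by auto
  next
    case 4
    have "\<exists>A'\<in>poly_over K. \<exists>B'\<in>poly_over K. \<exists>u\<in>poly_over K. \<exists>w\<in>poly_over K.
      u * A' + w * B' = 1 \<and> B * B' = A * A'"
      using 4 by (intro step[OF _ less.hyps less.prems(2,1)]) auto
    then obtain A' B' u w where *: "A' \<in> poly_over K" "B' \<in> poly_over K" "u \<in> poly_over K" "w \<in> poly_over K"
      "u * A' + w * B' = 1" "B * B' = A * A'" by blast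
    then have "w * B' + u * A' = 1 \<and> A * A' = B * B'" by (simp add: add.commute)
    then show ?thesis using * by blast
  qed
qed

text \<open>Newton interpolation with control of denominators. Passing to divided differences
  removes one node and costs one factor \<delta>; the factor \<epsilon> records what has been paid
  so far, so that the induction hypothesis applies to the quotient.\<close>

lemma divided_difference_coeff:
  assumes W: "subring W" and "finite S" "card S = Suc n" "degree g \<le> n" "S \<subseteq> W" and \<delta>: "\<delta> \<in> W"
    and "\<And>x y. x \<in> S \<Longrightarrow> y \<in> S \<Longrightarrow> x \<noteq> y \<Longrightarrow> \<delta> / (x - y) \<in> W"
    and "\<And>x. x \<in> S \<Longrightarrow> \<epsilon> * poly g x \<in> W"
  shows "\<epsilon> * \<delta> ^ n * coeff g i \<in> W"
  using assms(2-5,7,8)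
proof (induction n arbitrary: g S \<epsilon> i)
  case 0
  then obtain x where x: "x \<in> S" by (metis card.empty ex_in_conv nat.distinct(1))
  have g: "g = [:coeff g 0:]" using 0 by (simp add: degree_0_id)
  then have "poly g x = coeff g 0" by (metis poly_pCons mult_zero_right poly_0 add.right_neutral)
  moreover have "coeff g i = (if i = 0 then coeff g 0 else 0)"
    using 0 by (auto intro: coeff_eq_0)
  ultimately show ?case using 0(6)[OF x] W by (auto simp: subring_zero)
next
  case (Suc n)
  obtain x0 where x0: "x0 \<in> S" using Suc.prems by (metis card.empty ex_in_conv nat.distinct(1))
  \<comment> \<open>The quotient by \<open>X - x0\<close> takes at each remaining node the divided
    difference of \<open>g\<close> with respect to \<open>x0\<close>.\<close>
  define g1 where "g1 = synthetic_div g x0"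
  have geq: "g = [:- x0, 1:] * g1 + [:poly g x0:]" unfolding g1_def by (rule synthetic_div_correct'[symmetric])
  have IH: "(\<epsilon> * \<delta>) * \<delta> ^ n * coeff g1 j \<in> W" for j
  proof (rule Suc.IH[of "S - {x0}"])
    fix x assume x: "x \<in> S - {x0}"
    have "poly g x = (x - x0) * poly g1 x + poly g x0" by (subst geq) (simp add: algebra_simps)
    then have "\<epsilon> * (poly g x - poly g x0) = \<epsilon> * ((x - x0) * poly g1 x)" by simp
    then have "\<epsilon> * poly g x - \<epsilon> * poly g x0 = (x - x0) * (\<epsilon> * poly g1 x)"
      by (simp add: right_diff_distrib mult_ac)
    then have "(\<epsilon> * \<delta>) * poly g1 x = (\<delta> / (x - x0)) * (\<epsilon> * poly g x - \<epsilon> * poly g x0)"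
      using x by simp
    moreover have "(\<delta> / (x - x0)) * (\<epsilon> * poly g x - \<epsilon> * poly g x0) \<in> W"
      using Suc.prems(5)[of x x0] Suc.prems(6)[of x] Suc.prems(6)[of x0] x x0
      by (auto intro!: subring_mult[OF W, of "\<delta> / (x - x0)", simplified] subring_diff[OF W])
    ultimately show "(\<epsilon> * \<delta>) * poly g1 x \<in> W" by (simp only:)
  qed (use Suc.prems x0 in \<open>auto simp: g1_def degree_synthetic_div\<close>)
  have "coeff g i = - x0 * coeff g1 i + (case i of 0 \<Rightarrow> 0 | Suc j \<Rightarrow> coeff g1 j) + coeff [:poly g x0:] i"
    by (subst geq) (simp add: coeff_pCons split: nat.splits)
  then have "\<epsilon> * \<delta> ^ Suc n * coeff g i = \<epsilon> * \<delta> ^ Suc n * (- x0 * coeff g1 i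
      + (case i of 0 \<Rightarrow> 0 | Suc j \<Rightarrow> coeff g1 j) + coeff [:poly g x0:] i)"
    by (simp only:)
  then have "\<epsilon> * \<delta> ^ Suc n * coeff g i = - x0 * (\<epsilon> * \<delta> * \<delta> ^ n * coeff g1 i)
      + (case i of 0 \<Rightarrow> \<delta> ^ Suc n * (\<epsilon> * poly g x0) | Suc j \<Rightarrow> \<epsilon> * \<delta> * \<delta> ^ n * coeff g1 j)"
    by (simp add: algebra_simps coeff_pCons split: nat.splits)
  moreover have "x0 \<in> W" "\<epsilon> * poly g x0 \<in> W" using Suc.prems x0 by auto
  ultimately have eq: "\<epsilon> * \<delta> ^ Suc n * coeff g i = - x0 * (\<epsilon> * \<delta> * \<delta> ^ n * coeff g1 i)
      + (case i of 0 \<Rightarrow> \<delta> ^ Suc n * (\<epsilon> * poly g x0) | Suc j \<Rightarrow> \<epsilon> * \<delta> * \<delta> ^ n * coeff g1 j)"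
    and mem: "x0 \<in> W" "\<epsilon> * poly g x0 \<in> W" by blast+
  have "\<delta> ^ Suc n * (\<epsilon> * poly g x0) \<in> W" using mem subring_mult[OF W subring_power[OF W \<delta>]] by blast
  then have "(case i of 0 \<Rightarrow> \<delta> ^ Suc n * (\<epsilon> * poly g x0) | Suc j \<Rightarrow> \<epsilon> * \<delta> * \<delta> ^ n * coeff g1 j) \<in> W"
    using IH by (cases i) auto
  moreover have "- x0 * (\<epsilon> * \<delta> * \<delta> ^ n * coeff g1 i) \<in> W"
    using subring_mult[OF W subring_minus[OF W mem(1)] IH] .
  ultimately show ?case unfolding eq using subring_add[OF W] by blast
qed

lemma IntPoly_iff: "g \<in> IntPoly D \<longleftrightarrow> g \<in> poly_over (quot_field D) \<and> (\<forall>d\<in>D. poly g d \<in> D)"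
  by (auto simp: IntPoly_def poly_over_def)

lemma IntPoly_eval: "g \<in> IntPoly D \<Longrightarrow> x \<in> D \<Longrightarrow> poly g x \<in> D"
  by (auto simp: IntPoly_def)

lemma IntPoly_over_quot: "g \<in> IntPoly D \<Longrightarrow> g \<in> poly_over (quot_field D)"
  by (auto simp: IntPoly_iff)

lemma poly_over_IntPoly: "subring D \<Longrightarrow> g \<in> poly_over D \<Longrightarrow> g \<in> IntPoly D"
  using poly_over_mono[of D "quot_field D"] by (auto simp: IntPoly_iff intro: subset_quot_field poly_over_eval)

lemma IntPoly_const: "subring D \<Longrightarrow> c \<in> D \<Longrightarrow> [:c:] \<in> IntPoly D"
  by (intro poly_over_IntPoly poly_over_const)

lemma IntPoly_add: "subring D \<Longrightarrow> f \<in> IntPoly D \<Longrightarrow> g \<in> IntPoly D \<Longrightarrow> f + g \<in> IntPoly D"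
  and IntPoly_diff: "subring D \<Longrightarrow> f \<in> IntPoly D \<Longrightarrow> g \<in> IntPoly D \<Longrightarrow> f - g \<in> IntPoly D"
  and IntPoly_mult: "subring D \<Longrightarrow> f \<in> IntPoly D \<Longrightarrow> g \<in> IntPoly D \<Longrightarrow> f * g \<in> IntPoly D"
  by (auto simp: IntPoly_iff intro: poly_over_intros subring_quot subring_intros)

lemma IntPoly_smult: "subring D \<Longrightarrow> c \<in> D \<Longrightarrow> f \<in> IntPoly D \<Longrightarrow> smult c f \<in> IntPoly D"
  using IntPoly_mult[OF _ IntPoly_const] by fastforce

section \<open>Primes with finite residue field and families of Krull type\<close>

text \<open>By pigeonhole two powers of \<open>x\<close> have the same representative in
  \<open>T\<close>; the smaller power lies outside \<open>P\<close> and can be cancelled modulo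
  \<open>P\<close>.\<close>

lemma finite_residue_power:
  assumes R: "subring R" and P: "prime_ideal R P" and T: "finite T" "\<And>x. x \<in> R \<Longrightarrow> \<exists>t\<in>T. x - t \<in> P"
    and x: "x \<in> R" "x \<notin> P"
  shows "\<exists>e>0. x ^ e - 1 \<in> P"
proof -
  define r where "r n = (SOME t. t \<in> T \<and> x ^ n - t \<in> P)" for n :: nat
  have r: "r n \<in> T \<and> x ^ n - r n \<in> P" for n
    using someI_ex[of "\<lambda>t. t \<in> T \<and> x ^ n - t \<in> P"] T(2)[OF subring_power[OF R x(1), of n]]
    by (auto simp: r_def)
  have "\<not> inj r" 
    using r T(1) finite_subset[of "range r" T] finite_imageD[of r UNIV] infinite_UNIV_nat by blast
  then obtain m n where mn: "m < n" "r m = r n" unfolding inj_def by (metis linorder_neqE_nat)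
  have "(x ^ n - r n) - (x ^ m - r m) \<in> P" using r prime_ideal_diff[OF R P] by blast
  moreover have "(x ^ n - r n) - (x ^ m - r m) = x ^ m * (x ^ (n - m) - 1)"
    using mn by (simp add: algebra_simps flip: power_add)
  ultimately have "x ^ m \<in> P \<or> x ^ (n - m) - 1 \<in> P"
    using prime_ideal_prime[OF P] x R by (metis subring_diff subring_one subring_power)
  then have "x ^ (n - m) - 1 \<in> P" using prime_ideal_power[OF R P x(1)] x by blast
  then show ?thesis using mn by (intro exI[of _ "n - m"]) auto
qed

text \<open>A finite domain is a field: an element of \<open>Q\<close> outside \<open>P\<close> has
  a power congruent to \<open>1\<close> modulo \<open>P\<close>, which would put \<open>1\<close>
  into \<open>Q\<close>.\<close>

lemma finite_residue_maximal:
  assumes R: "subring R" and P: "prime_ideal R P" and T: "finite T" "\<And>x. x \<in> R \<Longrightarrow> \<exists>t\<in>T. x - t \<in> P"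
    and Q: "prime_ideal R Q" "P \<subseteq> Q"
  shows "Q = P"
proof (rule ccontr)
  assume "Q \<noteq> P"
  then obtain x where x: "x \<in> Q" "x \<notin> P" using Q by auto
  have xR: "x \<in> R" using x Q prime_ideal_mem by blast
  obtain e where e: "e > 0" "x ^ e - 1 \<in> P" using finite_residue_power[OF R P T xR x(2)] by blast
  have "x ^ e \<in> Q" using e x xR R prime_ideal_mult2[OF Q(1) subring_power[OF R xR, of "e - 1"] x(1)]
    by (simp add: power_eq_if)
  then have "x ^ e - (x ^ e - 1) \<in> Q" using e Q prime_ideal_diff[OF R Q(1)] by blast
  then show False using prime_ideal_one[OF Q(1)] by simp
qed

text \<open>The ring is kept variable because the locale is used both for the given domain and for
  \<open>D0\<close>. Local finiteness is phrased through membership in \<open>p\<close>, which for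
  nonzero elements of \<open>E\<close> means being a nonunit of \<open>loc E p\<close>.\<close>

locale krull_family =
  fixes E :: "'a::field set" and PP :: "'a set set"
  assumes E: "subring E"
    and PP_prime: "p \<in> PP \<Longrightarrow> prime_ideal E p"
    and PP_val: "p \<in> PP \<Longrightarrow> valuation_domain (loc E p)"
    and E_int: "x \<in> quot_field E \<Longrightarrow> (\<And>p. p \<in> PP \<Longrightarrow> x \<in> loc E p) \<Longrightarrow> x \<in> E"
    and PP_finite: "x \<in> E \<Longrightarrow> x \<noteq> 0 \<Longrightarrow> finite {p\<in>PP. x \<in> p}"

text \<open>The situation at a prime of \<open>Lambda0\<close>: \<open>a\<close> generates the
  maximal ideal of the localization, and \<open>T\<close> is a finite transversal of the residue
  classes modulo \<open>P\<close>.\<close>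

locale finite_residue_prime = krull_family E PP for E :: "'a::field set" and PP +
  fixes P :: "'a set" and a :: 'a and T :: "'a set"
  assumes P: "P \<in> PP" and a: "a \<in> P" "a \<noteq> 0" and a_gen: "x \<in> P \<Longrightarrow> x / a \<in> loc E P"
    and T: "finite T" "T \<subseteq> E" and T_ex: "x \<in> E \<Longrightarrow> \<exists>t\<in>T. x - t \<in> P"
    and T_eq: "t \<in> T \<Longrightarrow> t' \<in> T \<Longrightarrow> t - t' \<in> P \<Longrightarrow> t = t'"
begin

definition V where "V = loc E P"
text \<open>The principal ideal \<open>aV\<close>; by \<open>a_gen\<close> it is the maximal ideal
  of \<open>V\<close>. Writing it as a divisibility condition makes division by \<open>a\<close>
  immediate.\<close>

definition mV where "mV = {x. x / a \<in> V}"

lemma Pp: "prime_ideal E P" using P PP_prime by blast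
lemma aE: "a \<in> E" using prime_ideal_mem[OF Pp a(1)] .
lemma V: "subring V" unfolding V_def by (rule subring_loc[OF E Pp])
lemma V_val: "valuation_domain V" unfolding V_def using P PP_val by blast
lemma V_quot: "quot_field V = quot_field E" unfolding V_def by (rule quot_field_loc[OF E Pp])
lemma E_V: "x \<in> E \<Longrightarrow> x \<in> V" unfolding V_def by (rule loc_mem[OF E Pp])
lemma V_K: "x \<in> V \<Longrightarrow> x \<in> quot_field E" using loc_sub_quot[OF Pp] by (auto simp: V_def)
lemma EK: "x \<in> E \<Longrightarrow> x \<in> quot_field E" using E_V V_K by blast

lemma mV_V: "x \<in> mV \<Longrightarrow> x \<in> V"
  using subring_mult[OF V, of "x / a" a] a by (auto simp: mV_def E_V aE)

lemma P_mV: "x \<in> P \<Longrightarrow> x \<in> mV" using a_gen by (auto simp: mV_def V_def)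

lemma unit_V: "x \<in> E \<Longrightarrow> x \<notin> P \<Longrightarrow> inverse x \<in> V"
  using inverse_mem_loc[OF E Pp, of x] prime_ideal_zero[OF Pp] by (auto simp: V_def)

lemma not_mV: "x \<in> V \<Longrightarrow> x \<notin> mV \<Longrightarrow> inverse x \<in> V"
proof -
  assume x: "x \<in> V" "x \<notin> mV"
  then obtain b s where bs: "x = b / s" "b \<in> E" "s \<in> E" "s \<notin> P" "s \<noteq> 0" by (metis V_def locE[OF _ Pp])
  have "b \<notin> P"
  proof
    assume "b \<in> P"
    then have "(b / a) / s \<in> V" using loc_divide_unit[OF E Pp a_gen] bs by (auto simp: V_def)
    then show False using x bs by (auto simp: mV_def mult.commute)
  qed
  then have "s * inverse b \<in> V" using bs unit_V E_V subring_mult[OF V] by blast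
  then have "s / b \<in> V" by (simp only: divide_inverse)
  then show ?thesis using bs by (simp only: inverse_divide)
qed

lemma mV_no_inverse: "x \<in> mV \<Longrightarrow> inverse x \<in> V \<Longrightarrow> x = 0"
proof (rule ccontr)
  assume "x \<in> mV" "inverse x \<in> V" "x \<noteq> 0"
  then have *: "x / a * inverse x \<in> V" by (intro subring_mult[OF V]) (auto simp: mV_def)
  have "x / a * inverse x = inverse a" using \<open>x \<noteq> 0\<close> a by (simp add: field_simps)
  then have "inverse a \<in> V" using * by (simp only:)
  then show False using inverse_mem_loc[OF E Pp aE a(2)] a by (auto simp: V_def)
qed

lemma mV_prime: "prime_ideal V mV"
  unfolding prime_ideal_def is_ideal_def
proof (intro conjI ballI impI)
  have one: "1 \<notin> mV" using mV_no_inverse[of 1] subring_one[OF V] by auto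
  then show "mV \<noteq> V" using subring_one[OF V] by auto
  fix x y assume xy: "x \<in> V" "y \<in> V" "x * y \<in> mV"
  show "x \<in> mV \<or> y \<in> mV"
  proof (rule ccontr)
    assume n: "\<not> (x \<in> mV \<or> y \<in> mV)"
    then have nz: "x \<noteq> 0" "y \<noteq> 0" using subring_zero[OF V] by (auto simp: mV_def)
    have "inverse (x * y) \<in> V" using n xy not_mV subring_mult[OF V] by (simp add: nonzero_inverse_mult_distrib nz)
    then show False using xy nz mV_no_inverse by fastforce
  qed
qed (auto simp: mV_V, auto simp: mV_def add_divide_distrib subring_zero[OF V] subring_add[OF V], 
   metis subring_mult[OF V] times_divide_eq_right)

lemma mV_E: "x \<in> E \<Longrightarrow> x \<in> mV \<Longrightarrow> x \<in> P"
  using unit_V[of x] mV_no_inverse[of x] prime_ideal_zero[OF Pp] by auto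

lemma aV: "a \<in> mV" using P_mV a by blast

text \<open>The representatives of \<open>E\<close> modulo \<open>P\<close> also represent
  \<open>V\<close> modulo its maximal ideal: since \<open>s ^ e\<close> is congruent to
  \<open>1\<close>, the fraction \<open>b / s\<close> is congruent to
  \<open>b * s ^ (e - 1)\<close>, an element of \<open>E\<close>.\<close>

lemma V_residue: "x \<in> V \<Longrightarrow> \<exists>t\<in>T. x - t \<in> mV"
proof -
  assume "x \<in> V"
  then obtain b s where bs: "x = b / s" "b \<in> E" "s \<in> E" "s \<notin> P" "s \<noteq> 0" by (metis V_def locE[OF _ Pp])
  obtain e where e: "e > 0" "s ^ e - 1 \<in> P"
    using finite_residue_power[OF E Pp T(1) T_ex bs(3,4)] by blast
  obtain t where t: "t \<in> T" "b * s ^ (e - 1) - t \<in> P"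
    using T_ex bs E by (meson subring_mult subring_power)
  have "(- x) * (s ^ e - 1) \<in> mV" using e \<open>x \<in> V\<close> by (intro prime_ideal_mult[OF mV_prime] P_mV subring_minus V)
  then have mem: "(- x) * (s ^ e - 1) + (b * s ^ (e - 1) - t) \<in> mV"
    using prime_ideal_add[OF mV_prime] P_mV t by blast
  have "x * s ^ e = b * s ^ (e - 1)" using bs e by (simp add: power_eq_if)
  then have "(- x) * (s ^ e - 1) + (b * s ^ (e - 1) - t) = x - t" by (simp add: algebra_simps)
  then show ?thesis using t mem by metis
qed

lemma T_mV: "t \<in> T \<Longrightarrow> t' \<in> T \<Longrightarrow> t - t' \<in> mV \<Longrightarrow> t = t'"
  using T_eq mV_E[of "t - t'"] T(2) E subring_diff by blast

section \<open>Clearing denominators away from \<open>P\<close>\<close>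

text \<open>These are the elements of \<open>E\<close> that divide a power of \<open>a\<close> in
  \<open>V\<close>. Exactly when \<open>V\<close> is discrete every nonzero element of
  \<open>E\<close> is of this kind.\<close>

definition denom where "denom d \<longleftrightarrow> d \<in> E \<and> d \<noteq> 0 \<and> (\<exists>k. a ^ k / d \<in> V)"

lemma denom_one: "denom 1"
  using subring_one[OF E] subring_one[OF V] by (auto simp: denom_def intro!: exI[of _ 0])

lemma denom_a: "denom a"
  using aE a subring_one[OF V] by (auto simp: denom_def intro!: exI[of _ 1])

lemma denom_mult: "denom d \<Longrightarrow> denom d' \<Longrightarrow> denom (d * d')"
proof -
  assume "denom d" "denom d'"
  then obtain k k' where "a ^ k / d \<in> V" "a ^ k' / d' \<in> V" "d \<in> E" "d' \<in> E" "d \<noteq> 0" "d' \<noteq> 0" by (auto simp: denom_def)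
  then show ?thesis using subring_mult[OF V, of "a ^ k / d" "a ^ k' / d'"] subring_mult[OF E]
    by (auto simp: denom_def power_add intro!: exI[of _ "k + k'"])
qed

lemma PP_incomparable: "p \<in> PP \<Longrightarrow> p \<noteq> P \<Longrightarrow> \<exists>t\<in>P. t \<notin> p"
  using finite_residue_maximal[OF E Pp T(1) T_ex PP_prime] by blast

text \<open>For another member \<open>p\<close> take \<open>t\<close> in \<open>P\<close> outside
  \<open>p\<close>. As \<open>a\<close> divides \<open>t\<close> in \<open>V\<close>, some
  \<open>t ^ k / d\<close> equals \<open>b / s\<close> with \<open>s\<close> outside
  \<open>P\<close>, and then \<open>s / d = b / t ^ k\<close> is integral at \<open>p\<close>. Only
  finitely many \<open>p\<close> contain \<open>d\<close>, so the product of these \<open>s\<close>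
  works for all of them.\<close>

lemma denom_separate:
  assumes "denom d"
  shows "\<exists>s\<in>E - P. \<forall>p\<in>PP - {P}. s / d \<in> loc E p"
proof -
  have d: "d \<in> E" "d \<noteq> 0" using assms by (auto simp: denom_def)
  obtain k where k: "a ^ k / d \<in> V" using assms by (auto simp: denom_def)
  have "\<exists>s\<in>E - P. s / d \<in> loc E p" if p: "p \<in> PP" "p \<noteq> P" for p
  proof -
    obtain t where t: "t \<in> P" "t \<notin> p" using PP_incomparable[OF p] by blast
    have "(t / a) ^ k * (a ^ k / d) \<in> V" using k a_gen[OF t(1)] by (intro subring_mult[OF V] subring_power[OF V]) (auto simp: V_def)
    then have "t ^ k / d \<in> V" using a by (simp add: power_divide)
    then obtain b s where bs: "t ^ k / d = b / s" "b \<in> E" "s \<in> E" "s \<notin> P" "s \<noteq> 0" by (metis V_def locE[OF _ Pp])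
    have tE: "t \<in> E" using t Pp prime_ideal_mem by blast
    have tk: "t ^ k \<notin> p" using prime_ideal_power[OF E PP_prime[OF p(1)] tE] t by blast
    then have "t \<noteq> 0 \<or> k = 0" using t prime_ideal_zero[OF PP_prime[OF p(1)]] by auto
    then have "s / d = b / t ^ k" using bs d by (auto simp: field_simps)
    then have "s / d \<in> loc E p" using locI[OF bs(2) subring_power[OF E tE] tk] by simp
    then show ?thesis using bs by blast
  qed
  then obtain s where s: "\<And>p. p \<in> PP \<Longrightarrow> p \<noteq> P \<Longrightarrow> s p \<in> E - P \<and> s p / d \<in> loc E p" by metis
  define F where "F = {p\<in>PP. d \<in> p} - {P}"
  have F: "finite F" using PP_finite[OF d] by (simp add: F_def)
  define z where "z = prod s F"
  have sE: "s p \<in> E" if "p \<in> F" for p using s that by (auto simp: F_def)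
  have "z \<in> E" unfolding z_def using sE by (intro subring_prod E)
  moreover have "z \<notin> P" unfolding z_def using prime_ideal_prod[OF E Pp F, of s] sE s by (auto simp: F_def)
  moreover have "z / d \<in> loc E p" if p: "p \<in> PP - {P}" for p
  proof (cases "p \<in> F")
    case True
    have Lp: "subring (loc E p)" using subring_loc[OF E PP_prime] p by blast
    have "z / d = s p / d * prod s (F - {p})" unfolding z_def using prod.remove[OF F True, of s] by simp
    moreover have "prod s (F - {p}) \<in> loc E p"
      using sE p by (intro subring_prod Lp loc_mem[OF E PP_prime]) auto
    moreover have "s p / d \<in> loc E p" using s p by blast
    ultimately show ?thesis using subring_mult[OF Lp] by metis
  next
    case False
    then have "d \<notin> p" using p by (auto simp: F_def)
    then show ?thesis using locI \<open>z \<in> E\<close> d by blast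
  qed
  ultimately show ?thesis by blast
qed

text \<open>The factor \<open>s\<close> is chosen before \<open>f\<close>, so one factor serves all
  polynomials with the same \<open>d\<close>. At \<open>P\<close> the values are integral already,
  and elsewhere \<open>s * f(x)\<close> is the product of \<open>s / d\<close> and
  \<open>d * f(x)\<close>.\<close>

lemma denom_clear:
  assumes "denom d"
  shows "\<exists>s\<in>E - P. \<forall>f\<in>poly_over (quot_field E).
    (\<forall>x\<in>E. poly f x \<in> V \<and> d * poly f x \<in> E) \<longrightarrow> smult s f \<in> IntPoly E"
proof -
  obtain s where s: "s \<in> E" "s \<notin> P" and sd: "\<forall>p\<in>PP - {P}. s / d \<in> loc E p" using denom_separate[OF assms] by blast
  have d: "d \<noteq> 0" using assms by (auto simp: denom_def)
  have "smult s f \<in> IntPoly E" if f: "f \<in> poly_over (quot_field E)"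
    and fx: "\<forall>x\<in>E. poly f x \<in> V \<and> d * poly f x \<in> E" for f
    unfolding IntPoly_iff
  proof (intro conjI ballI)
    show "smult s f \<in> poly_over (quot_field E)" using f s by (intro poly_over_smult subring_quot E EK)
    fix x assume x: "x \<in> E"
    show "poly (smult s f) x \<in> E"
    proof (rule E_int)
      have "poly f x \<in> quot_field E" using fx x V_K by blast
      then show "poly (smult s f) x \<in> quot_field E" using s by (auto intro: subring_mult[OF subring_quot[OF E]] EK)
      fix p assume p: "p \<in> PP"
      show "poly (smult s f) x \<in> loc E p"
      proof (cases "p = P")
        case True
        then show ?thesis using fx x s E_V by (auto simp flip: V_def intro: subring_mult[OF V])
      next
        case False
        have "s / d * (d * poly f x) \<in> loc E p"
        proof (rule subring_mult[OF subring_loc[OF E PP_prime[OF p]]])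
          show "s / d \<in> loc E p" using sd p False by blast
          show "d * poly f x \<in> loc E p" using fx x by (intro loc_mem[OF E PP_prime[OF p]]) blast
        qed
        then show ?thesis using d by simp
      qed
    qed
  qed
  then show ?thesis using s by blast
qed

text \<open>\<open>B\<close> is the localization of \<open>IntPoly E\<close> at \<open>E - P\<close>, described by values; see \<open>B_clear\<close>.\<close>
definition B where "B = {f\<in>poly_over (quot_field E). (\<forall>x\<in>E. poly f x \<in> V) \<and> (\<exists>d. denom d \<and> (\<forall>x\<in>E. d * poly f x \<in> E))}"

lemma B_clear: "f \<in> B \<Longrightarrow> \<exists>s\<in>E - P. smult s f \<in> IntPoly E"
proof -
  assume f: "f \<in> B"
  then obtain d where d: "denom d" "\<forall>x\<in>E. d * poly f x \<in> E" by (auto simp: B_def)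
  then obtain s where "s\<in>E - P" "\<forall>f\<in>poly_over (quot_field E).
    (\<forall>x\<in>E. poly f x \<in> V \<and> d * poly f x \<in> E) \<longrightarrow> smult s f \<in> IntPoly E"
    using denom_clear by blast
  then show ?thesis using f d by (auto simp: B_def)
qed

lemma IntPoly_B: "f \<in> IntPoly E \<Longrightarrow> f \<in> B"
  using denom_one by (auto simp: B_def IntPoly_iff E_V intro!: exI[of _ 1])

lemma B_V: "f \<in> B \<Longrightarrow> x \<in> E \<Longrightarrow> poly f x \<in> V" by (auto simp: B_def)

lemma B_const: "c \<in> E \<Longrightarrow> [:c:] \<in> B"
  by (intro IntPoly_B IntPoly_const E)

lemma B_X: "[:0, 1:] \<in> B"
  by (intro IntPoly_B poly_over_IntPoly poly_over_X E)

lemma B_diff: "f \<in> B \<Longrightarrow> g \<in> B \<Longrightarrow> f - g \<in> B"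
  and B_mult: "f \<in> B \<Longrightarrow> g \<in> B \<Longrightarrow> f * g \<in> B"
proof -
  assume fg: "f \<in> B" "g \<in> B"
  then obtain d d' where d: "denom d" "\<And>x. x \<in> E \<Longrightarrow> d * poly f x \<in> E"
     and d': "denom d'" "\<And>x. x \<in> E \<Longrightarrow> d' * poly g x \<in> E" by (auto simp: B_def)
  have dE: "d \<in> E" "d' \<in> E" using d d' by (auto simp: denom_def)
  have 1: "d * d' * poly (f - g) x = d' * (d * poly f x) - d * (d' * poly g x)"
     "d * d' * poly (f * g) x = (d * poly f x) * (d' * poly g x)" for x by (auto simp: algebra_simps)
  have "d * d' * poly (f - g) x \<in> E" "d * d' * poly (f * g) x \<in> E" if "x \<in> E" for x
    unfolding 1 using d(2)[OF that] d'(2)[OF that] dE by (blast intro: subring_diff[OF E] subring_mult[OF E])+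
  moreover have "f - g \<in> poly_over (quot_field E)" "f * g \<in> poly_over (quot_field E)"
    using fg by (auto simp: B_def intro!: poly_over_diff poly_over_mult subring_quot E)
  moreover have "\<forall>x\<in>E. poly (f - g) x \<in> V" "\<forall>x\<in>E. poly (f * g) x \<in> V"
    using fg by (auto simp: B_def intro!: subring_diff[OF V] subring_mult[OF V])
  ultimately show "f - g \<in> B" "f * g \<in> B" using denom_mult[OF d(1) d'(1)] unfolding B_def by blast+
qed

lemma B_one: "1 \<in> B" using B_const[OF subring_one[OF E]] by (simp add: one_pCons)

lemma B_prod: "(\<And>i. i \<in> I \<Longrightarrow> f i \<in> B) \<Longrightarrow> prod f I \<in> B"
  by (induction I rule: infinite_finite_induct) (auto intro: B_one B_mult)

lemma B_power: "f \<in> B \<Longrightarrow> f ^ n \<in> B"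
  by (induction n) (auto intro: B_one B_mult)

lemma B_divide:
  assumes "f \<in> B" "denom c" "\<And>x. x \<in> E \<Longrightarrow> poly f x / c \<in> V"
  shows "smult (1/c) f \<in> B"
proof -
  obtain d where d: "denom d" "\<And>x. x \<in> E \<Longrightarrow> d * poly f x \<in> E" using assms by (auto simp: B_def)
  have c: "c \<in> E" "c \<noteq> 0" using assms by (auto simp: denom_def)
  have "1 / c \<in> quot_field E" using c E by (intro quot_fieldI subring_one)
  then have "smult (1/c) f \<in> poly_over (quot_field E)"
    using assms by (auto simp: B_def intro!: poly_over_smult subring_quot E)
  then show ?thesis using assms(3) denom_mult[OF d(1) assms(2)] d(2) c
    by (auto simp: B_def intro!: exI[of _ "d * c"])
qed

end

subsection \<open>Indicator polynomials of residue classes\<close>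

context finite_residue_prime begin

text \<open>Since \<open>T\<close> meets every residue class of \<open>V\<close>, the product always
  takes values in \<open>aV\<close>, so the quotient by \<open>a\<close> has values in
  \<open>V\<close> again and the construction can be repeated.\<close>

fun theta :: "nat \<Rightarrow> 'a poly" where
  "theta 0 = [:0, 1:]"
| "theta (Suc i) = smult (1 / a) (\<Prod>t\<in>T. theta i - [:t:])"

lemma V_diff_T: "x \<in> V \<Longrightarrow> t \<in> T \<Longrightarrow> x - t \<in> V"
  using T(2) E_V subring_diff[OF V] by blast

lemma prod_T_mV: "x \<in> V \<Longrightarrow> (\<Prod>t\<in>T. x - t) \<in> mV"
proof -
  assume x: "x \<in> V"
  obtain t where t: "t \<in> T" "x - t \<in> mV" using V_residue[OF x] by blast
  have "(\<Prod>t\<in>T - {t}. x - t) \<in> V" using x V_diff_T by (intro subring_prod V) auto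
  then have "(x - t) * (\<Prod>t\<in>T - {t}. x - t) \<in> mV" using t prime_ideal_mult2[OF mV_prime] by blast
  then show ?thesis using prod.remove[OF T(1) t(1)] by metis
qed

lemma poly_theta_Suc: "poly (theta (Suc i)) x = (\<Prod>t\<in>T. poly (theta i) x - t) / a"
  by (simp add: poly_prod)

lemma theta_B: "theta i \<in> B"
proof (induction i)
  case (Suc i)
  have "(\<Prod>t\<in>T. theta i - [:t:]) \<in> B" using Suc T by (intro B_prod B_diff B_const) auto
  moreover have "poly (\<Prod>t\<in>T. theta i - [:t:]) x / a \<in> V" if "x \<in> E" for x
    using prod_T_mV[OF B_V[OF Suc that]] by (simp add: poly_prod mV_def)
  ultimately show ?case unfolding theta.simps by (intro B_divide denom_a)
qed (simp add: B_X)

lemma prod_diff_factor: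
  assumes "finite S" "S \<subseteq> V" "x \<in> V" "y \<in> V"
  shows "\<exists>w\<in>V. (\<Prod>t\<in>S. x - t) - (\<Prod>t\<in>S. y - t) = (x - y) * w"
  using assms(1,2)
proof (induction S rule: finite_induct)
  case empty
  then show ?case using subring_zero[OF V] by auto
next
  case (insert t S)
  then obtain w where w: "w \<in> V" "(\<Prod>t\<in>S. x - t) - (\<Prod>t\<in>S. y - t) = (x - y) * w" by auto
  have "(\<Prod>t\<in>S. x - t) + (y - t) * w \<in> V"
    using insert w assms by (intro subring_add[OF V] subring_mult[OF V] subring_prod[OF V] subring_diff[OF V]) auto
  moreover have "(x - t) * (\<Prod>t\<in>S. x - t) - (y - t) * (\<Prod>t\<in>S. y - t)
      = (x - y) * (\<Prod>t\<in>S. x - t) + (y - t) * ((\<Prod>t\<in>S. x - t) - (\<Prod>t\<in>S. y - t))"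
    by (simp add: algebra_simps)
  then have "(x - t) * (\<Prod>t\<in>S. x - t) - (y - t) * (\<Prod>t\<in>S. y - t)
      = (x - y) * ((\<Prod>t\<in>S. x - t) + (y - t) * w)"
    unfolding w(2) by (simp add: algebra_simps)
  ultimately show ?case using insert by auto
qed

text \<open>On each residue class the map \<open>x \<mapsto> (\<Prod>t\<in>T. x - t) / a\<close> lowers the valuation of differences by
  exactly that of \<open>a\<close>, since all factors but one are units there. Hence its iterates read off the
  \<open>a\<close>-adic digits of the argument.\<close>
lemma theta_step_diff:
  assumes xy: "x \<in> V" "y \<in> V" and t: "t \<in> T" "x - t \<in> mV" "y - t \<in> mV"
  shows "\<exists>u\<in>V. inverse u \<in> V \<and> u \<noteq> 0 \<and> (\<Prod>t\<in>T. x - t) / a - (\<Prod>t\<in>T. y - t) / a = (x - y) / a * u"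
proof -
  let ?G = "\<lambda>x. \<Prod>t\<in>T - {t}. x - t"
  obtain w where w: "w \<in> V" "?G x - ?G y = (x - y) * w"
    using prod_diff_factor[of "T - {t}" x y] T xy E_V by blast
  define u where "u = ?G x + (y - t) * w"
  have GV: "?G x \<in> V" using xy T V_diff_T by (intro subring_prod V) auto
  have "?G x \<notin> mV"
  proof
    assume "?G x \<in> mV"
    then obtain t' where t': "t' \<in> T - {t}" "x - t' \<in> mV"
      using prime_ideal_prod[OF V mV_prime, of "T - {t}" "\<lambda>t. x - t"] T xy V_diff_T by auto
    then have "(x - t') - (x - t) \<in> mV" using t prime_ideal_diff[OF V mV_prime] by blast
    then have "t - t' \<in> mV" by simp
    then show False using T_mV t t' by blast
  qed
  moreover have r: "(y - t) * w \<in> mV" using t w prime_ideal_mult2[OF mV_prime] by blast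
  ultimately have um: "u \<notin> mV" unfolding u_def
    using prime_ideal_diff[OF V mV_prime _ r] by fastforce
  have uV: "u \<in> V" unfolding u_def using GV r mV_V V subring_add by blast
  have "u \<noteq> 0" using um prime_ideal_zero[OF mV_prime] by auto
  have "(\<Prod>t\<in>T. x - t) - (\<Prod>t\<in>T. y - t) = (x - t) * ?G x - (y - t) * ?G y"
    using prod.remove[OF T(1) t(1)] by metis
  also have "\<dots> = (x - y) * ?G x + (y - t) * (?G x - ?G y)" by (simp add: algebra_simps)
  also have "\<dots> = (x - y) * u" unfolding w(2) u_def by (simp add: algebra_simps)
  finally have "(\<Prod>t\<in>T. x - t) / a - (\<Prod>t\<in>T. y - t) / a = (x - y) / a * u"
    by (metis diff_divide_distrib times_divide_eq_left)
  then show ?thesis using uV um not_mV \<open>u \<noteq> 0\<close> by blast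
qed

definition digits :: "(nat \<Rightarrow> 'a) \<Rightarrow> nat \<Rightarrow> 'a \<Rightarrow> bool" where
  "digits \<tau> n x \<longleftrightarrow> (\<forall>i<n. poly (theta i) x - \<tau> i \<in> mV)"

text \<open>If the first \<open>n\<close> digits agree, \<open>theta_step_diff\<close> applies at
  each of the \<open>n\<close> levels, and each level contributes one factor \<open>a\<close> to the
  difference of the arguments.\<close>

lemma digits_separate:
  assumes \<tau>: "\<And>i. \<tau> i \<in> T" and xy: "x \<in> E" "y \<in> E" and d: "digits \<tau> n x" "digits \<tau> n y"
  shows "(x - y) / a ^ n \<in> V"
proof -
  \<comment> \<open>The induction starts at the last iterate, where the difference is merely in
    \<open>V\<close>, and descends to \<open>theta 0\<close>, which is the identity.\<close>
  have "(poly (theta (n - k)) x - poly (theta (n - k)) y) / a ^ k \<in> V" if "k \<le> n" for k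
    using that
  proof (induction k)
    case 0
    then show ?case using B_V[OF theta_B] xy subring_diff[OF V] by simp
  next
    case (Suc k)
    define i where "i = n - Suc k"
    have i: "n - k = Suc i" "i < n" using Suc by (auto simp: i_def)
    let ?x = "poly (theta i) x" and ?y = "poly (theta i) y"
    obtain u where u: "u \<in> V" "inverse u \<in> V" "u \<noteq> 0"
      "poly (theta (Suc i)) x - poly (theta (Suc i)) y = (?x - ?y) / a * u"
      using theta_step_diff[of ?x ?y "\<tau> i"] B_V[OF theta_B] xy \<tau> d i
      unfolding digits_def poly_theta_Suc by blast
    have "(?x - ?y) / a ^ Suc k = (poly (theta (Suc i)) x - poly (theta (Suc i)) y) / a ^ k * inverse u"
      unfolding u(4) using u(3) a(2) by (simp add: divide_simps mult_ac)
    also have "\<dots> \<in> V" using Suc u i by (intro subring_mult[OF V]) auto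
    finally show ?case by (simp add: i_def)
  qed
  from this[of n] show ?thesis by simp
qed

definition char_poly :: "(nat \<Rightarrow> 'a) \<Rightarrow> nat \<Rightarrow> 'a poly" where
  "char_poly \<tau> n = (\<Prod>i<n. \<Prod>t\<in>T - {\<tau> i}. theta i - [:t:])"

lemma char_poly_B: "char_poly \<tau> n \<in> B"
  unfolding char_poly_def using T by (intro B_prod B_diff theta_B B_const) auto

lemma poly_char_poly: "poly (char_poly \<tau> n) x = (\<Prod>i<n. \<Prod>t\<in>T - {\<tau> i}. poly (theta i) x - t)"
  by (simp add: char_poly_def poly_prod)

text \<open>At level \<open>i\<close> exactly one factor over the whole of \<open>T\<close> is a
  nonunit, namely the one for the digit of \<open>x\<close>. Omitting \<open>\<tau> i\<close>
  therefore leaves a unit precisely when that digit is \<open>\<tau> i\<close>.\<close>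

lemma char_poly_digits:
  assumes \<tau>: "\<And>i. \<tau> i \<in> T" and x: "x \<in> E"
  shows "poly (char_poly \<tau> n) x \<notin> mV \<longleftrightarrow> digits \<tau> n x"
proof -
  have thV: "poly (theta i) x - t \<in> V" if "t \<in> T" for i t using that V_diff_T B_V[OF theta_B x] by blast
  have inner: "(\<Prod>t\<in>T - {\<tau> i}. poly (theta i) x - t) \<in> V" for i using thV by (intro subring_prod V) auto
  have "(\<Prod>t\<in>T - {\<tau> i}. poly (theta i) x - t) \<in> mV \<longleftrightarrow> poly (theta i) x - \<tau> i \<notin> mV" for i
  proof -
    obtain t where t: "t \<in> T" "poly (theta i) x - t \<in> mV" using V_residue B_V[OF theta_B x] by blast
    have uniq: "t' = t" if "t' \<in> T" "poly (theta i) x - t' \<in> mV" for t'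
      using prime_ideal_diff[OF V mV_prime that(2) t(2)] T_mV t that by (auto simp: algebra_simps)
    have "(\<Prod>t\<in>T - {\<tau> i}. poly (theta i) x - t) \<in> mV \<longleftrightarrow> (\<exists>t\<in>T - {\<tau> i}. poly (theta i) x - t \<in> mV)" (is "?p \<in> mV \<longleftrightarrow> ?r")
    proof
      assume "?p \<in> mV"
      then show ?r using prime_ideal_prod[OF V mV_prime, of "T - {\<tau> i}" "\<lambda>t. poly (theta i) x - t"] T thV by auto
    next
      assume ?r
      then obtain t where t: "t \<in> T - {\<tau> i}" "poly (theta i) x - t \<in> mV" by blast
      have "(\<Prod>t\<in>T - {\<tau> i} - {t}. poly (theta i) x - t) \<in> V" using thV by (intro subring_prod V) auto
      then have "(poly (theta i) x - t) * (\<Prod>t\<in>T - {\<tau> i} - {t}. poly (theta i) x - t) \<in> mV"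
        using t prime_ideal_mult2[OF mV_prime] by blast
      then show "?p \<in> mV" using prod.remove[OF _ t(1), of "\<lambda>t. poly (theta i) x - t"] T(1) by simp
    qed
    then show ?thesis using t uniq \<tau> by blast
  qed
  note in_iff = this
  have "poly (char_poly \<tau> n) x \<in> mV \<longleftrightarrow> (\<exists>i<n. (\<Prod>t\<in>T - {\<tau> i}. poly (theta i) x - t) \<in> mV)"
  proof
    assume "poly (char_poly \<tau> n) x \<in> mV"
    then show "\<exists>i<n. (\<Prod>t\<in>T - {\<tau> i}. poly (theta i) x - t) \<in> mV"
      using prime_ideal_prod[OF V mV_prime, of "{..<n}" "\<lambda>i. \<Prod>t\<in>T - {\<tau> i}. poly (theta i) x - t"] inner
      unfolding poly_char_poly by blast
  next
    assume "\<exists>i<n. (\<Prod>t\<in>T - {\<tau> i}. poly (theta i) x - t) \<in> mV"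
    then obtain i where i: "i \<in> {..<n}" "(\<Prod>t\<in>T - {\<tau> i}. poly (theta i) x - t) \<in> mV" by blast
    have "(\<Prod>j\<in>{..<n} - {i}. \<Prod>t\<in>T - {\<tau> j}. poly (theta j) x - t) \<in> V" using inner by (intro subring_prod[OF V, of "{..<n} - {i}"])
    then show "poly (char_poly \<tau> n) x \<in> mV"
      unfolding poly_char_poly prod.remove[OF finite_lessThan i(1)]
      using prime_ideal_mult2[OF mV_prime _ i(2)] by blast
  qed
  then show ?thesis unfolding digits_def in_iff by blast
qed

end

subsection \<open>Primes of the ring of integer-valued polynomials\<close>

text \<open>Primes are handled as sets of polynomials, so that evaluation at points of
  \<open>E\<close> is available; \<open>trace_poly\<close> translates from primes of
  \<open>IntDom E\<close>.\<close>

definition int_prime :: "'a::field set \<Rightarrow> 'a poly set \<Rightarrow> bool" where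
  "int_prime E M \<longleftrightarrow> M \<subseteq> IntPoly E \<and> 1 \<notin> M \<and> (\<forall>f\<in>M. \<forall>g\<in>M. f + g \<in> M) \<and>
    (\<forall>r\<in>IntPoly E. \<forall>f\<in>M. r * f \<in> M) \<and>
    (\<forall>f\<in>IntPoly E. \<forall>g\<in>IntPoly E. f * g \<in> M \<longrightarrow> f \<in> M \<or> g \<in> M)"

text \<open>The hypothesis of \<open>valuation_loc_criterion\<close> expressed for integer-valued
  polynomials.\<close>

definition comparable_at :: "'a::field set \<Rightarrow> 'a poly set \<Rightarrow> bool" where
  "comparable_at E M \<longleftrightarrow> (\<forall>A\<in>IntPoly E. \<forall>B\<in>IntPoly E. A \<noteq> 0 \<longrightarrow> B \<noteq> 0 \<longrightarrow>
    (\<exists>C\<in>IntPoly E. \<exists>C'\<in>IntPoly E. A * C' = B * C \<and> (C \<notin> M \<or> C' \<notin> M)))"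

definition trace_poly :: "'a::field set \<Rightarrow> 'a poly fract set \<Rightarrow> 'a poly set" where
  "trace_poly E N = {g\<in>IntPoly E. Fract g 1 \<in> N}"

lemma Fract_inj: "Fract g 1 = Fract h 1 \<longleftrightarrow> g = h" for g h :: "'b::idom"
  by (simp add: eq_fract)

lemma Fract_mult: "Fract g 1 * Fract h 1 = Fract (g * h) 1" for g h :: "'b::idom"
  by simp

lemma Fract_zero: "Fract g 1 = 0 \<longleftrightarrow> g = 0" for g :: "'b::idom"
  by (simp add: Zero_fract_def eq_fract)

lemma IntDom_iff: "Fract g 1 \<in> IntDom E \<longleftrightarrow> g \<in> IntPoly E"
  by (auto simp: IntDom_def Fract_inj)

lemma IntDomE: "x \<in> IntDom E \<Longrightarrow> (\<And>g. x = Fract g 1 \<Longrightarrow> g \<in> IntPoly E \<Longrightarrow> thesis) \<Longrightarrow> thesis"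
  by (auto simp: IntDom_def)

lemma IntPoly_one: "subring E \<Longrightarrow> 1 \<in> IntPoly E"
  using IntPoly_const[of E 1] by (simp add: one_pCons subring_one)

lemma IntPoly_zero: "subring E \<Longrightarrow> 0 \<in> IntPoly E"
  using IntPoly_const[of E 0] by (simp add: subring_zero)

lemma subring_IntDom:
  assumes "subring E"
  shows "subring (IntDom E)"
  unfolding subring_def
proof (intro conjI ballI)
  show "0 \<in> IntDom E" "1 \<in> IntDom E" using IntDom_iff[of _ E] IntPoly_zero[OF assms] IntPoly_one[OF assms]
    by (auto simp: Zero_fract_def One_fract_def)
  fix x y assume "x \<in> IntDom E" "y \<in> IntDom E"
  then show "x + y \<in> IntDom E" "x - y \<in> IntDom E" "x * y \<in> IntDom E"
    using IntPoly_add[OF assms] IntPoly_diff[OF assms] IntPoly_mult[OF assms]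
    by (auto elim!: IntDomE simp: IntDom_iff)
qed

lemma int_prime_trace:
  assumes E: "subring E" and N: "prime_ideal (IntDom E) N"
  shows "int_prime E (trace_poly E N)"
  unfolding int_prime_def
proof (intro conjI ballI impI)
  show "1 \<notin> trace_poly E N" using prime_ideal_one[OF N] by (simp add: trace_poly_def One_fract_def)
next
  fix f g assume "f \<in> trace_poly E N" "g \<in> trace_poly E N"
  then show "f + g \<in> trace_poly E N"
    using prime_ideal_add[OF N, of "Fract f 1" "Fract g 1"] IntPoly_add[OF E] by (simp add: trace_poly_def)
next
  fix f g assume "f \<in> IntPoly E" "g \<in> trace_poly E N"
  then show "f * g \<in> trace_poly E N"
    using prime_ideal_mult[OF N, of "Fract f 1" "Fract g 1"] IntPoly_mult[OF E] by (simp add: trace_poly_def IntDom_iff)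
next
  fix f g assume "f \<in> IntPoly E" "g \<in> IntPoly E" "f * g \<in> trace_poly E N"
  then show "f \<in> trace_poly E N \<or> g \<in> trace_poly E N"
    using prime_ideal_prime[OF N, of "Fract f 1" "Fract g 1"] by (simp add: trace_poly_def IntDom_iff)
qed (auto simp: trace_poly_def)

lemma valuation_loc_IntDom:
  assumes E: "subring E" and N: "prime_ideal (IntDom E) N" and c: "comparable_at E (trace_poly E N)"
  shows "valuation_domain (loc (IntDom E) N)"
proof (rule valuation_loc_criterion[OF subring_IntDom[OF E] N])
  fix x y assume xy: "x \<in> IntDom E" "y \<in> IntDom E" "x \<noteq> 0" "y \<noteq> 0"
  then obtain A B where AB: "x = Fract A 1" "A \<in> IntPoly E" "y = Fract B 1" "B \<in> IntPoly E" by (metis IntDomE)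
  then have "A \<noteq> 0" "B \<noteq> 0" using xy by (auto simp: Fract_zero)
  then obtain C C' where C: "C \<in> IntPoly E" "C' \<in> IntPoly E" "A * C' = B * C" "C \<notin> trace_poly E N \<or> C' \<notin> trace_poly E N"
    using c AB unfolding comparable_at_def by meson
  have "Fract C 1 \<in> IntDom E" "Fract C' 1 \<in> IntDom E" "x * Fract C' 1 = y * Fract C 1"
    "Fract C 1 \<notin> N \<or> Fract C' 1 \<notin> N"
    using C AB by (auto simp: IntDom_iff trace_poly_def)
  then show "\<exists>C\<in>IntDom E. \<exists>C'\<in>IntDom E. x * C' = y * C \<and> (C \<notin> N \<or> C' \<notin> N)" by blast
qed

lemma quot_IntDom:
  assumes E: "subring E" and f: "f \<in> poly_over (quot_field E)"
  shows "Fract f 1 \<in> quot_field (IntDom E)"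
proof -
  obtain s where s: "s \<in> E" "s \<noteq> 0" "smult s f \<in> poly_over E"
    using poly_over_denominator[OF E, of "{f}"] f by auto
  have eq: "Fract f 1 = Fract (smult s f) 1 / Fract [:s:] 1"
    using s by (simp add: eq_fract)
  show ?thesis unfolding eq using s poly_over_IntPoly[OF E s(3)] IntPoly_const[OF E s(1)]
    by (intro quot_fieldI) (auto simp: IntDom_iff Fract_zero)
qed

text \<open>The Bezout relation over the quotient field is multiplied by the square of a common
  denominator, so a nonzero constant \<open>c\<close> takes the place of \<open>1\<close>.\<close>

lemma IntPoly_bezout:
  assumes E: "subring E" and AB: "A \<in> IntPoly E" "B \<in> IntPoly E"
  shows "\<exists>A'\<in>poly_over E. \<exists>B'\<in>poly_over E. \<exists>u\<in>poly_over E. \<exists>w\<in>poly_over E. \<exists>c\<in>E - {0}.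
    u * A' + w * B' = [:c:] \<and> A * B' = B * A'"
proof -
  obtain A' B' u w where *: "A' \<in> poly_over (quot_field E)" "B' \<in> poly_over (quot_field E)"
    "u \<in> poly_over (quot_field E)" "w \<in> poly_over (quot_field E)" "u * A' + w * B' = 1" "A * B' = B * A'"
    using poly_over_bezout[OF subring_quot[OF E] quot_inverse[OF E] IntPoly_over_quot[OF AB(1)] IntPoly_over_quot[OF AB(2)]]
    by blast
  obtain s where s: "s \<in> E" "s \<noteq> 0" "smult s A' \<in> poly_over E" "smult s B' \<in> poly_over E"
      "smult s u \<in> poly_over E" "smult s w \<in> poly_over E"
    using poly_over_denominator[OF E, of "{A', B', u, w}"] * by auto
  have "smult s u * smult s A' + smult s w * smult s B' = smult (s * s) (u * A' + w * B')"
    by (simp add: smult_add_right)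
  also have "\<dots> = [:s * s:]" using *(5) by (simp add: one_pCons)
  finally have "smult s u * smult s A' + smult s w * smult s B' = [:s * s:]" .
  moreover have "A * smult s B' = B * smult s A'" using * by simp
  moreover have "s * s \<in> E - {0}" using s subring_mult[OF E] by auto
  ultimately show ?thesis using s by blast
qed

text \<open>If both Bezout cofactors were in \<open>M\<close>, so would be the nonzero constant that
  they generate.\<close>

lemma comparable_at_generic:
  assumes E: "subring E" and M: "int_prime E M" and no: "\<And>c. c \<in> E \<Longrightarrow> c \<noteq> 0 \<Longrightarrow> [:c:] \<notin> M"
  shows "comparable_at E M"
  unfolding comparable_at_def
proof (intro ballI impI)
  fix A B assume "A \<in> IntPoly E" "B \<in> IntPoly E"
  then obtain A' B' u w c where *: "A' \<in> poly_over E" "B' \<in> poly_over E" "u \<in> poly_over E" "w \<in> poly_over E"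
     "c \<in> E - {0}" "u * A' + w * B' = [:c:]" "A * B' = B * A'"
    using IntPoly_bezout[OF E] by blast
  note I = poly_over_IntPoly[OF E]
  have "A' \<notin> M \<or> B' \<notin> M"
  proof (rule ccontr)
    assume "\<not> (A' \<notin> M \<or> B' \<notin> M)"
    then have "A' \<in> M" "B' \<in> M" by auto
    then have "u * A' \<in> M" "w * B' \<in> M" using M I[OF *(3)] I[OF *(4)] by (auto simp: int_prime_def)
    then have "u * A' + w * B' \<in> M" using M unfolding int_prime_def by blast
    then show False using no * by auto
  qed
  then show "\<exists>C\<in>IntPoly E. \<exists>C'\<in>IntPoly E. A * C' = B * C \<and> (C \<notin> M \<or> C' \<notin> M)"
    using *(7) I[OF *(1)] I[OF *(2)] by (intro bexI[of _ A'] bexI[of _ B']) auto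
qed

lemma poly_diff_factor:
  assumes R: "subring R" and "f \<in> poly_over R" "x \<in> R" "y \<in> R"
  shows "\<exists>w\<in>R. poly f x - poly f y = (x - y) * w"
  using assms(2)
proof (induction f)
  case 0
  then show ?case using subring_zero[OF R] by auto
next
  case (pCons c f)
  have "coeff (pCons c f) (Suc i) \<in> R" "coeff (pCons c f) 0 \<in> R" for i
    using pCons.prems unfolding poly_over_def by blast+
  then have f: "f \<in> poly_over R" "c \<in> R" by (auto simp: poly_over_def)
  then obtain w where w: "w \<in> R" "poly f x - poly f y = (x - y) * w" using pCons.IH by blast
  have "poly (pCons c f) x - poly (pCons c f) y = (x - y) * poly f x + y * (poly f x - poly f y)"
    by (simp add: algebra_simps)
  also have "\<dots> = (x - y) * (poly f x + y * w)" unfolding w(2) by (simp add: algebra_simps)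
  finally show ?case using w f assms R by (metis poly_over_eval subring_add subring_mult)
qed

section \<open>Primes of \<open>IntPoly E\<close> lying over a discrete member of the family\<close>

locale dvr_int_prime = finite_residue_prime +
  fixes M :: "'a poly set"
  assumes dvr: "x \<in> E \<Longrightarrow> x \<noteq> 0 \<Longrightarrow> denom x"
    and M: "int_prime E M" and M_const: "c \<in> E \<Longrightarrow> [:c:] \<in> M \<longleftrightarrow> c \<in> P"
begin

lemma M_add: "f \<in> M \<Longrightarrow> g \<in> M \<Longrightarrow> f + g \<in> M"
  and M_mult: "r \<in> IntPoly E \<Longrightarrow> f \<in> M \<Longrightarrow> r * f \<in> M"
  and M_prime: "f \<in> IntPoly E \<Longrightarrow> g \<in> IntPoly E \<Longrightarrow> f * g \<in> M \<Longrightarrow> f \<in> M \<or> g \<in> M"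
  using M by (auto simp: int_prime_def)

lemma M_smult: "c \<in> E \<Longrightarrow> f \<in> M \<Longrightarrow> smult c f \<in> M"
  using M_mult[OF IntPoly_const[OF E]] by fastforce

text \<open>The extension of \<open>M\<close> to the localization \<open>B\<close>. The digit
  polynomials \<open>theta i\<close> and \<open>char_poly\<close> are known to lie only in
  \<open>B\<close>, so the digits of \<open>M\<close> have to be read there.\<close>

definition M' where "M' = {f\<in>B. \<exists>s\<in>E - P. smult s f \<in> M}"

lemma notP_mult: "s \<in> E - P \<Longrightarrow> t \<in> E - P \<Longrightarrow> s * t \<in> E - P"
  using prime_ideal_prime[OF Pp] subring_mult[OF E] by blast

lemma M'_diff: "f \<in> M' \<Longrightarrow> g \<in> M' \<Longrightarrow> f - g \<in> M'"
proof -
  assume fg: "f \<in> M'" "g \<in> M'"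
  then obtain s t where st: "s \<in> E - P" "t \<in> E - P" "smult s f \<in> M" "smult t g \<in> M" by (auto simp: M'_def)
  have "smult t (smult s f) + smult (- s) (smult t g) \<in> M"
    using st M_smult M_add subring_minus[OF E] by blast
  also have "smult t (smult s f) + smult (- s) (smult t g) = smult (s * t) (f - g)"
    by (simp add: smult_diff_right mult.commute)
  finally show ?thesis using fg notP_mult[OF st(1,2)] B_diff by (auto simp: M'_def)
qed

lemma M'_prime: "f \<in> B \<Longrightarrow> g \<in> B \<Longrightarrow> f * g \<in> M' \<Longrightarrow> f \<in> M' \<or> g \<in> M'"
proof -
  assume fg: "f \<in> B" "g \<in> B" "f * g \<in> M'"
  obtain s where s: "s \<in> E - P" "smult s f \<in> IntPoly E" using B_clear fg by blast
  obtain t where t: "t \<in> E - P" "smult t g \<in> IntPoly E" using B_clear fg by blast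
  obtain r where r: "r \<in> E - P" "smult r (f * g) \<in> M" using fg by (auto simp: M'_def)
  have "smult (s * t) (smult r (f * g)) \<in> M" using s t r M_smult subring_mult[OF E] by blast
  also have "smult (s * t) (smult r (f * g)) = smult r (smult s f) * smult t g" by (simp add: mult_ac)
  finally have "smult r (smult s f) \<in> M \<or> smult t g \<in> M"
    using M_prime s t r IntPoly_smult[OF E] by blast
  then show ?thesis using fg s t notP_mult[OF r(1) s(1)] by (auto simp: M'_def)
qed

lemma M'_one: "1 \<notin> M'"
proof
  assume "1 \<in> M'"
  then obtain s where "s \<in> E - P" "smult s 1 \<in> M" by (auto simp: M'_def)
  then show False using M_const[of s] by (simp add: one_pCons)
qed

lemma M'_const: "c \<in> E \<Longrightarrow> [:c:] \<in> M' \<Longrightarrow> c \<in> P"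
proof -
  assume c: "c \<in> E" "[:c:] \<in> M'"
  then obtain s where s: "s \<in> E - P" "smult s [:c:] \<in> M" by (auto simp: M'_def)
  then have "s * c \<in> P" using M_const[of "s * c"] c subring_mult[OF E] by simp
  then show ?thesis using s c prime_ideal_prime[OF Pp, of s c] by blast
qed

lemma M'_prod: "finite I \<Longrightarrow> (\<And>i. i \<in> I \<Longrightarrow> f i \<in> B) \<Longrightarrow> prod f I \<in> M' \<Longrightarrow> \<exists>i\<in>I. f i \<in> M'"
proof (induction I rule: finite_induct)
  case (insert i I)
  then show ?case using M'_prime[of "f i" "prod f I"] B_prod[of I f] by auto
qed (simp add: M'_one)

lemma M'_power: "f \<in> B \<Longrightarrow> f ^ n \<in> M' \<Longrightarrow> f \<in> M'"
  using M'_prod[of "{..<n}" "\<lambda>_. f"] by auto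

text \<open>Such an \<open>f\<close> is \<open>a\<close> times an element of \<open>B\<close>, and
  the constant \<open>a\<close> belongs to \<open>M\<close> because \<open>M\<close> lies over
  \<open>P\<close>.\<close>

lemma M'_vanish:
  assumes f: "f \<in> B" "\<And>x. x \<in> E \<Longrightarrow> poly f x \<in> mV"
  shows "f \<in> M'"
proof -
  have "smult (1/a) f \<in> B" using f denom_a by (intro B_divide) (auto simp: mV_def)
  then obtain s where s: "s \<in> E - P" "smult s (smult (1/a) f) \<in> IntPoly E" using B_clear by blast
  have "smult s (smult (1/a) f) * [:a:] \<in> M" using M_mult[OF s(2)] M_const[OF aE] a by blast
  moreover have "smult s (smult (1/a) f) * [:a:] = smult s f" using a by simp
  ultimately show ?thesis using s f by (auto simp: M'_def)
qed

text \<open>The product of all \<open>f - t\<close> takes values in \<open>aV\<close>, hence lies in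
  the prime \<open>M'\<close>, and so does one of its factors. Thus \<open>M'\<close> has the same
  finite residue field as \<open>P\<close>.\<close>

lemma M'_class:
  assumes f: "f \<in> B"
  shows "\<exists>t\<in>T. f - [:t:] \<in> M'"
proof -
  have B: "f - [:t:] \<in> B" if "t \<in> T" for t using f that T by (intro B_diff B_const) auto
  have "(\<Prod>t\<in>T. f - [:t:]) \<in> M'"
    using prod_T_mV[OF B_V[OF f]] by (intro M'_vanish B_prod B) (auto simp: poly_prod)
  then show ?thesis using M'_prod[OF T(1), of "\<lambda>t. f - [:t:]"] B by blast
qed

lemma M'_class_unique: "t \<in> T \<Longrightarrow> t' \<in> T \<Longrightarrow> f - [:t:] \<in> M' \<Longrightarrow> f - [:t':] \<in> M' \<Longrightarrow> t = t'"
proof -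
  assume *: "t \<in> T" "t' \<in> T" "f - [:t:] \<in> M'" "f - [:t':] \<in> M'"
  have "(f - [:t':]) - (f - [:t:]) \<in> M'" using * M'_diff by blast
  then have "[:t - t':] \<in> M'" by simp
  then have "t - t' \<in> P" using M'_const * T subring_diff[OF E] by blast
  then show ?thesis using T_eq * by blast
qed

text \<open>\<open>M'\<close> behaves like the ideal of functions that are nonunits near a point of the completion
  of \<open>V\<close>: for every \<open>n\<close> it singles out one residue class modulo \<open>a ^ n\<close>.\<close>
lemma M'_digits:
  obtains \<tau> where "\<And>i. \<tau> i \<in> T" "\<And>n. char_poly \<tau> n \<notin> M'"
proof -
  obtain \<tau> where \<tau>: "\<And>i. \<tau> i \<in> T" "\<And>i. theta i - [:\<tau> i:] \<in> M'"
    using M'_class[OF theta_B] by metis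
  have B: "theta i - [:t:] \<in> B" if "t \<in> T" for i t using that T by (intro B_diff theta_B B_const) auto
  have "char_poly \<tau> n \<notin> M'" for n
  proof
    assume "char_poly \<tau> n \<in> M'"
    then obtain i where "(\<Prod>t\<in>T - {\<tau> i}. theta i - [:t:]) \<in> M'"
      unfolding char_poly_def using M'_prod[of "{..<n}" "\<lambda>i. \<Prod>t\<in>T - {\<tau> i}. theta i - [:t:]"] B B_prod[of "T - {\<tau> i}" "\<lambda>t. theta i - [:t:]" for i]
      by auto
    then obtain t where "t \<in> T - {\<tau> i}" "theta i - [:t:] \<in> M'"
      using M'_prod[of "T - {\<tau> i}" "\<lambda>t. theta i - [:t:]"] T B by auto
    then show False using M'_class_unique \<tau> by blast
  qed
  then show ?thesis using that \<tau> by blast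
qed

text \<open>On the residue class of \<open>c\<close> modulo \<open>a ^ n\<close> the values of
  \<open>A\<close> equal \<open>A(c)\<close> up to units, since \<open>A(c)\<close> has smaller
  valuation than \<open>a ^ n\<close>. Multiplying \<open>A\<close> and \<open>B'\<close> by
  \<open>h ^ n / A(c)\<close> keeps them integral on the class and makes them nonunits off it. The
  first product is a unit on the class that \<open>M\<close> singles out, so it escapes
  \<open>M\<close>.\<close>

lemma comparable_step:
  assumes \<tau>: "\<And>i. \<tau> i \<in> T" and h: "char_poly \<tau> n \<notin> M'" and c: "c \<in> E" "digits \<tau> n c"
    and A: "A \<in> poly_over E" and B': "B' \<in> poly_over E"
    and nz: "poly A c \<noteq> 0" and n: "poly A c / a ^ n \<notin> V" and le: "poly B' c / poly A c \<in> V"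
  shows "\<exists>C\<in>IntPoly E. \<exists>C'\<in>IntPoly E. A * C' = B' * C \<and> C \<notin> M"
proof -
  define \<alpha> where "\<alpha> = poly A c"
  define h where "h = char_poly \<tau> n"
  have \<alpha>: "\<alpha> \<in> E" "\<alpha> \<noteq> 0" using A c nz E by (auto simp: \<alpha>_def poly_over_eval)
  have anV: "a ^ n / \<alpha> \<in> mV"
  proof -
    have "a ^ n / \<alpha> \<in> V"
      using valuation_domainD[OF V_val, of \<alpha> "a ^ n"] n \<alpha> a EK aE subring_power[OF E]
      by (auto simp: V_quot \<alpha>_def)
    then show ?thesis using not_mV[of "a ^ n / \<alpha>"] n by (auto simp: \<alpha>_def)
  qed
  \<comment> \<open>On the class, polynomials over \<open>E\<close> vary only by multiples of
    \<open>a ^ n\<close>, which \<alpha> divides properly.\<close>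
  have near: "(poly F y - poly F c) / \<alpha> \<in> mV" if Fy: "F \<in> poly_over E" "y \<in> E" "digits \<tau> n y" for F y
  proof -
    obtain w where w: "w \<in> E" "poly F y - poly F c = (y - c) * w"
      using poly_diff_factor[OF E Fy(1,2) c(1)] by blast
    have "(poly F y - poly F c) / \<alpha> = ((y - c) / a ^ n * w) * (a ^ n / \<alpha>)"
      unfolding w(2) using a by simp
    also have "\<dots> \<in> mV"
      using digits_separate[OF \<tau> Fy(2) c(1) Fy(3) c(2)] w E_V
      by (intro prime_ideal_mult[OF mV_prime _ anV] subring_mult[OF V]) auto
    finally show ?thesis .
  qed
  \<comment> \<open>Off the class each of the \<open>n\<close> factors \<open>h\<close> contributes
    one factor \<open>a\<close>, which is enough to absorb the denominator \<alpha>.\<close>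
  have far: "poly (h ^ n * F) y / \<alpha> \<in> mV" if "F \<in> poly_over E" "y \<in> E" "poly h y \<in> mV" for F y
  proof -
    have "poly (h ^ n * F) y / \<alpha> = ((poly h y / a) ^ n * poly F y) * (a ^ n / \<alpha>)"
      using a by (simp add: power_divide)
    also have "\<dots> \<in> mV"
      using that poly_over_eval[OF E that(1,2)] E_V
      by (intro prime_ideal_mult[OF mV_prime _ anV] subring_mult[OF V] subring_power[OF V]) (auto simp: mV_def)
    finally show ?thesis .
  qed
  have hV: "poly h y \<in> V" if "y \<in> E" for y using B_V[OF char_poly_B that] by (simp add: h_def)
  have hd: "poly h y \<notin> mV \<longleftrightarrow> digits \<tau> n y" if "y \<in> E" for y
    unfolding h_def by (rule char_poly_digits[OF \<tau> that])
  have inB: "smult (1/\<alpha>) (h ^ n * F) \<in> B" if F: "F \<in> poly_over E" "poly F c / \<alpha> \<in> V" for F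
  proof (rule B_divide)
    show "h ^ n * F \<in> B" unfolding h_def
      by (rule B_mult[OF B_power[OF char_poly_B] IntPoly_B[OF poly_over_IntPoly[OF E F(1)]]])
    show "denom \<alpha>" using dvr \<alpha> by blast
    fix y assume y: "y \<in> E"
    show "poly (h ^ n * F) y / \<alpha> \<in> V"
    proof (cases "poly h y \<in> mV")
      case True
      then show ?thesis using far[OF F(1) y] mV_V by blast
    next
      case False
      have "(poly F y - poly F c) / \<alpha> + poly F c / \<alpha> \<in> V"
        using near[OF F(1) y] hd[OF y] False F mV_V subring_add[OF V] by blast
      then have "poly F y / \<alpha> \<in> V" by (simp add: diff_divide_distrib)
      then have "poly h y ^ n * (poly F y / \<alpha>) \<in> V" using hV[OF y] subring_mult[OF V] subring_power[OF V] by blast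
      then show ?thesis by simp
    qed
  qed
  define gA where "gA = smult (1/\<alpha>) (h ^ n * A)"
  define gB where "gB = smult (1/\<alpha>) (h ^ n * B')"
  have gA: "gA \<in> B" using inB[OF A] \<alpha> subring_one[OF V] by (simp add: gA_def \<alpha>_def)
  have gB: "gB \<in> B" using inB[OF B'] le by (simp add: gB_def \<alpha>_def)
  have unit: "poly gA y \<notin> mV" if y: "y \<in> E" "poly h y \<notin> mV" for y
  proof
    assume m: "poly gA y \<in> mV"
    have nr: "(poly A y - \<alpha>) / \<alpha> \<in> mV" using near[OF A y(1)] hd[OF y(1)] y by (simp add: \<alpha>_def)
    then have "poly A y / \<alpha> - 1 \<in> mV" using \<alpha> by (simp add: diff_divide_distrib)
    then have nA: "poly A y / \<alpha> \<notin> mV" "poly A y / \<alpha> \<in> V"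
      using prime_ideal_diff[OF V mV_prime, of "poly A y / \<alpha>" "poly A y / \<alpha> - 1"] prime_ideal_one[OF mV_prime]
        mV_V[of "poly A y / \<alpha> - 1"] subring_add[OF V _ subring_one[OF V], of "poly A y / \<alpha> - 1"] by auto
    have "poly gA y = poly h y ^ n * (poly A y / \<alpha>)" by (simp add: gA_def)
    then have "poly h y ^ n \<in> mV" using m nA prime_ideal_prime[OF mV_prime] hV[OF y(1)] subring_power[OF V] by metis
    then show False using prime_ideal_power[OF V mV_prime hV[OF y(1)]] y by blast
  qed
  have gA_notin: "gA \<notin> M'"
  proof
    assume g: "gA \<in> M'"
    \<comment> \<open>The set \<open>T - P\<close> represents the nonzero residues. Where
      \<open>h\<close> is a unit so is \<open>gA\<close>, and some factor of \<open>q\<close> is a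
      nonunit; elsewhere \<open>h\<close> itself is one. Hence \<open>q * h\<close> lies in
      \<open>M'\<close>, and as \<open>h\<close> does not, \<open>gA\<close> has a nonzero residue
      modulo \<open>M'\<close>.\<close>
    define q where "q = (\<Prod>t\<in>T - P. gA - [:t:])"
    have Bt: "gA - [:t:] \<in> B" if "t \<in> T" for t using gA that T by (intro B_diff B_const) auto
    have qB: "q \<in> B" unfolding q_def using Bt by (intro B_prod) auto
    have hB: "h \<in> B" using char_poly_B by (simp add: h_def)
    have "q * h \<in> M'"
    proof (rule M'_vanish[OF B_mult[OF qB hB]])
      fix y assume y: "y \<in> E"
      have qV: "poly q y \<in> V" using B_V[OF qB y] .
      show "poly (q * h) y \<in> mV"
      proof (cases "poly h y \<in> mV")
        case True
        then show ?thesis using prime_ideal_mult[OF mV_prime qV] by simp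
      next
        case False
        obtain t where t: "t \<in> T" "poly gA y - t \<in> mV" using V_residue[OF B_V[OF gA y]] by blast
        have "t \<notin> P"
        proof
          assume "t \<in> P"
          then have "(poly gA y - t) + t \<in> mV" using t P_mV prime_ideal_add[OF mV_prime] by blast
          then show False using unit[OF y False] by simp
        qed
        then have tt: "t \<in> T - P" using t by blast
        have "(\<Prod>t\<in>T - P - {t}. poly gA y - t) \<in> V"
          using V_diff_T[OF B_V[OF gA y]] by (intro subring_prod[OF V]) auto
        then have "(poly gA y - t) * (\<Prod>t\<in>T - P - {t}. poly gA y - t) \<in> mV"
          using t prime_ideal_mult2[OF mV_prime] by blast
        then have "poly q y \<in> mV" using prod.remove[OF _ tt, of "\<lambda>t. poly gA y - t"] T(1)
          by (simp add: q_def poly_prod)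
        then show ?thesis using prime_ideal_mult2[OF mV_prime hV[OF y]] by simp
      qed
    qed
    then have "q \<in> M'" using M'_prime[OF qB hB] assms(2) by (auto simp: h_def)
    then obtain t where t: "t \<in> T - P" "gA - [:t:] \<in> M'" unfolding q_def
      using M'_prod[of "T - P" "\<lambda>t. gA - [:t:]"] T Bt by auto
    have "gA - (gA - [:t:]) \<in> M'" using g t M'_diff by blast
    then have "t \<in> P" using M'_const t T by auto
    then show False using t by blast
  qed
  obtain s where s: "s \<in> E - P" "smult s gA \<in> IntPoly E" using B_clear gA by blast
  obtain s' where s': "s' \<in> E - P" "smult s' gB \<in> IntPoly E" using B_clear gB by blast
  \<comment> \<open>The product \<open>s * s'\<close> clears both polynomials by the same factor,
    which preserves the relation between them.\<close>
  define C where "C = smult (s * s') gA"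
  define C' where "C' = smult (s * s') gB"
  have "C \<in> IntPoly E" "C' \<in> IntPoly E"
    using IntPoly_smult[OF E _ s(2), of s'] IntPoly_smult[OF E _ s'(2), of s] s s'
    by (simp_all add: C_def C'_def mult.commute)
  moreover have "A * C' = B' * C" by (simp add: C_def C'_def gA_def gB_def mult_ac)
  moreover have "C \<notin> M" using gA_notin gA notP_mult[OF s(1) s'(1)] unfolding C_def M'_def by blast
  ultimately show ?thesis by blast
qed

text \<open>The Bezout constant bounds how far \<open>A'\<close> and \<open>B'\<close> can be small
  at the same point. At a point of a sufficiently small class attached to \<open>M\<close>, the one
  with smaller value is fed into \<open>comparable_step\<close> as \<open>A\<close>.\<close>

lemma comparable_at_dvr: "comparable_at E M"
  unfolding comparable_at_def
proof (intro ballI impI)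
  fix A B assume "A \<in> IntPoly E" "B \<in> IntPoly E"
  then obtain A' B' u w x where *: "A' \<in> poly_over E" "B' \<in> poly_over E" "u \<in> poly_over E" "w \<in> poly_over E"
     "x \<in> E - {0}" "u * A' + w * B' = [:x:]" "A * B' = B * A'"
    using IntPoly_bezout[OF E] by blast
  obtain \<tau> where \<tau>: "\<And>i. \<tau> i \<in> T" "\<And>n. char_poly \<tau> n \<notin> M'" using M'_digits by blast
  obtain k where k: "a ^ k / x \<in> V" using dvr[of x] * by (auto simp: denom_def)
  \<comment> \<open>Since \<open>x\<close> divides \<open>a ^ k\<close>, a common divisor
    \<open>a ^ Suc k\<close> of both values would divide \<open>x\<close> and make \<open>a\<close>
    a unit.\<close>
  define n where "n = Suc k"
  \<comment> \<open>The class contains a point of \<open>E\<close>: otherwise the indicator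
    polynomial would take only nonunit values and lie in \<open>M'\<close>.\<close>
  obtain c where c: "c \<in> E" "poly (char_poly \<tau> n) c \<notin> mV"
    using M'_vanish[OF char_poly_B] \<tau>(2) by blast
  have d: "digits \<tau> n c" using c char_poly_digits[of \<tau>, OF \<tau>(1) c(1)] by blast
  define \<alpha> \<beta> where "\<alpha> = poly A' c" "\<beta> = poly B' c"
  have ab: "\<alpha> \<in> E" "\<beta> \<in> E" using * c E by (auto simp: \<alpha>_\<beta>_def poly_over_eval)
  have notboth: "\<not> (\<alpha> / a ^ n \<in> V \<and> \<beta> / a ^ n \<in> V)"
  proof
    assume v: "\<alpha> / a ^ n \<in> V \<and> \<beta> / a ^ n \<in> V"
    have "poly u c * (\<alpha> / a ^ n) + poly w c * (\<beta> / a ^ n) \<in> V"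
      using v * c E_V poly_over_eval[OF E] by (intro subring_add[OF V] subring_mult[OF V]) auto
    moreover have "x = poly u c * \<alpha> + poly w c * \<beta>" using arg_cong[OF *(6), of "\<lambda>f. poly f c"] by (simp add: \<alpha>_\<beta>_def)
    ultimately have "x / a ^ n \<in> V" by (simp add: add_divide_distrib)
    then have "(a ^ k / x) * (x / a ^ n) \<in> V" using k subring_mult[OF V] by blast
    then have "inverse a \<in> V" using * a by (simp add: n_def divide_simps)
    then show False using mV_no_inverse[OF aV] a by blast
  qed
  have main: "\<exists>C\<in>IntPoly E. \<exists>C'\<in>IntPoly E. F * C' = G * C \<and> C \<notin> M"
    if FG: "F \<in> poly_over E" "G \<in> poly_over E" "poly F c \<noteq> 0" "poly F c / a ^ n \<notin> V" "poly G c / poly F c \<in> V" for F G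
    using comparable_step[OF \<tau> c(1) d FG] .
  have nz: "y / a ^ n \<notin> V \<Longrightarrow> y \<noteq> 0" for y using subring_zero[OF V] by auto
  consider "\<alpha> \<noteq> 0" "\<alpha> / a ^ n \<notin> V" "\<beta> / \<alpha> \<in> V" | "\<beta> \<noteq> 0" "\<beta> / a ^ n \<notin> V" "\<alpha> / \<beta> \<in> V"
  proof (cases "\<alpha> = 0 \<or> \<beta> = 0")
    case True
    then show thesis using that notboth nz subring_zero[OF V] by auto
  next
    case False
    then have "\<beta> / \<alpha> \<in> V \<or> \<alpha> / \<beta> \<in> V" using valuation_domainD[OF V_val] ab EK by (auto simp: V_quot)
    then show thesis
    proof
      assume v: "\<beta> / \<alpha> \<in> V"
      have "\<alpha> / a ^ n \<notin> V"
      proof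
        assume al: "\<alpha> / a ^ n \<in> V"
        then have "\<beta> / \<alpha> * (\<alpha> / a ^ n) \<in> V" using v subring_mult[OF V] by blast
        then show False using notboth al False by simp
      qed
      then show thesis using that False v by blast
    next
      assume v: "\<alpha> / \<beta> \<in> V"
      have "\<beta> / a ^ n \<notin> V"
      proof
        assume al: "\<beta> / a ^ n \<in> V"
        then have "\<alpha> / \<beta> * (\<beta> / a ^ n) \<in> V" using v subring_mult[OF V] by blast
        then show False using notboth al False by simp
      qed
      then show thesis using that False v by blast
    qed
  qed
  then show "\<exists>C\<in>IntPoly E. \<exists>C'\<in>IntPoly E. A * C' = B * C \<and> (C \<notin> M \<or> C' \<notin> M)"
  proof cases
    case 1
    then obtain C C' where C: "C \<in> IntPoly E" "C' \<in> IntPoly E" "A' * C' = B' * C" "C \<notin> M"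
      using main[of A' B'] * by (auto simp: \<alpha>_\<beta>_def)
    \<comment> \<open>The relation found for \<open>A'\<close> and \<open>B'\<close> is carried over
      to \<open>A\<close> and \<open>B\<close> by cancelling \<open>A'\<close>, which is nonzero
      because its value at \<open>c\<close> is.\<close>
    have "A' * (A * C') = A * (B' * C)" by (simp add: C(3)[symmetric] mult_ac)
    also have "\<dots> = A' * (B * C)" using *(7) by (simp add: mult_ac)
    finally have "A * C' = B * C" using 1 by (auto simp: \<alpha>_\<beta>_def)
    then show ?thesis using C by blast
  next
    case 2
    then obtain C C' where C: "C \<in> IntPoly E" "C' \<in> IntPoly E" "B' * C' = A' * C" "C \<notin> M"
      using main[of B' A'] * by (auto simp: \<alpha>_\<beta>_def)
    have "B' * (B * C') = B * (A' * C)" by (simp add: C(3)[symmetric] mult_ac)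
    also have "\<dots> = B' * (A * C)" using *(7) by (simp add: mult_ac)
    finally have "A * C = B * C'" using 2 by (auto simp: \<alpha>_\<beta>_def)
    then show ?thesis using C by blast
  qed
qed

end

subsection \<open>The t-operation\<close>

lemma is_idealD:
  assumes "is_ideal R I"
  shows "I \<subseteq> R" "0 \<in> I" "x \<in> I \<Longrightarrow> y \<in> I \<Longrightarrow> x + y \<in> I" "r \<in> R \<Longrightarrow> x \<in> I \<Longrightarrow> r * x \<in> I"
  using assms by (auto simp: is_ideal_def)

lemma colon_gen_mod:
  assumes R: "subring R" and F: "finite F"
  shows "colon R (gen_mod R F) = {z\<in>quot_field R. \<forall>f\<in>F. z * f \<in> R}"
proof (intro equalityI subsetI)
  fix z assume z: "z \<in> colon R (gen_mod R F)"
  have "f \<in> gen_mod R F" if f: "f \<in> F" for f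
  proof -
    have "(\<Sum>x\<in>F. (if x = f then 1 else 0) * x) = (\<Sum>x\<in>F. if x = f then x else 0)"
      by (intro sum.cong) auto
    also have "\<dots> = f" using F f by (simp add: sum.delta)
    finally have "f = (\<Sum>x\<in>F. (if x = f then 1 else 0) * x)" by simp
    then show ?thesis using subring_zero[OF R] subring_one[OF R]
      unfolding gen_mod_def by (intro CollectI exI[of _ "\<lambda>x. if x = f then 1 else 0"]) auto
  qed
  then show "z \<in> {z\<in>quot_field R. \<forall>f\<in>F. z * f \<in> R}" using z by (auto simp: colon_def)
next
  fix z assume z: "z \<in> {z\<in>quot_field R. \<forall>f\<in>F. z * f \<in> R}"
  have "z * y \<in> R" if "y \<in> gen_mod R F" for y
  proof -
    obtain c where c: "y = (\<Sum>x\<in>F. c x * x)" "\<forall>x\<in>F. c x \<in> R" using \<open>y \<in> gen_mod R F\<close> unfolding gen_mod_def by blast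
    have "z * y = (\<Sum>x\<in>F. c x * (z * x))" unfolding c(1) sum_distrib_left by (simp add: mult_ac)
    also have "\<dots> \<in> R"
    proof (rule subring_sum[OF R])
      fix x assume "x \<in> F"
      then show "c x * (z * x) \<in> R" using c(2) z subring_mult[OF R] by blast
    qed
    finally show ?thesis .
  qed
  then show "z \<in> colon R (gen_mod R F)" using z by (auto simp: colon_def)
qed

text \<open>Multipliers of a finitely generated module are tested on its generators, so the
  v-closures in the definition reduce to a statement about finite sets \<open>F\<close>. The
  condition on \<open>F - {0}\<close> excludes the zero module.\<close>

lemma t_op_iff:
  assumes R: "subring R"
  shows "y \<in> t_op R I \<longleftrightarrow> y \<in> quot_field R \<and> (\<exists>F. finite F \<and> F \<subseteq> I \<and> F - {0} \<noteq> {} \<and>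
    (\<forall>z\<in>quot_field R. (\<forall>f\<in>F. z * f \<in> R) \<longrightarrow> y * z \<in> R))"
proof -
  have "y \<in> v_op R (gen_mod R F) \<longleftrightarrow> y \<in> quot_field R \<and>
    (\<forall>z\<in>quot_field R. (\<forall>f\<in>F. z * f \<in> R) \<longrightarrow> y * z \<in> R)" if "finite F" for F
    unfolding v_op_def colon_gen_mod[OF R that] by (auto simp: colon_def)
  then show ?thesis unfolding t_op_def by blast
qed

lemma t_op_sub: "subring R \<Longrightarrow> I \<subseteq> R \<Longrightarrow> t_op R I \<subseteq> R"
proof
  fix y assume R: "subring R" "I \<subseteq> R" and "y \<in> t_op R I"
  then obtain F where "F \<subseteq> I" "\<forall>z\<in>quot_field R. (\<forall>f\<in>F. z * f \<in> R) \<longrightarrow> y * z \<in> R"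
    by (auto simp: t_op_iff)
  then have "y * 1 \<in> R" using R subset_quot_field[OF R(1) subring_one] by (metis mult_1 subsetD)
  then show "y \<in> R" by simp
qed

lemma t_op_extensive:
  assumes R: "subring R" and I: "I \<subseteq> R" and a: "a \<in> I" "a \<noteq> 0"
  shows "I \<subseteq> t_op R I"
proof
  fix x assume x: "x \<in> I"
  then have "x \<in> quot_field R" using I R subset_quot_field by blast
  then show "x \<in> t_op R I" unfolding t_op_iff[OF R] using x a
    by (intro conjI exI[of _ "{x, a}"]) (auto simp: mult.commute)
qed

text \<open>Each of finitely many elements of the closure has a finite witness in \<open>I\<close>,
  and the union of these witnesses is a witness for \<open>y\<close>.\<close>

lemma t_op_idem:
  assumes R: "subring R" and I: "I \<subseteq> R"
  shows "t_op R (t_op R I) \<subseteq> t_op R I"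
proof
  fix y assume y: "y \<in> t_op R (t_op R I)"
  then obtain F where F: "finite F" "F \<subseteq> t_op R I" "F - {0} \<noteq> {}"
      "\<forall>z\<in>quot_field R. (\<forall>f\<in>F. z * f \<in> R) \<longrightarrow> y * z \<in> R" and yq: "y \<in> quot_field R"
    unfolding t_op_iff[OF R] by blast
  define wit where "wit f G \<longleftrightarrow> finite G \<and> G \<subseteq> I \<and> G - {0} \<noteq> {} \<and>
      (\<forall>z\<in>quot_field R. (\<forall>g\<in>G. z * g \<in> R) \<longrightarrow> f * z \<in> R)" for f G
  have "\<exists>G. wit f G" if "f \<in> F" for f
  proof -
    have "f \<in> t_op R I" using that F(2) by blast
    then show ?thesis unfolding t_op_iff[OF R, of f I] wit_def by blast
  qed
  then obtain G where "\<And>f. f \<in> F \<Longrightarrow> wit f (G f)" by metis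
  then have G: "\<And>f. f \<in> F \<Longrightarrow> finite (G f) \<and> G f \<subseteq> I \<and> G f - {0} \<noteq> {} \<and>
     (\<forall>z\<in>quot_field R. (\<forall>g\<in>G f. z * g \<in> R) \<longrightarrow> f * z \<in> R)" unfolding wit_def by blast
  have "finite (\<Union>f\<in>F. G f)" using G F(1) by simp
  moreover have "(\<Union>f\<in>F. G f) \<subseteq> I" using G by blast
  moreover have "(\<Union>f\<in>F. G f) - {0} \<noteq> {}"
  proof -
    obtain f where "f \<in> F" using F(3) by blast
    then have "G f - {0} \<noteq> {}" "G f \<subseteq> (\<Union>f\<in>F. G f)" using G by auto
    then show ?thesis by blast
  qed
  moreover have "y * z \<in> R" if z: "z \<in> quot_field R" "\<forall>g\<in>(\<Union>f\<in>F. G f). z * g \<in> R" for z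
  proof -
    have "\<forall>f\<in>F. z * f \<in> R" using G z by (metis UN_I mult.commute)
    then show ?thesis using F(4) z by blast
  qed
  ultimately show "y \<in> t_op R I" unfolding t_op_iff[OF R] using yq by blast
qed

lemma t_op_ideal:
  assumes R: "subring R" and I: "is_ideal R I" and a: "a \<in> I" "a \<noteq> 0"
  shows "is_ideal R (t_op R I)"
  unfolding is_ideal_def
proof (intro conjI ballI)
  note IR = is_idealD(1)[OF I]
  show "t_op R I \<subseteq> R" by (rule t_op_sub[OF R IR])
  show "0 \<in> t_op R I" using t_op_extensive[OF R IR a] is_idealD(2)[OF I] by blast
  note sq = subring_quot[OF R]
  fix x y assume x: "x \<in> t_op R I" and y: "y \<in> t_op R I"
  obtain F where F: "finite F" "F \<subseteq> I" "F - {0} \<noteq> {}" "\<forall>z\<in>quot_field R. (\<forall>f\<in>F. z * f \<in> R) \<longrightarrow> x * z \<in> R"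
      and xq: "x \<in> quot_field R"
    using x unfolding t_op_iff[OF R] by blast
  obtain G where G: "finite G" "G \<subseteq> I" "G - {0} \<noteq> {}" "\<forall>z\<in>quot_field R. (\<forall>f\<in>G. z * f \<in> R) \<longrightarrow> y * z \<in> R"
      and yq: "y \<in> quot_field R"
    using y unfolding t_op_iff[OF R] by blast
  have "(x + y) * z \<in> R" if z: "z \<in> quot_field R" "\<forall>f\<in>F \<union> G. z * f \<in> R" for z
    using F(4) G(4) z subring_add[OF R] by (auto simp: distrib_right)
  moreover have "finite (F \<union> G)" "F \<union> G \<subseteq> I" "(F \<union> G) - {0} \<noteq> {}" using F G by auto
  ultimately show "x + y \<in> t_op R I" unfolding t_op_iff[OF R] using subring_add[OF sq xq yq] by blast
next
  fix r x assume r: "r \<in> R" and x: "x \<in> t_op R I"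
  obtain F where F: "finite F" "F \<subseteq> I" "F - {0} \<noteq> {}" "\<forall>z\<in>quot_field R. (\<forall>f\<in>F. z * f \<in> R) \<longrightarrow> x * z \<in> R"
      and xq: "x \<in> quot_field R"
    using x unfolding t_op_iff[OF R] by blast
  have "r * x * z \<in> R" if "z \<in> quot_field R" "\<forall>f\<in>F. z * f \<in> R" for z
    using F(4) that subring_mult[OF R r] by (simp add: mult.assoc)
  moreover have "r * x \<in> quot_field R" using xq subset_quot_field[OF R r] subring_mult[OF subring_quot[OF R]] by blast
  ultimately show "r * x \<in> t_op R I" unfolding t_op_iff[OF R] using F by blast
qed

lemma t_ideal_t_op:
  assumes R: "subring R" and I: "is_ideal R I" and a: "a \<in> I" "a \<noteq> 0"
  shows "t_ideal R (t_op R I)"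
proof -
  have IR: "I \<subseteq> R" using I by (simp add: is_ideal_def)
  have "a \<in> t_op R I" using t_op_extensive[OF R IR a] a by blast
  then have "t_op R I \<subseteq> t_op R (t_op R I)" using t_op_extensive[OF R t_op_sub[OF R IR]] a by blast
  then show ?thesis using t_op_idem[OF R IR] t_op_ideal[OF R I a] by (auto simp: t_ideal_def)
qed

lemma add_principal_ideal:
  assumes R: "subring R" and I: "is_ideal R I" and a: "a \<in> R"
  shows "is_ideal R {m + r * a | m r. m \<in> I \<and> r \<in> R}" (is "is_ideal R ?J")
    "I \<subseteq> {m + r * a | m r. m \<in> I \<and> r \<in> R}" "a \<in> {m + r * a | m r. m \<in> I \<and> r \<in> R}"
proof -
  note D = is_idealD[OF I]
  show "I \<subseteq> ?J"
  proof
    fix x assume "x \<in> I"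
    then show "x \<in> ?J" using subring_zero[OF R] by (intro CollectI exI[of _ x] exI[of _ 0]) auto
  qed
  show "a \<in> ?J" using subring_one[OF R] D by (intro CollectI exI[of _ 0] exI[of _ 1]) auto
  show "is_ideal R ?J"
    unfolding is_ideal_def
  proof (intro conjI ballI)
    show "?J \<subseteq> R" using D(1) a by (auto intro!: subring_add[OF R] subring_mult[OF R])
    show "0 \<in> ?J" using \<open>I \<subseteq> ?J\<close> D(2) by blast
    fix x y assume "x \<in> ?J" "y \<in> ?J"
    then obtain m r n s where *: "x = m + r * a" "y = n + s * a" "m \<in> I" "n \<in> I" "r \<in> R" "s \<in> R" by blast
    then have "x + y = (m + n) + (r + s) * a" by (simp add: algebra_simps)
    then show "x + y \<in> ?J" using * D(3) subring_add[OF R] by blast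
  next
    fix q x assume "q \<in> R" "x \<in> ?J"
    then obtain m r where *: "x = m + r * a" "m \<in> I" "r \<in> R" by blast
    then have "q * x = q * m + (q * r) * a" by (simp add: algebra_simps)
    then show "q * x \<in> ?J" using * D(4)[OF \<open>q \<in> R\<close>] subring_mult[OF R \<open>q \<in> R\<close>] by blast
  qed
qed

text \<open>If \<open>a\<close> is outside \<open>M\<close>, the t-closure of \<open>M + Ra\<close>
  is \<open>R\<close>, so some finite \<open>F\<close> in that ideal has \<open>1\<close> in its
  v-closure. Then \<open>b\<close> lies in the v-closure of \<open>bF\<close>, which is contained in
  \<open>M\<close> because \<open>a * b\<close> is.\<close>

lemma t_maximal_prime:
  assumes R: "subring R" and M: "t_maximal R M"
  shows "prime_ideal R M"
  unfolding prime_ideal_def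
proof (intro conjI ballI impI)
  show I: "is_ideal R M" "M \<noteq> R" using M by (auto simp: t_maximal_def t_ideal_def)
  fix a b assume ab: "a \<in> R" "b \<in> R" "a * b \<in> M"
  show "a \<in> M \<or> b \<in> M"
  proof (cases "a \<in> M \<or> M = {0}")
    case True
    then show ?thesis using ab by auto
  next
    case False
    obtain m0 where m0: "m0 \<in> M" "m0 \<noteq> 0" using False is_idealD(2)[OF I(1)] by blast
    define J where "J = {m + r * a | m r. m \<in> M \<and> r \<in> R}"
    note J = add_principal_ideal[OF R I(1) ab(1), folded J_def]
    have t: "t_ideal R (t_op R J)" using t_ideal_t_op[OF R J(1), of m0] J(2) m0 by blast
    have "J \<subseteq> t_op R J" using t_op_extensive[OF R is_idealD(1)[OF J(1)], of m0] J(2) m0 by blast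
    then have "a \<in> t_op R J" "M \<subseteq> t_op R J" using J by blast+
    then have "t_op R J = R" using M t False unfolding t_maximal_def by blast
    then have "1 \<in> t_op R J" using subring_one[OF R] by simp
    then obtain F where F: "finite F" "F \<subseteq> J" "\<forall>z\<in>quot_field R. (\<forall>f\<in>F. z * f \<in> R) \<longrightarrow> 1 * z \<in> R"
      unfolding t_op_iff[OF R] by blast
    \<comment> \<open>The element \<open>m0\<close> keeps the generating set nonzero, even if all
      \<open>b * f\<close> vanish.\<close>
    let ?G = "insert m0 ((\<lambda>f. b * f) ` F)"
    have "b * f \<in> M" if f: "f \<in> F" for f
    proof -
      obtain m r where *: "f = m + r * a" "m \<in> M" "r \<in> R" using f F(2) by (auto simp: J_def)
      have "b * f = b * m + r * (a * b)" by (simp add: * algebra_simps)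
      also have "\<dots> \<in> M" 
        by (rule is_idealD(3)[OF I(1) is_idealD(4)[OF I(1) ab(2) *(2)] is_idealD(4)[OF I(1) *(3) ab(3)]])
      finally show ?thesis .
    qed
    then have "?G \<subseteq> M" using m0 by auto
    moreover have "b * z \<in> R" if z: "z \<in> quot_field R" "\<forall>g\<in>?G. z * g \<in> R" for z
    proof -
      have "b * z \<in> quot_field R" using z ab subset_quot_field[OF R] subring_mult[OF subring_quot[OF R]] by blast
      moreover have "\<forall>f\<in>F. (b * z) * f \<in> R" using z by (simp add: mult_ac)
      ultimately have "1 * (b * z) \<in> R" using F(3) by blast
      then show ?thesis by simp
    qed
    moreover have "finite ?G" "?G - {0} \<noteq> {}" using F m0 by auto
    ultimately have "b \<in> t_op R M" unfolding t_op_iff[OF R] using subset_quot_field[OF R ab(2)] by blast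
    then show ?thesis using M False by (auto simp: t_maximal_def t_ideal_def)
  qed
qed

lemma maximal_prime:
  assumes R: "subring R" and M: "maximal_ideal R M"
  shows "prime_ideal R M"
  unfolding prime_ideal_def
proof (intro conjI ballI impI)
  show I: "is_ideal R M" "M \<noteq> R" using M by (auto simp: maximal_ideal_def)
  fix a b assume ab: "a \<in> R" "b \<in> R" "a * b \<in> M"
  show "a \<in> M \<or> b \<in> M"
  proof (cases "a \<in> M")
    case False
    define J where "J = {m + r * a | m r. m \<in> M \<and> r \<in> R}"
    note J = add_principal_ideal[OF R I(1) ab(1), folded J_def]
    have "J = R" using M J False unfolding maximal_ideal_def by blast
    then have "1 \<in> J" using subring_one[OF R] by simp
    then obtain m r where *: "1 = m + r * a" "m \<in> M" "r \<in> R" by (auto simp: J_def)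
    have "b = b * 1" by simp
    also have "\<dots> = b * m + r * (a * b)" unfolding *(1) by (simp add: algebra_simps)
    also have "\<dots> \<in> M" 
      by (rule is_idealD(3)[OF I(1) is_idealD(4)[OF I(1) ab(2) *(2)] is_idealD(4)[OF I(1) *(3) ab(3)]])
    finally show ?thesis by simp
  qed simp
qed

lemma chain_union_ideal:
  assumes "C \<noteq> {}" "subset.chain {J. is_ideal R J} C"
  shows "is_ideal R (\<Union>C)"
  unfolding is_ideal_def
proof (intro conjI ballI)
  have C: "\<And>J. J \<in> C \<Longrightarrow> is_ideal R J" "\<And>I J. I \<in> C \<Longrightarrow> J \<in> C \<Longrightarrow> I \<subseteq> J \<or> J \<subseteq> I"
    using assms(2) by (auto simp: subset_chain_def)
  show "\<Union>C \<subseteq> R" "0 \<in> \<Union>C" using C(1) assms(1) is_idealD(1,2) by blast+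
  fix x y assume "x \<in> \<Union>C" "y \<in> \<Union>C"
  then obtain I J where IJ: "I \<in> C" "x \<in> I" "J \<in> C" "y \<in> J" by blast
  then obtain L where "L \<in> C" "x \<in> L" "y \<in> L" using C(2)[of I J] by blast
  then show "x + y \<in> \<Union>C" using is_idealD(3)[OF C(1)] by blast
next
  fix r x assume rx: "r \<in> R" "x \<in> \<Union>C"
  then obtain I where "I \<in> C" "x \<in> I" by blast
  moreover from this have "is_ideal R I" using assms(2) by (auto simp: subset_chain_def)
  ultimately show "r * x \<in> \<Union>C" using is_idealD(4) rx(1) by blast
qed

lemma is_ideal_proper: "is_ideal R I \<Longrightarrow> subring R \<Longrightarrow> I \<noteq> R \<longleftrightarrow> 1 \<notin> I"
  using ideal_one_imp_eq subring_one by blast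

lemma maximal_ideal_exists:
  assumes R: "subring R" and I: "is_ideal R I" "I \<noteq> R"
  shows "\<exists>M. maximal_ideal R M \<and> I \<subseteq> M"
proof -
  let ?A = "{J. is_ideal R J \<and> J \<noteq> R \<and> I \<subseteq> J}"
  have "\<exists>M\<in>?A. \<forall>X\<in>?A. M \<subseteq> X \<longrightarrow> X = M"
  proof (rule subset_Zorn_nonempty)
    fix C assume C: "C \<noteq> {}" "subset.chain ?A C"
    then have "is_ideal R (\<Union>C)" by (intro chain_union_ideal) (auto simp: subset_chain_def)
    moreover have "1 \<notin> \<Union>C" using C is_ideal_proper[OF _ R] by (auto simp: subset_chain_def)
    moreover obtain J where "J \<in> C" "I \<subseteq> J" using C by (fastforce simp: subset_chain_def)
    then have "I \<subseteq> \<Union>C" by blast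
    ultimately show "\<Union>C \<in> ?A" using is_ideal_proper[OF _ R] by blast
  qed (use I in auto)
  then obtain M where "is_ideal R M" "M \<noteq> R" "I \<subseteq> M" "\<forall>X\<in>?A. M \<subseteq> X \<longrightarrow> X = M" by blast
  moreover from this have "X = M" if "is_ideal R X" "X \<noteq> R" "M \<subseteq> X" for X using that by blast
  ultimately show ?thesis unfolding maximal_ideal_def by blast
qed

text \<open>Zorn's lemma applies because the t-operation has finite type: a finite subset of the
  union of a chain lies in one member of the chain, which is already closed.\<close>

lemma t_maximal_exists:
  assumes R: "subring R" and I: "t_ideal R I" "I \<noteq> R"
  shows "\<exists>M. t_maximal R M \<and> I \<subseteq> M"
proof -
  let ?A = "{J. t_ideal R J \<and> J \<noteq> R \<and> I \<subseteq> J}"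
  have "\<exists>M\<in>?A. \<forall>X\<in>?A. M \<subseteq> X \<longrightarrow> X = M"
  proof (rule subset_Zorn_nonempty)
    fix C assume C: "C \<noteq> {}" "subset.chain ?A C"
    then have id: "is_ideal R (\<Union>C)" by (intro chain_union_ideal) (auto simp: subset_chain_def t_ideal_def)
    have one: "1 \<notin> \<Union>C" using C is_ideal_proper[OF _ R] by (auto simp: subset_chain_def t_ideal_def)
    have "t_op R (\<Union>C) \<subseteq> \<Union>C"
    proof
      fix y assume y: "y \<in> t_op R (\<Union>C)"
      then obtain F where F: "finite F" "F \<subseteq> \<Union>C" "F - {0} \<noteq> {}"
          "\<forall>z\<in>quot_field R. (\<forall>f\<in>F. z * f \<in> R) \<longrightarrow> y * z \<in> R" and yq: "y \<in> quot_field R"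
        unfolding t_op_iff[OF R] by blast
      obtain J where J: "J \<in> C" "F \<subseteq> J" using finite_subset_Union_chain[OF F(1,2) C] by blast
      then have "y \<in> t_op R J" unfolding t_op_iff[OF R] using F yq by blast
      moreover have "J = t_op R J" using J F(3) C by (auto simp: subset_chain_def t_ideal_def)
      ultimately show "y \<in> \<Union>C" using J by blast
    qed
    then have "t_ideal R (\<Union>C)" unfolding t_ideal_def
      using id t_op_extensive[OF R is_idealD(1)[OF id]] is_idealD(2)[OF id] by blast
    moreover obtain J where "J \<in> C" "I \<subseteq> J" using C by (fastforce simp: subset_chain_def)
    then have "I \<subseteq> \<Union>C" by blast
    ultimately show "\<Union>C \<in> ?A" using one subring_one[OF R] by blast
  qed (use I in auto)
  then obtain M where "t_ideal R M" "M \<noteq> R" "I \<subseteq> M" "\<forall>X\<in>?A. M \<subseteq> X \<longrightarrow> X = M" by blast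
  moreover from this have "X = M" if "t_ideal R X" "X \<noteq> R" "M \<subseteq> X" for X using that by blast
  ultimately show ?thesis unfolding t_maximal_def by blast
qed

section \<open>Interpolation at powers and a t-prime given by the value at \<open>0\<close>\<close>

text \<open>With \<open>m\<close> the degree, the nodes are \<open>1, a, ..., a ^ m\<close>. The
  difference of two of them is a smaller power of \<open>a\<close> times some
  \<open>1 - a ^ k\<close>, a unit, so \<open>a ^ m\<close> is a multiple of every difference and
  the \<open>m\<close> interpolation steps cost \<open>a ^ (m * m)\<close>.\<close>

lemma power_nodes_coeff:
  assumes V: "subring V" and a: "a \<in> V" "a \<noteq> 0"
    and u: "\<And>k. k > 0 \<Longrightarrow> 1 - a ^ k \<noteq> 0 \<and> inverse (1 - a ^ k) \<in> V"
    and g: "\<And>i. poly g (a ^ i) \<in> V"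
  shows "a ^ (degree g * degree g) * coeff g i \<in> V"
proof -
  define m where "m = degree g"
  have less: "a ^ i \<noteq> a ^ j \<and> a ^ m / (a ^ i - a ^ j) \<in> V" if "i < j" "j \<le> m" for i j
  proof -
    have 1: "1 - a ^ (j - i) \<noteq> 0" "inverse (1 - a ^ (j - i)) \<in> V" using u[of "j - i"] that by auto
    have pw: "a ^ j = a ^ i * a ^ (j - i)" "a ^ m = a ^ i * a ^ (m - i)" using that by (simp_all flip: power_add)
    then have df: "a ^ i - a ^ j = a ^ i * (1 - a ^ (j - i))" by (simp add: right_diff_distrib)
    then have "a ^ m / (a ^ i - a ^ j) = (a ^ i * a ^ (m - i)) / (a ^ i * (1 - a ^ (j - i)))"
      using pw by metis
    also have "\<dots> = a ^ (m - i) * inverse (1 - a ^ (j - i))" using a(2) by (simp add: divide_inverse)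
    also have "\<dots> \<in> V" using 1 subring_mult[OF V] subring_power[OF V a(1)] by blast
    finally show ?thesis using df 1 a(2) by auto
  qed
  have diff: "a ^ m / (a ^ i - a ^ j) \<in> V" if ij: "i \<le> m" "j \<le> m" "a ^ i \<noteq> a ^ j" for i j
  proof -
    consider "i < j" | "j < i" using ij(3) by (metis linorder_neqE_nat)
    then show ?thesis
    proof cases
      case 2
      have "- (a ^ m / (a ^ j - a ^ i)) \<in> V" using less[OF 2 ij(1)] subring_minus[OF V] by blast
      then show ?thesis by (simp add: minus_divide_right)
    qed (use less ij in blast)
  qed
  have inj: "inj_on (\<lambda>i. a ^ i) {..m}"
    by (rule linorder_inj_onI) (use less in auto)
  have "1 * (a ^ m) ^ m * coeff g i \<in> V"
  proof (rule divided_difference_coeff[OF V, of "(\<lambda>i. a ^ i) ` {..m}"])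
    show "card ((\<lambda>i. a ^ i) ` {..m}) = Suc m" using card_image[OF inj] by simp
  qed (use diff g subring_power[OF V a(1)] in \<open>auto simp: m_def\<close>)
  then show ?thesis by (simp add: m_def power_mult)
qed

context finite_residue_prime begin

lemma one_minus_power_unit: "k > 0 \<Longrightarrow> 1 - a ^ k \<noteq> 0 \<and> inverse (1 - a ^ k) \<in> V"
proof -
  assume "k > 0"
  then have "a * a ^ (k - 1) \<in> mV" using aV aE E_V subring_power[OF V] prime_ideal_mult2[OF mV_prime] by blast
  then have ak: "a ^ k \<in> mV" using \<open>k > 0\<close> by (simp add: power_eq_if)
  have "1 - a ^ k \<notin> mV"
  proof
    assume "1 - a ^ k \<in> mV"
    then have "(1 - a ^ k) + a ^ k \<in> mV" using ak prime_ideal_add[OF mV_prime] by blast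
    then show False using prime_ideal_one[OF mV_prime] by simp
  qed
  moreover have "1 - a ^ k \<in> V" using ak mV_V subring_diff[OF V subring_one[OF V]] by blast
  ultimately show ?thesis using not_mV prime_ideal_zero[OF mV_prime] by metis
qed

text \<open>Interpolation at the powers of \<open>a\<close> bounds the denominators of all
  coefficients by \<open>a ^ N\<close>. In \<open>g(y) - g(0) = y q(y)\<close> a factor
  \<open>a ^ Suc N\<close> of \<open>y\<close> therefore leaves one \<open>a\<close> over.\<close>

lemma IntPoly_continuous:
  assumes g: "g \<in> IntPoly E"
  shows "\<exists>k. \<forall>y\<in>E. y / a ^ k \<in> V \<longrightarrow> poly g y - poly g 0 \<in> mV"
proof -
  define N where "N = degree g * degree g"
  have c: "a ^ N * coeff g i \<in> V" for i
    unfolding N_def using one_minus_power_unit IntPoly_eval[OF g subring_power[OF E aE]] E_V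
    by (intro power_nodes_coeff[OF V E_V[OF aE] a(2)]) auto
  obtain g0 q where gq: "g = pCons g0 q" by (cases g)
  have cq: "smult (a ^ N) q \<in> poly_over V"
    using c[of "Suc i" for i] by (auto simp: poly_over_def gq)
  have "poly g y - poly g 0 \<in> mV" if y: "y \<in> E" "y / a ^ Suc N \<in> V" for y
  proof -
    have "poly (smult (a ^ N) q) y \<in> V" by (rule poly_over_eval[OF V cq E_V[OF y(1)]])
    then have "(y / a ^ Suc N) * (a ^ N * poly q y) \<in> V" using y subring_mult[OF V] unfolding poly_smult by blast
    moreover have "(poly g y - poly g 0) / a = (y / a ^ Suc N) * (a ^ N * poly q y)"
      using a(2) by (simp add: gq)
    ultimately show ?thesis by (simp only: mV_def mem_Collect_eq)
  qed
  then show ?thesis by blast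
qed

lemma power_quotient_mono: "y / a ^ n \<in> V \<Longrightarrow> k \<le> n \<Longrightarrow> y / a ^ k \<in> V"
proof -
  assume y: "y / a ^ n \<in> V" "k \<le> n"
  have "a ^ n = a ^ k * a ^ (n - k)" using y by (simp flip: power_add)
  then have "y / a ^ k = (y / a ^ n) * a ^ (n - k)" using a(2) by simp
  then show ?thesis using y subring_mult[OF V _ subring_power[OF V E_V[OF aE]]] by metis
qed

definition N0 :: "'a poly fract set" where
  "N0 = {Fract g 1 | g. g \<in> IntPoly E \<and> poly g 0 \<in> P}"

lemma zeroE: "0 \<in> E" using subring_zero[OF E] .

lemma N0_iff: "Fract g 1 \<in> N0 \<longleftrightarrow> g \<in> IntPoly E \<and> poly g 0 \<in> P"
  by (auto simp: N0_def Fract_inj)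

lemma N0_prime: "prime_ideal (IntDom E) N0"
  unfolding prime_ideal_def is_ideal_def
proof (intro conjI ballI impI)
  show "N0 \<subseteq> IntDom E" by (auto simp: N0_def IntDom_iff)
  show "0 \<in> N0" using N0_iff[of 0] IntPoly_zero[OF E] prime_ideal_zero[OF Pp] by (simp add: Zero_fract_def)
  have "1 \<notin> N0" using N0_iff[of 1] prime_ideal_one[OF Pp] by (simp add: One_fract_def)
  then show "N0 \<noteq> IntDom E" using subring_one[OF subring_IntDom[OF E]] by blast
next
  fix x y assume "x \<in> N0" "y \<in> N0"
  then show "x + y \<in> N0" using IntPoly_add[OF E] prime_ideal_add[OF Pp] by (auto simp: N0_def Fract_inj)
next
  fix r x assume "r \<in> IntDom E" "x \<in> N0"
  then obtain f g where fg: "r = Fract f 1" "f \<in> IntPoly E" "x = Fract g 1" "g \<in> IntPoly E" "poly g 0 \<in> P"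
    unfolding N0_def by (auto elim!: IntDomE)
  have "poly f 0 * poly g 0 \<in> P" using IntPoly_eval[OF fg(2) zeroE] fg(5) prime_ideal_mult[OF Pp] by blast
  then show "r * x \<in> N0" using fg IntPoly_mult[OF E] by (simp add: N0_iff)
next
  fix x y assume xy: "x \<in> IntDom E" "y \<in> IntDom E" "x * y \<in> N0"
  then obtain f g where fg: "x = Fract f 1" "f \<in> IntPoly E" "y = Fract g 1" "g \<in> IntPoly E"
    by (auto elim!: IntDomE)
  then have "poly f 0 * poly g 0 \<in> P" using xy by (simp add: N0_iff)
  then show "x \<in> N0 \<or> y \<in> N0"
    using prime_ideal_prime[OF Pp] fg IntPoly_eval zeroE by (simp add: N0_iff) blast
qed

text \<open>For finitely many elements \<open>g\<close> of \<open>N0\<close>, a polynomial \<open>h\<close> that is a unit at \<open>0\<close> and a nonunit off a small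
  neighbourhood of \<open>0\<close> yields \<open>h / a\<close>, which (up to a factor outside \<open>P\<close>) multiplies them into \<open>IntDom E\<close>.\<close>
lemma N0_t_ideal: "t_ideal (IntDom E) N0"
proof -
  let ?R = "IntDom E"
  note R = subring_IntDom[OF E]
  have NR: "N0 \<subseteq> ?R" using N0_prime by (auto dest: prime_ideal_mem)
  have an: "Fract [:a:] 1 \<in> N0" "Fract [:a:] 1 \<noteq> 0" using a IntPoly_const[OF E aE] by (auto simp: N0_iff Fract_zero)
  have "t_op ?R N0 \<subseteq> N0"
  proof
    fix y assume y: "y \<in> t_op ?R N0"
    then obtain F where F: "finite F" "F \<subseteq> N0" "\<forall>z\<in>quot_field ?R. (\<forall>f\<in>F. z * f \<in> ?R) \<longrightarrow> y * z \<in> ?R"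
      unfolding t_op_iff[OF R] by blast
    have "\<forall>f\<in>F. \<exists>g. f = Fract g 1 \<and> g \<in> IntPoly E \<and> poly g 0 \<in> P" using F(2) by (auto simp: N0_def)
    then obtain G where G: "\<And>f. f \<in> F \<Longrightarrow> f = Fract (G f) 1 \<and> G f \<in> IntPoly E \<and> poly (G f) 0 \<in> P" by metis
    have "\<forall>f\<in>F. \<exists>k. \<forall>y\<in>E. y / a ^ k \<in> V \<longrightarrow> poly (G f) y - poly (G f) 0 \<in> mV"
      using IntPoly_continuous G by blast
    then obtain k where k: "\<And>f y. f \<in> F \<Longrightarrow> y \<in> E \<Longrightarrow> y / a ^ k f \<in> V \<Longrightarrow> poly (G f) y - poly (G f) 0 \<in> mV" by metis
    \<comment> \<open>The sum merely serves as a common upper bound for the moduli of continuity of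
      the finitely many polynomials.\<close>
    define n where "n = sum k F"
    have kn: "k f \<le> n" if "f \<in> F" for f unfolding n_def using F(1) that by (simp add: member_le_sum)
    have "\<forall>i. \<exists>t\<in>T. poly (theta i) 0 - t \<in> mV" using V_residue B_V[OF theta_B zeroE] by blast
    then obtain \<tau> where \<tau>: "\<And>i. \<tau> i \<in> T" "\<And>i. poly (theta i) 0 - \<tau> i \<in> mV" by metis
    have d0: "digits \<tau> n 0" using \<tau> by (simp add: digits_def)
    define h where "h = char_poly \<tau> n"
    have hB: "h \<in> B" unfolding h_def by (rule char_poly_B)
    have h0: "poly h 0 \<notin> mV" unfolding h_def using char_poly_digits[of \<tau>, OF \<tau>(1) zeroE] d0 by blast
    obtain d where d: "denom d" "\<forall>x\<in>E. d * poly h x \<in> E" using hB by (auto simp: B_def)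
    obtain s where s: "s \<in> E - P" and scl: "\<forall>f\<in>poly_over (quot_field E).
       (\<forall>x\<in>E. poly f x \<in> V \<and> (d * a) * poly f x \<in> E) \<longrightarrow> smult s f \<in> IntPoly E"
      using denom_clear[OF denom_mult[OF d(1) denom_a]] by blast
    \<comment> \<open>This is the multiplier that separates: it carries \<open>F\<close> into the
      ring, whereas \<open>z(0)\<close> is a unit divided by \<open>a\<close>.\<close>
    define z where "z = smult (s / a) h"
    have zK: "z \<in> poly_over (quot_field E)"
      using hB s a aE EK unfolding z_def B_def by (auto intro!: poly_over_smult subring_quot E quot_divide)
    have zf: "Fract z 1 * f \<in> ?R" if f: "f \<in> F" for f
    proof -
      let ?f = "smult (1/a) (h * G f)"
      have "smult s ?f \<in> IntPoly E"
      proof (rule scl[rule_format])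
        have "1 / a \<in> quot_field E" using quot_fieldI[OF subring_one[OF E] aE a(2)] .
        then show "?f \<in> poly_over (quot_field E)"
          using hB G[OF f] subring_quot[OF E] IntPoly_over_quot[of "G f" E] unfolding B_def
          by (blast intro: poly_over_smult poly_over_mult)
        fix x assume x: "x \<in> E"
        have gE: "poly (G f) x \<in> E" using G[OF f] x by (auto intro: IntPoly_eval)
        have "poly h x * poly (G f) x \<in> mV"
        proof (cases "poly h x \<in> mV")
          case True
          then show ?thesis using gE E_V prime_ideal_mult2[OF mV_prime] by blast
        next
          case False
          then have "digits \<tau> n x" unfolding h_def using char_poly_digits[of \<tau>, OF \<tau>(1) x] by blast
          then have "(x - 0) / a ^ n \<in> V" using digits_separate[of \<tau>, OF \<tau>(1) x zeroE _ d0] by blast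
          then have "x / a ^ k f \<in> V" using power_quotient_mono kn[OF f] by simp
          then have "poly (G f) x - poly (G f) 0 \<in> mV" using k[OF f x] by blast
          then have "(poly (G f) x - poly (G f) 0) + poly (G f) 0 \<in> mV"
            using G[OF f] P_mV prime_ideal_add[OF mV_prime] by blast
          then have "poly (G f) x \<in> mV" by simp
          then show ?thesis using B_V[OF hB x] prime_ideal_mult[OF mV_prime] by blast
        qed
        then show "poly ?f x \<in> V \<and> d * a * poly ?f x \<in> E"
          using d(2) x gE a subring_mult[OF E, of "d * poly h x" "poly (G f) x"] by (auto simp: mV_def mult_ac)
      qed
      moreover have "z * G f = smult s ?f" by (simp add: z_def)
      ultimately show ?thesis using G[OF f] by (metis Fract_mult IntDom_iff)
    qed
    have "y \<in> ?R" using y t_op_sub[OF R NR] by blast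
    then obtain f where f: "y = Fract f 1" "f \<in> IntPoly E" by (rule IntDomE)
    have "y * Fract z 1 \<in> ?R" using F(3) zf quot_IntDom[OF E zK] by blast
    then have "f * z \<in> IntPoly E" using f by (metis Fract_mult IntDom_iff)
    \<comment> \<open>Since \<open>s\<close> and \<open>h(0)\<close> are units of \<open>V\<close>,
      integrality at \<open>0\<close> forces \<open>a\<close> to divide \<open>f(0)\<close>.\<close>
    then have "poly f 0 * (s / a * poly h 0) \<in> V" using IntPoly_eval[of "f * z" E 0] zeroE E_V by (simp add: z_def mult_ac)
    then have "poly f 0 * (s * poly h 0) \<in> mV" by (simp add: mV_def mult_ac)
    moreover have "s * poly h 0 \<notin> mV"
      using prime_ideal_prime[OF mV_prime, of s "poly h 0"] s h0 mV_E E_V B_V[OF hB zeroE] by blast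
    moreover have "s * poly h 0 \<in> V" using s E_V B_V[OF hB zeroE] subring_mult[OF V] by blast
    ultimately have "poly f 0 \<in> mV" using prime_ideal_prime[OF mV_prime] IntPoly_eval[OF f(2) zeroE] E_V by blast
    then have "poly f 0 \<in> P" using mV_E IntPoly_eval[OF f(2) zeroE] by blast
    then show "y \<in> N0" using f by (simp add: N0_iff)
  qed
  then show ?thesis using t_op_extensive[OF R NR an] N0_prime by (auto simp: t_ideal_def prime_ideal_def)
qed

text \<open>If \<open>X / d = g / h\<close> with \<open>h(0)\<close> outside \<open>P\<close>, then
  at \<open>a ^ k\<close> close to \<open>0\<close> the value of \<open>h\<close> is still a unit,
  and \<open>a ^ k h(a ^ k) = d g(a ^ k)\<close> contradicts that \<open>a ^ Suc k\<close> divides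
  \<open>d\<close>. If \<open>d / X = g / h\<close>, evaluation at \<open>0\<close> gives
  \<open>d h(0) = 0\<close>.\<close>

lemma N0_not_valuation:
  assumes d: "d \<in> E" "d \<noteq> 0" "\<And>n. d / a ^ n \<in> V"
  shows "\<not> valuation_domain (loc (IntDom E) N0)"
proof
  assume v: "valuation_domain (loc (IntDom E) N0)"
  note R = subring_IntDom[OF E]
  let ?X = "Fract [:0, 1:] 1" and ?d = "Fract [:d:] 1"
  have X: "[:0, 1:] \<in> IntPoly E" by (intro poly_over_IntPoly poly_over_X E)
  have mem: "?X \<in> quot_field (IntDom E)" "?d \<in> quot_field (IntDom E)"
    using X IntPoly_const[OF E d(1)] by (auto intro!: subset_quot_field[OF R] simp: IntDom_iff)
  have nz: "?X \<noteq> 0" "?d \<noteq> 0" using d by (auto simp: Fract_zero)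
  have rep: "\<exists>g h. x * Fract h 1 = Fract g 1 \<and> g \<in> IntPoly E \<and> h \<in> IntPoly E \<and> poly h 0 \<notin> P"
    if x: "x \<in> loc (IntDom E) N0" for x
  proof -
    obtain b s where bs: "x = b / s" "b \<in> IntDom E" "s \<in> IntDom E" "s \<notin> N0" "s \<noteq> 0" using x N0_prime by (rule locE)
    obtain g where g: "b = Fract g 1" "g \<in> IntPoly E" using bs(2) by (rule IntDomE)
    obtain h where h: "s = Fract h 1" "h \<in> IntPoly E" using bs(3) by (rule IntDomE)
    have "x * Fract h 1 = Fract g 1" unfolding bs(1) g(1)[symmetric] h(1)[symmetric] using bs(5) by (rule nonzero_eq_divide_eq[THEN iffD1, OF _ refl])
    then show ?thesis using g h bs N0_iff by blast
  qed
  have "?X / ?d \<in> loc (IntDom E) N0 \<or> ?d / ?X \<in> loc (IntDom E) N0"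
    using valuation_domainD[OF v _ _ nz] mem quot_field_loc[OF R N0_prime] by simp
  then show False
  proof
    assume "?X / ?d \<in> loc (IntDom E) N0"
    then obtain g h where gh: "?X / ?d * Fract h 1 = Fract g 1" "g \<in> IntPoly E" "h \<in> IntPoly E" "poly h 0 \<notin> P"
      using rep by blast
    have "?X * Fract h 1 = ?d * Fract g 1" unfolding gh(1)[symmetric] using nz by (simp del: mult_fract divide_fract)
    then have eq: "[:0, 1:] * h = [:d:] * g" by (simp only: Fract_mult Fract_inj)
    obtain k where k: "\<And>y. y \<in> E \<Longrightarrow> y / a ^ k \<in> V \<Longrightarrow> poly h y - poly h 0 \<in> mV"
      using IntPoly_continuous[OF gh(3)] by blast
    have ak: "a ^ k \<in> E" using subring_power[OF E aE] .
    have hk: "poly h (a ^ k) - poly h 0 \<in> mV" using k[OF ak] a(2) subring_one[OF V] by simp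
    have hE: "poly h (a ^ k) \<in> E" "poly h 0 \<in> E" using gh(3) ak zeroE by (auto intro: IntPoly_eval)
    have "poly h (a ^ k) \<notin> mV"
    proof
      assume "poly h (a ^ k) \<in> mV"
      then have "poly h (a ^ k) - (poly h (a ^ k) - poly h 0) \<in> mV" using hk prime_ideal_diff[OF V mV_prime] by blast
      then show False using gh(4) mV_E[OF hE(2)] by simp
    qed
    then have u: "inverse (poly h (a ^ k)) \<in> V" "poly h (a ^ k) \<noteq> 0"
      using not_mV E_V hE prime_ideal_zero[OF mV_prime] by auto
    have eqk: "a ^ k * poly h (a ^ k) = d * poly g (a ^ k)"
      using arg_cong[OF eq, of "\<lambda>f. poly f (a ^ k)"] by simp
    have "(a ^ k * poly h (a ^ k)) / (a ^ Suc k * poly h (a ^ k))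
        = (d / a ^ Suc k) * (poly g (a ^ k) * inverse (poly h (a ^ k)))"
      unfolding eqk by (simp add: divide_inverse mult_ac)
    moreover have "(a ^ k * poly h (a ^ k)) / (a ^ Suc k * poly h (a ^ k)) = inverse a"
      using a(2) u(2) by (simp add: divide_simps)
    moreover have "(d / a ^ Suc k) * (poly g (a ^ k) * inverse (poly h (a ^ k))) \<in> V"
      using d(3) u E_V[OF IntPoly_eval[OF gh(2) ak]] subring_mult[OF V] by blast
    ultimately have "inverse a \<in> V" by metis
    then show False using mV_no_inverse[OF aV] a by blast
  next
    assume "?d / ?X \<in> loc (IntDom E) N0"
    then obtain g h where gh: "?d / ?X * Fract h 1 = Fract g 1" "h \<in> IntPoly E" "poly h 0 \<notin> P"
      using rep by blast
    have "?d * Fract h 1 = ?X * Fract g 1" unfolding gh(1)[symmetric] using nz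
      by (simp del: mult_fract divide_fract) (auto simp del: mult_fract divide_fract)
    then have eq: "[:d:] * h = [:0, 1:] * g" by (simp only: Fract_mult Fract_inj)
    have "d * poly h 0 = 0" using arg_cong[OF eq, of "\<lambda>f. poly f 0"] by simp
    then show False using d gh(3) prime_ideal_zero[OF Pp] by simp
  qed
qed

text \<open>Overrings of valuation domains in their quotient field are valuation domains, so the
  failure at \<open>N0\<close> passes to any t-maximal or maximal ideal above it. The t-ideal
  property of \<open>N0\<close> supplies the t-maximal one.\<close>

lemma not_dvr_not_PvMD:
  assumes d: "d \<in> E" "d \<noteq> 0" "\<And>n. d / a ^ n \<in> V"
  shows "\<not> PvMD (IntDom E)" "\<not> Pruefer (IntDom E)"
proof -
  note R = subring_IntDom[OF E]
  have N: "is_ideal (IntDom E) N0" "N0 \<noteq> IntDom E" using N0_prime by (auto simp: prime_ideal_def)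
  show "\<not> PvMD (IntDom E)"
  proof
    assume "PvMD (IntDom E)"
    moreover obtain M where M: "t_maximal (IntDom E) M" "N0 \<subseteq> M"
      using t_maximal_exists[OF R N0_t_ideal N(2)] by blast
    ultimately have "valuation_domain (loc (IntDom E) M)" by (auto simp: PvMD_def)
    then show False
      using valuation_domain_loc_mono[OF R t_maximal_prime[OF R M(1)] N0_prime M(2)] N0_not_valuation[OF d] by blast
  qed
  show "\<not> Pruefer (IntDom E)"
  proof
    assume "Pruefer (IntDom E)"
    moreover obtain M where M: "maximal_ideal (IntDom E) M" "N0 \<subseteq> M"
      using maximal_ideal_exists[OF R N] by blast
    ultimately have "valuation_domain (loc (IntDom E) M)" by (auto simp: Pruefer_def)
    then show False
      using valuation_domain_loc_mono[OF R maximal_prime[OF R M(1)] N0_prime M(2)] N0_not_valuation[OF d] by blast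
  qed
qed

end

subsection \<open>Families of Krull type\<close>

lemma Krull_type_family:
  assumes D: "subring D" and K: "Krull_type D"
  obtains PP where "krull_family D PP"
proof -
  obtain PP where PP: "\<forall>P\<in>PP. prime_ideal D P \<and> valuation_domain (loc D P)"
    "D = quot_field D \<inter> \<Inter>(loc D ` PP)" "\<forall>x\<in>D - {0}. finite {P\<in>PP. inverse x \<notin> loc D P}"
    using K unfolding Krull_type_def by blast
  have "krull_family D PP"
  proof
    fix x assume x: "x \<in> D" "x \<noteq> 0"
    have "inverse x \<notin> loc D P \<longleftrightarrow> x \<in> P" if "P \<in> PP" for P using inverse_mem_loc[OF D _ x] PP(1) that by blast
    then have "{P\<in>PP. inverse x \<notin> loc D P} = {P\<in>PP. x \<in> P}" by auto
    moreover have "finite {P\<in>PP. inverse x \<notin> loc D P}" using PP(3) x by blast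
    ultimately show "finite {P\<in>PP. x \<in> P}" by simp
  next
    fix x assume "x \<in> quot_field D" "\<And>p. p \<in> PP \<Longrightarrow> x \<in> loc D p"
    then show "x \<in> D" using PP(2) by blast
  qed (use D PP in auto)
  then show thesis by (rule that)
qed

lemma transversal_exists:
  assumes R: "subring R" and P: "prime_ideal R P"
  obtains T where "T \<subseteq> R" "\<And>x. x \<in> R \<Longrightarrow> \<exists>t\<in>T. x - t \<in> P"
    "\<And>t t'. t \<in> T \<Longrightarrow> t' \<in> T \<Longrightarrow> t - t' \<in> P \<Longrightarrow> t = t'"
proof -
  define r where "r x = (SOME y. y \<in> R \<and> x - y \<in> P)" for x
  have r: "r x \<in> R \<and> x - r x \<in> P" if "x \<in> R" for x
    unfolding r_def by (rule someI[of _ x]) (use that prime_ideal_zero[OF P] in auto)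
  have "r x = r y" if xy: "x \<in> R" "y \<in> R" "r x - r y \<in> P" for x y
  proof -
    have "(x - r x) + (r x - r y) - (y - r y) \<in> P"
      using r[OF xy(1)] r[OF xy(2)] xy(3) prime_ideal_add[OF P] prime_ideal_diff[OF R P] by blast
    then have d: "x - y \<in> P" by simp
    have "x - z \<in> P \<longleftrightarrow> y - z \<in> P" for z
      using prime_ideal_diff[OF R P _ d, of "x - z"] prime_ideal_add[OF P _ d, of "y - z"] by auto
    then show ?thesis by (simp add: r_def)
  qed
  then show thesis using r by (intro that[of "r ` R"]) auto
qed

context krull_family begin

lemma mem_loc_of_mult:
  assumes "p \<in> PP" "e \<in> E" "e \<notin> p" "e * y \<in> E"
  shows "y \<in> loc E p"
proof -
  have "e \<noteq> 0" using assms prime_ideal_zero[OF PP_prime] by blast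
  then have "y = (e * y) / e" by simp
  then show ?thesis using locI[of "e * y" E e p] assms by metis
qed

text \<open>Otherwise take a nonzero \<open>d\<close> in \<open>P\<close> and, for each of the
  finitely many \<open>p\<close> containing \<open>d\<close>, an element of \<open>P\<close> outside
  \<open>p\<close>. At every member one of these is invertible, so a multiplier carrying all of them
  into \<open>E\<close> lies in \<open>E\<close>, and \<open>1\<close> would be in the t-closure of
  \<open>P\<close>.\<close>

lemma t_prime_sub:
  assumes P: "P \<in> t_Spec E" "P \<noteq> {0}"
  shows "\<exists>p\<in>PP. P \<subseteq> p"
proof (rule ccontr)
  assume no: "\<not> ?thesis"
  have Pp: "prime_ideal E P" "t_ideal E P" using P by (auto simp: t_Spec_def)
  obtain d where d: "d \<in> P" "d \<noteq> 0" using P(2) prime_ideal_zero[OF Pp(1)] by blast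
  have PE: "x \<in> P \<Longrightarrow> x \<in> E" for x using prime_ideal_mem[OF Pp(1)] .
  have "\<exists>e. e \<in> P \<and> e \<notin> p" if "p \<in> PP" for p using no that by blast
  then obtain e where e: "\<And>p. p \<in> PP \<Longrightarrow> e p \<in> P \<and> e p \<notin> p" by metis
  let ?F = "insert d (e ` {p\<in>PP. d \<in> p})"
  have "1 * z \<in> E" if z: "z \<in> quot_field E" "\<forall>f\<in>?F. z * f \<in> E" for z
  proof -
    have "z \<in> loc E p" if p: "p \<in> PP" for p
    proof (cases "d \<in> p")
      case True
      then show ?thesis using mem_loc_of_mult[OF p, of "e p" z] e[OF p] PE p z by (auto simp: mult.commute)
    next
      case False
      then show ?thesis using mem_loc_of_mult[OF p, of d z] d PE z by (auto simp: mult.commute)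
    qed
    then show ?thesis using E_int z by simp
  qed
  moreover have "finite ?F" "?F \<subseteq> P" "?F - {0} \<noteq> {}" using PP_finite[OF PE[OF d(1)] d(2)] d e by auto
  ultimately have "1 \<in> t_op E P"
    unfolding t_op_iff[OF E] using subset_quot_field[OF E subring_one[OF E]] by blast
  then have "1 \<in> P" using Pp(2) P(2) by (auto simp: t_ideal_def)
  then show False using prime_ideal_one[OF Pp(1)] by blast
qed

text \<open>In the valuation ring at \<open>p\<close> a finite subset \<open>F\<close> of
  \<open>p\<close> is generated by one of its elements \<open>c\<close>. A suitable
  \<open>s / c\<close> with \<open>s\<close> outside \<open>p\<close> carries \<open>F\<close> into
  \<open>E\<close>, so for \<open>y\<close> in the closure \<open>y * s\<close> is a multiple of
  \<open>c\<close>.\<close>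

lemma PP_t_Spec:
  assumes p: "p \<in> PP" "p \<noteq> {0}"
  shows "p \<in> t_Spec E"
proof -
  note Pp = PP_prime[OF p(1)]
  have pE: "p \<subseteq> E" using prime_ideal_mem[OF Pp] by blast
  obtain a where a: "a \<in> p" "a \<noteq> 0" using p(2) prime_ideal_zero[OF Pp] by blast
  have "t_op E p \<subseteq> p"
  proof
    fix y assume y: "y \<in> t_op E p"
    then obtain F where F: "finite F" "F \<subseteq> p" "F - {0} \<noteq> {}"
      "\<forall>z\<in>quot_field E. (\<forall>f\<in>F. z * f \<in> E) \<longrightarrow> y * z \<in> E" unfolding t_op_iff[OF E] by blast
    have FK: "F \<subseteq> quot_field E" using F(2) pE subset_quot_field[OF E] by blast
    obtain c where c: "c \<in> F" "c \<noteq> 0" "\<forall>x\<in>F. x / c \<in> loc E p"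
      using valuation_min_element[OF PP_val[OF p(1)] F(1)] F(3) FK quot_field_loc[OF E Pp] by auto
    obtain s where s: "s \<in> E - p" "\<forall>x\<in>(\<lambda>x. x / c) ` F. s * x \<in> E"
      using common_denominator[OF E Pp, of "(\<lambda>x. x / c) ` F"] F(1) c(3) by auto
    have "s / c \<in> quot_field E" using s c F(2) pE by (intro quot_fieldI) auto
    moreover have "\<forall>f\<in>F. s / c * f \<in> E" using s(2) by simp
    ultimately have ys: "y * (s / c) \<in> E" using F(4) by blast
    have "y * (s / c) * c \<in> p" using prime_ideal_mult[OF Pp ys] c F(2) by blast
    then have "y * s \<in> p" using c by simp
    then show "y \<in> p" using prime_ideal_prime[OF Pp] s t_op_sub[OF E pE] y by blast
  qed
  then have "t_ideal E p" using t_op_extensive[OF E pE a] Pp by (auto simp: t_ideal_def prime_ideal_def)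
  then show ?thesis using Pp by (simp add: t_Spec_def)
qed

lemma IntPoly_sub_loc:
  assumes "p \<in> PP" "p \<noteq> {0}" "p \<notin> Lambda0 E"
  shows "IntPoly E \<subseteq> poly_over (loc E p)"
proof
  fix g assume g: "g \<in> IntPoly E"
  have "g = smult (inverse 1) g" by simp
  then have "g \<in> IntPoly_loc E p"
    unfolding IntPoly_loc_def using g subring_one[OF E] prime_ideal_one[OF PP_prime[OF assms(1)]] by blast
  then show "g \<in> poly_over (loc E p)" using assms PP_t_Spec by (auto simp: Lambda0_def)
qed

text \<open>If the maximal ideal of the valuation ring is not principal, arbitrarily high roots (up to units)
  exist, so the nodes \<open>1, \<eta>, \<eta>\<^sup>2, \<dots>\<close> give interpolation denominators of arbitrarily small valuation.\<close>
lemma nonprincipal_root: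
  assumes P: "prime_ideal E P" and val: "valuation_domain (loc E P)"
    and np: "\<And>a. a \<in> P \<Longrightarrow> a \<noteq> 0 \<Longrightarrow> \<exists>x\<in>P. x / a \<notin> loc E P"
  shows "x \<in> P \<Longrightarrow> x \<noteq> 0 \<Longrightarrow> \<exists>\<eta>\<in>P. \<eta> \<noteq> 0 \<and> x / \<eta> ^ (2 ^ k) \<in> loc E P"
proof (induction k arbitrary: x)
  let ?V = "loc E P"
  note V = subring_loc[OF E P]
  case 0
  then show ?case using subring_one[OF V] by auto
next
  let ?V = "loc E P"
  note V = subring_loc[OF E P]
  case (Suc k)
  have PK: "y \<in> P \<Longrightarrow> y \<in> quot_field (loc E P)" for y
    using prime_ideal_mem[OF P] subset_quot_field[OF E] quot_field_loc[OF E P] by auto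
  obtain y where y: "y \<in> P" "y / x \<notin> ?V" using np[OF Suc.prems] by blast
  have y0: "y \<noteq> 0" using y subring_zero[OF V] by auto
  have "x / y \<in> ?V" using valuation_domainD[OF val PK[OF y(1)] PK[OF Suc.prems(1)] y0 Suc.prems(2)] y by blast
  then obtain b s where bs: "x / y = b / s" "b \<in> E" "s \<in> E" "s \<notin> P" "s \<noteq> 0" using P by (rule locE)
  have b0: "b \<noteq> 0" using bs Suc.prems y0 by auto
  have bP: "b \<in> P"
  proof (rule ccontr)
    assume "b \<notin> P"
    then have "s / b \<in> ?V" using bs locI by blast
    moreover have "s / b = y / x" using bs Suc.prems y0 b0 by (simp add: frac_eq_eq mult.commute)
    ultimately show False using y by simp
  qed
  have xe: "x = b * y / s" using bs y0 by (simp add: divide_simps mult.commute)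
  have s1: "inverse s \<in> ?V" using inverse_mem_loc[OF E P bs(3,5)] bs by blast
  \<comment> \<open>Up to a unit, \<open>x\<close> is the product of \<open>b\<close> and
    \<open>y\<close>, both in \<open>P\<close>; the square of the one with smaller valuation divides
    \<open>x\<close>.\<close>
  have "\<exists>\<eta>\<in>P. \<eta> \<noteq> 0 \<and> x / \<eta> ^ 2 \<in> ?V"
  proof -
    have "y / b \<in> ?V \<or> b / y \<in> ?V" using valuation_domainD[OF val PK[OF y(1)] PK[OF bP] y0 b0] by blast
    then show ?thesis
    proof
      assume "y / b \<in> ?V"
      then have "y / b * inverse s \<in> ?V" using s1 subring_mult[OF V] by blast
      also have "y / b * inverse s = x / b ^ 2" using b0 by (simp add: xe power2_eq_square divide_inverse)
      finally show ?thesis using bP b0 by blast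
    next
      assume "b / y \<in> ?V"
      then have "b / y * inverse s \<in> ?V" using s1 subring_mult[OF V] by blast
      also have "b / y * inverse s = x / y ^ 2" using y0 by (simp add: xe power2_eq_square divide_inverse)
      finally show ?thesis using y(1) y0 by blast
    qed
  qed
  then obtain \<eta> where \<eta>: "\<eta> \<in> P" "\<eta> \<noteq> 0" "x / \<eta> ^ 2 \<in> ?V" by blast
  obtain \<zeta> where \<zeta>: "\<zeta> \<in> P" "\<zeta> \<noteq> 0" "\<eta> / \<zeta> ^ (2 ^ k) \<in> ?V" using Suc.IH[OF \<eta>(1,2)] by blast
  have "x / \<zeta> ^ (2 ^ Suc k) = (x / \<eta> ^ 2) * (\<eta> / \<zeta> ^ (2 ^ k)) ^ 2"
    using \<eta>(2) by (simp add: power_divide mult.commute flip: power_mult)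
  also have "\<dots> \<in> ?V" using \<eta>(3) \<zeta>(3) subring_mult[OF V] subring_power[OF V] by blast
  finally show ?case using \<zeta> by blast
qed

section \<open>The primes of \<open>Lambda0\<close>\<close>

text \<open>Polynomials over \<open>loc E P\<close> always lie in the localized ring, by clearing
  denominators, so inequality must come from an integer-valued polynomial with a coefficient
  outside. This excludes the zero prime, whose localization is the quotient field.\<close>

lemma Lambda0_witness:
  assumes "P \<in> Lambda0 E"
  obtains g where "prime_ideal E P" "P \<in> t_Spec E" "P \<noteq> {0}" "g \<in> IntPoly E" "g \<notin> poly_over (loc E P)"
proof -
  have tP: "P \<in> t_Spec E" and ne: "IntPoly_loc E P \<noteq> poly_over (loc E P)" using assms by (auto simp: Lambda0_def)
  have Pp: "prime_ideal E P" using tP by (simp add: t_Spec_def)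
  note V = subring_loc[OF E Pp]
  have "poly_over (loc E P) \<subseteq> IntPoly_loc E P"
  proof
    fix f assume "f \<in> poly_over (loc E P)"
    then obtain s where s: "s \<in> E - P" "smult s f \<in> poly_over E" using common_denominator_poly[OF E Pp, of "{f}"] by auto
    have "s \<noteq> 0" using s prime_ideal_zero[OF Pp] by auto
    then have "f = smult (inverse s) (smult s f)" by simp
    then show "f \<in> IntPoly_loc E P" unfolding IntPoly_loc_def using s poly_over_IntPoly[OF E s(2)] by blast
  qed
  then obtain g s where g: "g \<in> IntPoly E" "s \<in> E - P" "smult (inverse s) g \<notin> poly_over (loc E P)"
    using ne by (auto simp: IntPoly_loc_def)
  have "inverse s \<in> loc E P" using inverse_mem_loc[OF E Pp, of s] g(2) prime_ideal_zero[OF Pp] by auto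
  then have gn: "g \<notin> poly_over (loc E P)" using g(3) poly_over_smult[OF V] by blast
  then have "P \<noteq> {0}" using IntPoly_over_quot[OF g(1)] loc_zero by metis
  then show thesis using that Pp tP g(1) gn by blast
qed

text \<open>A coefficient outside the valuation ring contradicts interpolation in two ways: at nodes
  distinct modulo \<open>P\<close> if the residue field is infinite, and at powers of elements of
  small valuation if the maximal ideal is not principal. Finiteness of the residue field makes
  \<open>P\<close> maximal, hence a member of the family.\<close>

lemma Lambda0_finite_residue:
  assumes "P \<in> Lambda0 E"
  obtains a T where "finite_residue_prime E PP P a T"
proof -
  obtain g where Pp: "prime_ideal E P" and P: "P \<in> t_Spec E" "P \<noteq> {0}"
    and g: "g \<in> IntPoly E" "g \<notin> poly_over (loc E P)"
    using Lambda0_witness[OF assms] by blast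
  let ?V = "loc E P"
  note V = subring_loc[OF E Pp]
  have EV: "x \<in> E \<Longrightarrow> x \<in> ?V" for x using loc_mem[OF E Pp] .
  have PE: "x \<in> P \<Longrightarrow> x \<in> E" for x using prime_ideal_mem[OF Pp] .
  obtain p where p: "p \<in> PP" "P \<subseteq> p" using t_prime_sub[OF P] by blast
  have val: "valuation_domain ?V" using valuation_domain_loc_mono[OF E PP_prime[OF p(1)] Pp p(2) PP_val[OF p(1)]] .
  obtain T where T: "T \<subseteq> E" "\<And>x. x \<in> E \<Longrightarrow> \<exists>t\<in>T. x - t \<in> P"
    "\<And>t t'. t \<in> T \<Longrightarrow> t' \<in> T \<Longrightarrow> t - t' \<in> P \<Longrightarrow> t = t'" using transversal_exists[OF E Pp] by blast
  obtain i where i: "coeff g i \<notin> ?V" using g(2) by (auto simp: poly_over_def)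
  have finT: "finite T"
  proof (rule ccontr)
    assume "infinite T"
    then obtain S where S: "finite S" "card S = Suc (degree g)" "S \<subseteq> T" using infinite_arbitrarily_large by blast
    \<comment> \<open>The differences of such nodes are units, so interpolation costs
      nothing.\<close>
    have "1 * 1 ^ degree g * coeff g i \<in> ?V"
    proof (rule divided_difference_coeff[OF V S(1,2) le_refl])
      show "S \<subseteq> ?V" using S T EV by blast
      show "1 \<in> ?V" using subring_one[OF V] .
      fix x y assume xy: "x \<in> S" "y \<in> S" "x \<noteq> y"
      have xE: "x \<in> E" "y \<in> E" using xy S T by auto
      have "x - y \<notin> P" using xy S(3) T(3) by blast
      then show "1 / (x - y) \<in> ?V" using xE subring_diff[OF E] subring_one[OF E] by (intro locI) auto
    next
      fix x assume "x \<in> S"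
      then show "1 * poly g x \<in> ?V" using IntPoly_eval[OF g(1)] S(3) T(1) EV by auto
    qed
    then show False using i by simp
  qed
  have max: "p = P" using finite_residue_maximal[OF E Pp finT T(2) PP_prime[OF p(1)] p(2)] .
  have "\<exists>a\<in>P. a \<noteq> 0 \<and> (\<forall>x\<in>P. x / a \<in> ?V)"
  proof (rule ccontr)
    assume "\<not> ?thesis"
    then have np: "\<And>a. a \<in> P \<Longrightarrow> a \<noteq> 0 \<Longrightarrow> \<exists>x\<in>P. x / a \<notin> ?V" by blast
    define c where "c = coeff g i"
    have c: "c \<in> quot_field ?V" "c \<noteq> 0" "c \<notin> ?V"
      using IntPoly_over_quot[OF g(1)] i subring_zero[OF V] quot_field_loc[OF E Pp] by (auto simp: poly_over_def c_def)
    then have "inverse c \<in> ?V" using val by (auto simp: valuation_domain_def)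
    then obtain b s where bs: "inverse c = b / s" "b \<in> E" "s \<in> E" "s \<notin> P" "s \<noteq> 0" using Pp by (rule locE)
    have b0: "b \<noteq> 0" using bs c by auto
    have cs: "c = s / b" using bs(1) by (metis inverse_divide inverse_inverse_eq)
    then have bP: "b \<in> P" using c bs locI by blast
    \<comment> \<open>Up to a unit, \<open>b\<close> is the denominator of the coefficient
      \<open>c\<close>. Some \<open>x\<close> in \<open>P\<close> has smaller valuation than
      \<open>b\<close>, so \<open>x * c\<close> is not integral.\<close>
    obtain x where x: "x \<in> P" "x / b \<notin> ?V" using np[OF bP b0] by blast
    have x0: "x \<noteq> 0" using x subring_zero[OF V] by auto
    define n where "n = degree g * degree g"
    \<comment> \<open>The exponent \<open>2 ^ n\<close> exceeds \<open>n\<close>, and \<eta> to the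
      power \<open>n\<close> already clears the coefficient \<open>c\<close>; so \<open>x\<close>
      would clear it as well.\<close>
    obtain \<eta> where \<eta>: "\<eta> \<in> P" "\<eta> \<noteq> 0" "x / \<eta> ^ (2 ^ n) \<in> ?V"
      using nonprincipal_root[OF Pp val np x(1) x0] by blast
    have \<eta>V: "\<eta> \<in> ?V" using \<eta> PE EV by blast
    have un: "1 - \<eta> ^ k \<noteq> 0 \<and> inverse (1 - \<eta> ^ k) \<in> ?V" if "k > 0" for k
    proof -
      have "\<eta> * \<eta> ^ (k - 1) \<in> P" using prime_ideal_mult2[OF Pp subring_power[OF E PE[OF \<eta>(1)]] \<eta>(1)] .
      then have k: "\<eta> ^ k \<in> P" using that by (simp add: power_eq_if)
      have n1: "1 - \<eta> ^ k \<notin> P"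
      proof
        assume "1 - \<eta> ^ k \<in> P"
        then have "(1 - \<eta> ^ k) + \<eta> ^ k \<in> P" using k prime_ideal_add[OF Pp] by blast
        then show False using prime_ideal_one[OF Pp] by simp
      qed
      then have "1 - \<eta> ^ k \<noteq> 0" using prime_ideal_zero[OF Pp] by metis
      then show ?thesis using inverse_mem_loc[OF E Pp] n1 subring_diff[OF E subring_one[OF E] PE[OF k]] by blast
    qed
    have "\<eta> ^ n * c \<in> ?V" unfolding n_def c_def
      using power_nodes_coeff[OF V \<eta>V \<eta>(2) un] IntPoly_eval[OF g(1) subring_power[OF E PE[OF \<eta>(1)]]] EV by blast
    moreover have "\<eta> ^ (2 ^ n - n) \<in> ?V" using subring_power[OF V \<eta>V] .
    moreover have "n \<le> 2 ^ n" using less_exp[of n] by simp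
    then have "\<eta> ^ (2 ^ n) = \<eta> ^ n * \<eta> ^ (2 ^ n - n)" by (simp flip: power_add)
    then have "x * c = (x / \<eta> ^ (2 ^ n)) * (\<eta> ^ (2 ^ n - n) * (\<eta> ^ n * c))" using \<eta>(2) by simp
    ultimately have "x * c \<in> ?V" using \<eta>(3) subring_mult[OF V] by metis
    then have "x * c / s \<in> ?V" using loc_divide_unit[OF E Pp _ bs(3,4)] by blast
    moreover have "x * c / s = x / b" using cs bs(5) by simp
    ultimately show False using x by simp
  qed
  then obtain a where "a \<in> P" "a \<noteq> 0" "\<forall>x\<in>P. x / a \<in> ?V" by blast
  then have "finite_residue_prime E PP P a T"
    using p(1) T finT by unfold_locales (auto simp: max)
  then show thesis by (rule that)
qed

lemma Lambda0_sub: "P \<in> Lambda0 E \<Longrightarrow> P \<in> PP"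
  by (erule Lambda0_finite_residue) (rule finite_residue_prime.P)

text \<open>A tool for contradictions: \<open>d\<close> and one test polynomial for each of the
  finitely many \<open>p\<close> containing \<open>d\<close> form a finite subset of
  \<open>N\<close>. If the tests force every multiplier to be integral at these \<open>p\<close>,
  then \<open>1\<close> lies in the t-closure of \<open>N\<close>.\<close>

lemma t_ideal_test:
  assumes N: "prime_ideal (IntDom E) N" "t_ideal (IntDom E) N"
    and d: "d \<in> E" "d \<noteq> 0" "[:d:] \<in> trace_poly E N"
    and test: "\<And>p. p \<in> PP \<Longrightarrow> d \<in> p \<Longrightarrow> \<exists>g\<in>trace_poly E N.
      \<forall>z\<in>poly_over (quot_field E). z * g \<in> IntPoly E \<longrightarrow> (\<forall>x\<in>E. poly z x \<in> loc E p)"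
  shows False
proof -
  note R = subring_IntDom[OF E]
  obtain g where g: "\<And>p. p \<in> PP \<Longrightarrow> d \<in> p \<Longrightarrow> g p \<in> trace_poly E N \<and>
      (\<forall>z\<in>poly_over (quot_field E). z * g p \<in> IntPoly E \<longrightarrow> (\<forall>x\<in>E. poly z x \<in> loc E p))"
    using test by metis
  let ?d = "Fract [:d:] 1"
  let ?F = "insert ?d ((\<lambda>p. Fract (g p) 1) ` {p\<in>PP. d \<in> p})"
  have d0: "?d \<noteq> 0" using d by (simp add: Fract_zero)
  have dN: "?d \<in> N" using d(3) by (simp add: trace_poly_def)
  have "1 * z' \<in> IntDom E" if z': "z' \<in> quot_field (IntDom E)" "\<forall>f\<in>?F. z' * f \<in> IntDom E" for z'
  proof -
    have "z' * ?d \<in> IntDom E" using z' by blast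
    then obtain w where w: "z' * ?d = Fract w 1" "w \<in> IntPoly E" by (rule IntDomE)
    \<comment> \<open>Because \<open>d\<close> is a constant, a multiplier of the finite set is a
      polynomial over the quotient field, so its integrality can be checked on values.\<close>
    define z where "z = smult (1 / d) w"
    have zK: "z \<in> poly_over (quot_field E)"
      using IntPoly_over_quot[OF w(2)] quot_fieldI[OF subring_one[OF E] d(1,2)]
      unfolding z_def by (intro poly_over_smult subring_quot E)
    have "Fract z 1 * ?d = Fract w 1" using d by (simp add: z_def)
    then have zz: "z' = Fract z 1" using w(1) d0 by (metis mult_right_cancel)
    have zd: "d * poly z x \<in> E" if "x \<in> E" for x using IntPoly_eval[OF w(2) that] d by (simp add: z_def)
    have "poly z x \<in> E" if x: "x \<in> E" for x
    proof (rule E_int)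
      show "poly z x \<in> quot_field E" using poly_over_eval[OF subring_quot[OF E] zK] subset_quot_field[OF E x] .
      fix p assume p: "p \<in> PP"
      show "poly z x \<in> loc E p"
      proof (cases "d \<in> p")
        case True
        have "z' * Fract (g p) 1 \<in> IntDom E" using z'(2) p True by blast
        then have "z * g p \<in> IntPoly E" unfolding zz by (simp only: Fract_mult IntDom_iff)
        then show ?thesis using g[OF p True] zK x by blast
      next
        case False
        then show ?thesis using mem_loc_of_mult[OF p d(1) False zd[OF x]] by blast
      qed
    qed
    then have "z \<in> IntPoly E" using zK by (simp add: IntPoly_iff)
    then show ?thesis unfolding zz by (simp add: IntDom_iff)
  qed
  moreover have "finite ?F" using PP_finite[OF d(1,2)] by simp
  moreover have "?F \<subseteq> N" using dN g by (auto simp: trace_poly_def)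
  moreover have "?F - {0} \<noteq> {}" using d0 by blast
  ultimately have "1 \<in> t_op (IntDom E) N"
    unfolding t_op_iff[OF R] using subset_quot_field[OF R subring_one[OF R]] by blast
  moreover have "N \<noteq> {0}" using dN d0 by blast
  ultimately show False using N prime_ideal_one[OF N(1)] by (auto simp: t_ideal_def)
qed

lemma const_trace_prime:
  assumes M: "int_prime E M" and z: "0 \<in> M"
  shows "prime_ideal E {c\<in>E. [:c:] \<in> M}"
  unfolding prime_ideal_def is_ideal_def
proof (intro conjI ballI impI)
  let ?q = "{c\<in>E. [:c:] \<in> M}"
  have add: "f \<in> M \<Longrightarrow> g \<in> M \<Longrightarrow> f + g \<in> M" and mult: "r \<in> IntPoly E \<Longrightarrow> f \<in> M \<Longrightarrow> r * f \<in> M"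
    and prime: "f \<in> IntPoly E \<Longrightarrow> g \<in> IntPoly E \<Longrightarrow> f * g \<in> M \<Longrightarrow> f \<in> M \<or> g \<in> M" for f g r
    using M by (auto simp: int_prime_def)
  show "0 \<in> ?q" using subring_zero[OF E] z by simp
  have "1 \<notin> ?q" using M by (auto simp: int_prime_def one_pCons)
  then show "?q \<noteq> E" using subring_one[OF E] by blast
  fix x y assume "x \<in> ?q" "y \<in> ?q"
  then show "x + y \<in> ?q" using add[of "[:x:]" "[:y:]"] subring_add[OF E] by simp
next
  let ?q = "{c\<in>E. [:c:] \<in> M}"
  fix r x assume "r \<in> E" "x \<in> ?q"
  then show "r * x \<in> ?q" using M IntPoly_const[OF E, of r] subring_mult[OF E, of r x]
    unfolding int_prime_def by fastforce
next
  let ?q = "{c\<in>E. [:c:] \<in> M}"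
  fix x y assume xy: "x \<in> E" "y \<in> E" "x * y \<in> ?q"
  have "[:x:] * [:y:] \<in> M" using xy by (simp add: mult.commute)
  then have "[:x:] \<in> M \<or> [:y:] \<in> M" using M IntPoly_const[OF E] xy(1,2) unfolding int_prime_def by blast
  then show "x \<in> ?q \<or> y \<in> ?q" using xy by blast
qed auto

text \<open>The first half shows that elements of \<open>M\<close> with coefficients in
  \<open>E\<close> have all coefficients in \<open>q\<close>; otherwise they provide test
  polynomials for \<open>t_ideal_test\<close> through Gauss' lemma. Hence dividing \<open>A\<close>
  and \<open>B\<close> by their coefficient of least valuation at \<open>q\<close> takes one of them
  out of \<open>M\<close>.\<close>

lemma gauss_comparable:
  assumes N: "prime_ideal (IntDom E) N" "t_ideal (IntDom E) N"
    and q: "q = {c\<in>E. [:c:] \<in> trace_poly E N}" "d \<in> q" "d \<noteq> 0" and qp: "p0 \<in> PP" "q \<subseteq> p0"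
    and loc: "\<And>p. p \<in> PP \<Longrightarrow> q \<subseteq> p \<Longrightarrow> IntPoly E \<subseteq> poly_over (loc E p)"
  shows "comparable_at E (trace_poly E N)"
proof -
  let ?M = "trace_poly E N"
  note M = int_prime_trace[OF E N(1)]
  have "0 \<in> ?M" using prime_ideal_zero[OF N(1)] IntPoly_zero[OF E] by (simp add: trace_poly_def Zero_fract_def)
  then have qprime: "prime_ideal E q" unfolding q(1) by (rule const_trace_prime[OF M])
  have qE: "x \<in> q \<Longrightarrow> x \<in> E" for x using prime_ideal_mem[OF qprime] .
  have coeffs_q: "coeff f i \<in> q" if f: "f \<in> ?M" "f \<in> poly_over E" for f i
  proof (rule ccontr)
    assume i: "coeff f i \<notin> q"
    have f0: "f \<noteq> 0" using i prime_ideal_zero[OF qprime] by auto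
    show False
    proof (rule t_ideal_test[OF N qE[OF q(2)] q(3)])
      show "[:d:] \<in> ?M" using q by blast
      fix p assume p: "p \<in> PP" "d \<in> p"
      note Pp = PP_prime[OF p(1)]
      show "\<exists>g\<in>?M. \<forall>z\<in>poly_over (quot_field E). z * g \<in> IntPoly E \<longrightarrow> (\<forall>x\<in>E. poly z x \<in> loc E p)"
      proof (cases "q \<subseteq> p")
        case False
        then obtain e where e: "e \<in> q" "e \<notin> p" by blast
        have "poly z x \<in> loc E p" if "z * [:e:] \<in> IntPoly E" "x \<in> E" for z x
          using IntPoly_eval[OF that] mem_loc_of_mult[OF p(1) qE[OF e(1)] e(2), of "poly z x"] by (simp add: mult.commute)
        then show ?thesis using e q(1) by blast
      next
        case True
        have ran: "range (coeff f) \<subseteq> E" using f(2) by (auto simp: poly_over_def)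
        have ranK: "range (coeff f) \<subseteq> quot_field (loc E p)"
          using ran subset_quot_field[OF E] quot_field_loc[OF E Pp] by blast
        have fin: "finite (range (coeff f))" by (simp add: range_coeff)
        have "\<exists>x\<in>range (coeff f). x \<noteq> 0" using f0 by (auto simp: poly_eq_iff)
        then obtain c where c: "c \<in> range (coeff f)" "c \<noteq> 0" "\<forall>x\<in>range (coeff f). x / c \<in> loc E p"
          using valuation_min_element[OF PP_val[OF p(1)] fin ranK] by blast
        obtain s where s: "s \<in> E - p" "\<forall>x\<in>(\<lambda>x. x / c) ` range (coeff f). s * x \<in> E"
          using common_denominator[OF E Pp, of "(\<lambda>x. x / c) ` range (coeff f)"] fin c(3) by blast
        \<comment> \<open>Normalizing \<open>f\<close> by its content at \<open>p\<close> produces a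
          unit coefficient. The result stays in \<open>M\<close> because the content
          \<open>c\<close> lies outside \<open>q\<close>.\<close>
        define h where "h = smult (s / c) f"
        have hE: "h \<in> poly_over E" using s(2) by (auto simp: h_def poly_over_def)
        have cE: "c \<in> E" using c ran by blast
        have "c \<notin> q"
        proof
          assume "c \<in> q"
          moreover have "s * (coeff f i / c) \<in> E" using s(2) by blast
          ultimately have "s * (coeff f i / c) * c \<in> q" using prime_ideal_mult[OF qprime] by blast
          then have "s * coeff f i \<in> q" using c by simp
          moreover have "coeff f i \<in> E" using ran by blast
          ultimately show False using prime_ideal_prime[OF qprime, of s "coeff f i"] s True i by blast
        qed
        then have cM: "[:c:] \<notin> ?M" using q(1) cE by blast
        have "[:s:] * f \<in> ?M" using M IntPoly_const[OF E] s f(1) unfolding int_prime_def by blast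
        then have "[:c:] * h \<in> ?M" using c by (simp add: h_def)
        then have hM: "h \<in> ?M" using cM M IntPoly_const[OF E cE] poly_over_IntPoly[OF E hE] unfolding int_prime_def by blast
        obtain j where "c = coeff f j" using c(1) by blast
        then have "coeff h j = s" using c(2) by (simp add: h_def)
        moreover have "s \<noteq> 0" using s prime_ideal_zero[OF Pp] by auto
        ultimately have unit: "\<exists>i. coeff h i \<noteq> 0 \<and> inverse (coeff h i) \<in> loc E p"
          using inverse_mem_loc[OF E Pp, of s] s by (intro exI[of _ j]) auto
        have EV: "E \<subseteq> loc E p" using loc_mem[OF E Pp] by blast
        have hV: "h \<in> poly_over (loc E p)" using hE poly_over_mono[OF EV] by blast
        have "poly z x \<in> loc E p" if z: "z \<in> poly_over (quot_field E)" "z * h \<in> IntPoly E" and x: "x \<in> E" for z x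
        proof -
          have "z * h \<in> poly_over (loc E p)" using z(2) loc[OF p(1) True] by blast
          then have "z \<in> poly_over (loc E p)"
            using gauss_cancel[OF PP_val[OF p(1)] _ hV unit] z(1) quot_field_loc[OF E Pp] by simp
          then show ?thesis using poly_over_eval[OF subring_loc[OF E Pp]] x EV by blast
        qed
        then show ?thesis using hM by blast
      qed
    qed
  qed
  have val: "valuation_domain (loc E q)"
    using valuation_domain_loc_mono[OF E PP_prime[OF qp(1)] qprime qp(2) PP_val[OF qp(1)]] .
  show ?thesis unfolding comparable_at_def
  proof (intro ballI impI)
    fix A B assume AB: "A \<in> IntPoly E" "B \<in> IntPoly E" "A \<noteq> 0" "B \<noteq> 0"
    let ?S = "range (coeff A) \<union> range (coeff B)"
    have fin: "finite ?S" by (simp add: range_coeff)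
    have SK: "?S \<subseteq> quot_field (loc E q)"
      using IntPoly_over_quot[OF AB(1)] IntPoly_over_quot[OF AB(2)] quot_field_loc[OF E qprime] by (auto simp: poly_over_def)
    have "\<exists>x\<in>?S. x \<noteq> 0" using AB(3) by (auto simp: poly_eq_iff)
    then obtain c where c: "c \<in> ?S" "c \<noteq> 0" "\<forall>x\<in>?S. x / c \<in> loc E q"
      using valuation_min_element[OF val fin SK] by blast
    obtain s where s: "s \<in> E - q" "\<forall>x\<in>(\<lambda>x. x / c) ` ?S. s * x \<in> E"
      using common_denominator[OF E qprime, of "(\<lambda>x. x / c) ` ?S"] fin c(3) by blast
    define C where "C = smult (s / c) A"
    define C' where "C' = smult (s / c) B"
    have CE: "C \<in> poly_over E" "C' \<in> poly_over E" using s(2) by (auto simp: C_def C'_def poly_over_def)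
    obtain j where "c = coeff A j \<or> c = coeff B j" using c(1) by blast
    then have "coeff C j = s \<or> coeff C' j = s" using c(2) by (auto simp: C_def C'_def)
    then have "C \<notin> ?M \<or> C' \<notin> ?M" using coeffs_q CE s by blast
    moreover have "A * C' = B * C" by (simp add: C_def C'_def mult.commute)
    ultimately show "\<exists>C\<in>IntPoly E. \<exists>C'\<in>IntPoly E. A * C' = B * C \<and> (C \<notin> ?M \<or> C' \<notin> ?M)"
      using CE poly_over_IntPoly[OF E] by blast
  qed
qed

text \<open>Otherwise choose in each member an element outside \<open>q\<close>. By
  \<open>one_dim\<close>, high powers of those belonging to the finitely many \<open>p\<close>
  containing \<open>d\<close> have a product divisible by \<open>d\<close> in \<open>E\<close>; it
  then lies in \<open>q\<close>, although no factor does.\<close>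

lemma nonzero_prime_contains:
  assumes one_dim: "\<And>p d b. p \<in> PP \<Longrightarrow> d \<in> E \<Longrightarrow> d \<noteq> 0 \<Longrightarrow> b \<in> p \<Longrightarrow> \<exists>m. b ^ m / d \<in> loc E p"
    and q: "prime_ideal E q" "d \<in> q" "d \<noteq> 0"
  shows "\<exists>p\<in>PP. p \<subseteq> q"
proof (rule ccontr)
  assume no: "\<not> ?thesis"
  define F where "F = {p\<in>PP. d \<in> p}"
  have dE: "d \<in> E" using prime_ideal_mem[OF q(1,2)] .
  have F: "finite F" unfolding F_def using PP_finite[OF dE q(3)] .
  have "\<exists>b. b \<in> p \<and> b \<notin> q" if "p \<in> PP" for p using no that by blast
  then obtain b where b: "\<And>p. p \<in> PP \<Longrightarrow> b p \<in> p \<and> b p \<notin> q" by metis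
  have "\<forall>p\<in>PP. \<exists>m. b p ^ m / d \<in> loc E p" using one_dim dE q(3) b by blast
  then obtain m where m: "\<And>p. p \<in> PP \<Longrightarrow> b p ^ m p / d \<in> loc E p" by metis
  have bE: "b p \<in> E" if "p \<in> PP" for p using b[OF that] prime_ideal_mem[OF PP_prime[OF that]] by blast
  let ?f = "\<lambda>p. b p ^ m p"
  define y where "y = prod ?f F"
  have fE: "?f p \<in> E" if "p \<in> F" for p using that bE subring_power[OF E] by (auto simp: F_def)
  have yE: "y \<in> E" unfolding y_def using fE by (intro subring_prod E)
  have "y / d \<in> E"
  proof (rule E_int)
    show "y / d \<in> quot_field E" using quot_fieldI[OF yE dE q(3)] .
    fix p assume p: "p \<in> PP"
    show "y / d \<in> loc E p"
    proof (cases "p \<in> F")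
      case True
      have "prod ?f (F - {p}) \<in> loc E p" using fE by (intro loc_mem[OF E PP_prime[OF p]] subring_prod E) auto
      then have "b p ^ m p / d * prod ?f (F - {p}) \<in> loc E p"
        using m[OF p] subring_mult[OF subring_loc[OF E PP_prime[OF p]]] by blast
      moreover have "y / d = b p ^ m p / d * prod ?f (F - {p})"
        unfolding y_def prod.remove[OF F True, of ?f] by simp
      ultimately show ?thesis by (simp only:)
    next
      case False
      then have "d \<notin> p" using p by (simp add: F_def)
      then show ?thesis using locI yE dE by blast
    qed
  qed
  then have "y / d * d \<in> q" using q prime_ideal_mult by blast
  then have "y \<in> q" using q(3) by simp
  then obtain p where p: "p \<in> F" "?f p \<in> q" using prime_ideal_prod[OF E q(1) F, of ?f] fE by (auto simp: y_def)
  then show False using prime_ideal_power[OF E q(1) bE] b by (auto simp: F_def)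
qed

end

subsection \<open>The ring D0\<close>

text \<open>For a valuation ring \<open>W\<close> above \<open>S\<close> this is the contraction of
  its maximal ideal; zero is added by hand since \<open>inverse 0 = 0\<close>. It gives the primes
  of \<open>D0\<close> that correspond to those of \<open>Lambda0\<close>.\<close>

definition nonunits :: "'a::field set \<Rightarrow> 'a set \<Rightarrow> 'a set" where
  "nonunits S W = {x\<in>S. x = 0 \<or> inverse x \<notin> W}"

lemma (in finite_residue_prime) nonunits_eq: "S \<subseteq> V \<Longrightarrow> nonunits S (loc E P) = S \<inter> mV"
  using not_mV mV_no_inverse prime_ideal_zero[OF mV_prime] by (auto simp: nonunits_def V_def)

lemma (in finite_residue_prime) nonunits_overring:
  assumes S: "subring S" "E \<subseteq> S" "S \<subseteq> V"
  shows "prime_ideal S (nonunits S (loc E P))" "loc S (nonunits S (loc E P)) = loc E P"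
proof -
  note eq = nonunits_eq[OF S(3)]
  show prime: "prime_ideal S (nonunits S (loc E P))"
    unfolding eq prime_ideal_def is_ideal_def
  proof (intro conjI ballI impI)
    show "S \<inter> mV \<noteq> S" using subring_one[OF S(1)] prime_ideal_one[OF mV_prime] by blast
    show "0 \<in> S \<inter> mV" using subring_zero[OF S(1)] prime_ideal_zero[OF mV_prime] by blast
  next
    fix x y assume "x \<in> S \<inter> mV" "y \<in> S \<inter> mV"
    then show "x + y \<in> S \<inter> mV" using subring_add[OF S(1)] prime_ideal_add[OF mV_prime] by blast
  next
    fix r x assume "r \<in> S" "x \<in> S \<inter> mV"
    then show "r * x \<in> S \<inter> mV" using S(3) subring_mult[OF S(1)] prime_ideal_mult[OF mV_prime] by blast
  next
    fix x y assume "x \<in> S" "y \<in> S" "x * y \<in> S \<inter> mV"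
    then show "x \<in> S \<inter> mV \<or> y \<in> S \<inter> mV" using S(3) prime_ideal_prime[OF mV_prime, of x y] by blast
  qed simp
  show "loc S (nonunits S (loc E P)) = loc E P"
  proof (intro equalityI subsetI)
    fix x assume "x \<in> loc S (nonunits S (loc E P))"
    then obtain b s where bs: "x = b / s" "b \<in> S" "s \<in> S" "s \<notin> nonunits S (loc E P)" "s \<noteq> 0"
      using prime by (rule locE)
    then have "inverse s \<in> V" "b \<in> V" using S(3) by (auto simp: nonunits_def V_def)
    then show "x \<in> loc E P" using bs subring_mult[OF V] by (simp add: divide_inverse V_def)
  next
    fix x assume "x \<in> loc E P"
    then obtain b s where bs: "x = b / s" "b \<in> E" "s \<in> E" "s \<notin> P" "s \<noteq> 0" using Pp by (rule locE)
    then have "inverse s \<in> loc E P" using unit_V by (simp add: V_def)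
    then have "s \<notin> nonunits S (loc E P)" using bs by (simp add: nonunits_def)
    then show "x \<in> loc S (nonunits S (loc E P))" using bs S(2) locI by blast
  qed
qed

context krull_family begin

definition PP0 where "PP0 = (\<lambda>P. nonunits (D0 E) (loc E P)) ` Lambda0 E"

lemma Lambda0_prime: "P \<in> Lambda0 E \<Longrightarrow> prime_ideal E P"
  using Lambda0_sub PP_prime by blast

lemma E_sub_D0: "x \<in> E \<Longrightarrow> x \<in> D0 E"
  using loc_mem[OF E Lambda0_prime] subset_quot_field[OF E] by (auto simp: D0_def)

lemma D0_sub_loc: "P \<in> Lambda0 E \<Longrightarrow> D0 E \<subseteq> loc E P"
  by (auto simp: D0_def)

lemma D0_sub_quot: "D0 E \<subseteq> quot_field E"
  using loc_sub_quot[OF Lambda0_prime] by (auto simp: D0_def)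

lemma subring_D0: "subring (D0 E)"
proof (cases "Lambda0 E = {}")
  case False
  have "subring (loc E P)" if "P \<in> Lambda0 E" for P using subring_loc[OF E Lambda0_prime[OF that]] .
  then show ?thesis using False unfolding D0_def subring_def by auto
qed (simp add: D0_def subring_quot E)

lemma quot_D0: "quot_field (D0 E) = quot_field E"
  using quot_field_between[OF E _ D0_sub_quot] E_sub_D0 by blast

lemma loc_D0:
  assumes "P \<in> Lambda0 E"
  shows "prime_ideal (D0 E) (nonunits (D0 E) (loc E P))" "loc (D0 E) (nonunits (D0 E) (loc E P)) = loc E P"
proof -
  obtain a T where "finite_residue_prime E PP P a T" using Lambda0_finite_residue[OF assms] .
  then interpret finite_residue_prime E PP P a T .
  show "prime_ideal (D0 E) (nonunits (D0 E) (loc E P))" "loc (D0 E) (nonunits (D0 E) (loc E P)) = loc E P"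
    using nonunits_overring[OF subring_D0] E_sub_D0 D0_sub_loc[OF assms] by (auto simp: V_def)
qed

text \<open>Passing to \<open>D0\<close> leaves the localizations unchanged. For local finiteness
  write \<open>x = b / s\<close> over \<open>E\<close>: wherever \<open>x\<close> is a nonunit, the
  corresponding prime contains \<open>b\<close>.\<close>

lemma krull_family_D0: "krull_family (D0 E) PP0"
proof
  show "subring (D0 E)" by (rule subring_D0)
  fix p assume "p \<in> PP0"
  then show "prime_ideal (D0 E) p" using loc_D0 by (auto simp: PP0_def)
next
  fix p assume "p \<in> PP0"
  then show "valuation_domain (loc (D0 E) p)" using loc_D0 PP_val[OF Lambda0_sub] by (auto simp: PP0_def)
next
  fix x assume x: "x \<in> quot_field (D0 E)" "\<And>p. p \<in> PP0 \<Longrightarrow> x \<in> loc (D0 E) p"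
  then show "x \<in> D0 E" using loc_D0 quot_D0 by (auto simp: D0_def PP0_def)
next
  fix x assume x: "x \<in> D0 E" "x \<noteq> 0"
  then obtain b s where bs: "x = b / s" "b \<in> E" "s \<in> E" "s \<noteq> 0" using D0_sub_quot by (auto simp: quot_field_def)
  have b0: "b \<noteq> 0" using bs x by auto
  have "{p\<in>PP0. x \<in> p} \<subseteq> (\<lambda>P. nonunits (D0 E) (loc E P)) ` {P\<in>PP. b \<in> P}"
  proof
    fix p assume "p \<in> {p\<in>PP0. x \<in> p}"
    then obtain P where P: "P \<in> Lambda0 E" "p = nonunits (D0 E) (loc E P)" "x \<in> p" by (auto simp: PP0_def)
    have "inverse x \<notin> loc E P" using P x by (auto simp: nonunits_def)
    moreover have "inverse x = s / b" using bs by simp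
    ultimately have "b \<in> P" using locI[OF bs(3,2)] by auto
    then show "p \<in> (\<lambda>P. nonunits (D0 E) (loc E P)) ` {P\<in>PP. b \<in> P}" using P Lambda0_sub by blast
  qed
  then show "finite {p\<in>PP0. x \<in> p}" using PP_finite[OF bs(2) b0] finite_subset by blast
qed

text \<open>The generator \<open>a\<close> and the transversal \<open>T\<close> can be kept, as the
  valuation ring and its residue field are the same over \<open>D0\<close>.\<close>

lemma finite_residue_prime_D0:
  assumes L: "P \<in> Lambda0 E" and f: "finite_residue_prime E PP P a T"
  shows "finite_residue_prime (D0 E) PP0 (nonunits (D0 E) (loc E P)) a T"
proof -
  interpret finite_residue_prime E PP P a T by (rule f)
  interpret K: krull_family "D0 E" PP0 by (rule krull_family_D0)
  note eq = nonunits_eq[of "D0 E", unfolded V_def, OF D0_sub_loc[OF L]]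
  note l = loc_D0[OF L]
  show ?thesis
  proof unfold_locales
    show "nonunits (D0 E) (loc E P) \<in> PP0" using L by (simp add: PP0_def)
    show "a \<in> nonunits (D0 E) (loc E P)" using eq E_sub_D0[OF aE] aV by simp
    show "a \<noteq> 0" by (rule a)
    show "finite T" by (rule T)
    show "T \<subseteq> D0 E" using T(2) E_sub_D0 by blast
  next
    fix x assume "x \<in> nonunits (D0 E) (loc E P)"
    then have "x \<in> mV" using eq by blast
    then show "x / a \<in> loc (D0 E) (nonunits (D0 E) (loc E P))" unfolding l(2) by (simp add: mV_def V_def)
  next
    fix x assume x: "x \<in> D0 E"
    then obtain t where t: "t \<in> T" "x - t \<in> mV" using V_residue D0_sub_loc[OF L] by (auto simp: V_def)
    then have "x - t \<in> D0 E" using x T(2) E_sub_D0 by (intro subring_diff[OF subring_D0]) auto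
    then show "\<exists>t\<in>T. x - t \<in> nonunits (D0 E) (loc E P)" using t eq by blast
  next
    fix t t' assume "t \<in> T" "t' \<in> T" "t - t' \<in> nonunits (D0 E) (loc E P)"
    then show "t = t'" using eq T_mV by blast
  qed
qed

section \<open>Discreteness and the two implications\<close>

text \<open>Combined with a principal maximal ideal this says that the localization is a discrete
  valuation ring. The form without a generator transfers easily to \<open>D0\<close>.\<close>

definition rank_one :: "'a set \<Rightarrow> bool" where
  "rank_one P \<longleftrightarrow> (\<forall>x\<in>E - {0}. \<forall>b\<in>P. \<exists>m. b ^ m / x \<in> loc E P)"

text \<open>If \<open>x\<close> divides no power of some \<open>b\<close> in \<open>P\<close>, it
  divides no power of \<open>a\<close>, since \<open>a\<close> divides \<open>b\<close>; hence every
  power of \<open>a\<close> divides \<open>x\<close>. The valuation ring being the same over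
  \<open>D0\<close>, both negative results follow from one \<open>x\<close>.\<close>

lemma not_rank_one:
  assumes P: "P \<in> Lambda0 E" and n: "\<not> rank_one P"
  shows "\<not> PvMD (IntDom E)" "\<not> Pruefer (IntDom (D0 E))"
proof -
  obtain a T where f: "finite_residue_prime E PP P a T" using Lambda0_finite_residue[OF P] .
  interpret F: finite_residue_prime E PP P a T by (rule f)
  interpret G: finite_residue_prime "D0 E" PP0 "nonunits (D0 E) (loc E P)" a T
    by (rule finite_residue_prime_D0[OF P f])
  have VG: "G.V = F.V" unfolding G.V_def F.V_def by (rule loc_D0[OF P])
  obtain x b where x: "x \<in> E" "x \<noteq> 0" "b \<in> P" "\<And>m. b ^ m / x \<notin> loc E P"
    using n by (auto simp: rank_one_def)
  have d: "x / a ^ n \<in> F.V" for n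
  proof (rule ccontr)
    assume "x / a ^ n \<notin> F.V"
    then have "a ^ n / x \<in> F.V"
      using valuation_domainD[OF F.V_val, of x "a ^ n"] x F.a F.EK subring_power[OF E F.aE] by (auto simp: F.V_quot)
    then have "(b / a) ^ n * (a ^ n / x) \<in> F.V"
      using F.a_gen[OF x(3)] subring_mult[OF F.V] subring_power[OF F.V] by (simp only: F.V_def)
    then have "b ^ n / x \<in> F.V" using F.a by (simp add: power_divide)
    then show False using x(4) by (simp add: F.V_def)
  qed
  show "\<not> PvMD (IntDom E)" by (rule F.not_dvr_not_PvMD[OF x(1,2) d])
  show "\<not> Pruefer (IntDom (D0 E))" by (rule G.not_dvr_not_PvMD[OF E_sub_D0[OF x(1)] x(2) d[folded VG]])
qed

lemma comparable_at_rank_one: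
  assumes f: "finite_residue_prime E PP P a T" and r: "rank_one P"
    and M: "int_prime E M" and c: "\<And>c. c \<in> E \<Longrightarrow> [:c:] \<in> M \<longleftrightarrow> c \<in> P"
  shows "comparable_at E M"
proof -
  interpret F: finite_residue_prime E PP P a T by (rule f)
  interpret dvr_int_prime E PP P a T M
  proof
    fix x assume "x \<in> E" "x \<noteq> 0"
    then show "F.denom x" using r F.a unfolding F.denom_def rank_one_def F.V_def by blast
  qed (use M c in auto)
  show ?thesis by (rule comparable_at_dvr)
qed

lemma trace_zero: "prime_ideal (IntDom E) N \<Longrightarrow> 0 \<in> trace_poly E N"
  using prime_ideal_zero[of "IntDom E" N] IntPoly_zero[OF E] Fract_zero[of "0::'a poly"] by (simp add: trace_poly_def)

text \<open>Every nonzero prime of \<open>D0\<close> contains a member of \<open>PP0\<close>, and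
  such members are maximal by their finite residue fields. So a maximal ideal of the polynomial ring
  contracts to zero or to a member of \<open>PP0\<close>.\<close>

lemma rank_one_Pruefer:
  assumes r: "\<And>P. P \<in> Lambda0 E \<Longrightarrow> rank_one P"
  shows "Pruefer (IntDom (D0 E))"
  unfolding Pruefer_def
proof (intro conjI allI impI)
  interpret K: krull_family "D0 E" PP0 by (rule krull_family_D0)
  show R: "subring (IntDom (D0 E))" by (rule subring_IntDom[OF subring_D0])
  fix N assume "maximal_ideal (IntDom (D0 E)) N"
  then have N: "prime_ideal (IntDom (D0 E)) N" by (rule maximal_prime[OF R])
  let ?M = "trace_poly (D0 E) N"
  note M = int_prime_trace[OF subring_D0 N]
  define q where "q = {c\<in>D0 E. [:c:] \<in> ?M}"
  have q: "prime_ideal (D0 E) q" unfolding q_def by (rule K.const_trace_prime[OF M K.trace_zero[OF N]])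
  \<comment> \<open>Discreteness is transferred by writing a nonzero element of \<open>D0\<close> as
    a fraction \<open>y / s\<close> over \<open>E\<close> and bounding \<open>y\<close> by a power
    of \<open>a\<close>.\<close>
  have r0: "K.rank_one (nonunits (D0 E) (loc E P))" if P: "P \<in> Lambda0 E" for P
    unfolding K.rank_one_def loc_D0(2)[OF P]
  proof (intro ballI)
    fix x b assume x: "x \<in> D0 E - {0}" and b: "b \<in> nonunits (D0 E) (loc E P)"
    obtain a T where f: "finite_residue_prime E PP P a T" using Lambda0_finite_residue[OF P] .
    interpret F: finite_residue_prime E PP P a T by (rule f)
    have ba: "b / a \<in> F.V"
      using b F.nonunits_eq[of "D0 E", unfolded F.V_def, OF D0_sub_loc[OF P]] by (simp add: F.mV_def)
    obtain y s where ys: "x = y / s" "y \<in> E" "s \<in> E" "s \<noteq> 0" using x D0_sub_quot by (auto simp: quot_field_def)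
    have "y \<in> E - {0}" using ys x by auto
    then obtain m where m: "a ^ m / y \<in> F.V" using r[OF P] F.a unfolding rank_one_def F.V_def by blast
    have "(b / a) ^ m * (a ^ m / y) * s \<in> F.V"
      by (rule subring_mult[OF F.V subring_mult[OF F.V subring_power[OF F.V ba] m] F.E_V[OF ys(3)]])
    then have "b ^ m / x \<in> F.V" using F.a by (simp add: power_divide ys(1))
    then show "\<exists>m. b ^ m / x \<in> loc E P" by (auto simp: F.V_def)
  qed
  have "comparable_at (D0 E) ?M"
  proof (cases "\<exists>d\<in>q. d \<noteq> 0")
    case False
    then show ?thesis using comparable_at_generic[OF subring_D0 M] by (auto simp: q_def)
  next
    case True
    then obtain d where d: "d \<in> q" "d \<noteq> 0" by blast
    have "\<exists>p\<in>PP0. p \<subseteq> q"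
    proof (rule K.nonzero_prime_contains[OF _ q d])
      fix p d b assume "p \<in> PP0" "d \<in> D0 E" "d \<noteq> 0" "b \<in> p"
      then show "\<exists>m. b ^ m / d \<in> loc (D0 E) p" using r0 unfolding PP0_def K.rank_one_def by blast
    qed
    then obtain P where P: "P \<in> Lambda0 E" "nonunits (D0 E) (loc E P) \<subseteq> q" by (auto simp: PP0_def)
    obtain a T where f: "finite_residue_prime E PP P a T" using Lambda0_finite_residue[OF P(1)] .
    note f0 = finite_residue_prime_D0[OF P(1) f]
    interpret F: finite_residue_prime "D0 E" PP0 "nonunits (D0 E) (loc E P)" a T by (rule f0)
    have "q = nonunits (D0 E) (loc E P)"
      using finite_residue_maximal[OF subring_D0 F.Pp F.T(1) F.T_ex q P(2)] .
    then have "\<And>c. c \<in> D0 E \<Longrightarrow> [:c:] \<in> ?M \<longleftrightarrow> c \<in> nonunits (D0 E) (loc E P)" by (auto simp: q_def)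
    then show ?thesis using K.comparable_at_rank_one[OF f0 r0[OF P(1)] M] by blast
  qed
  then show "valuation_domain (loc (IntDom (D0 E)) N)" by (rule valuation_loc_IntDom[OF subring_D0 N])
qed

lemma rank_one_PvMD:
  assumes r: "\<And>P. P \<in> Lambda0 E \<Longrightarrow> rank_one P"
  shows "PvMD (IntDom E)"
  unfolding PvMD_def
proof (intro conjI allI impI)
  show R: "subring (IntDom E)" by (rule subring_IntDom[OF E])
  fix N assume tm: "t_maximal (IntDom E) N"
  have N: "prime_ideal (IntDom E) N" by (rule t_maximal_prime[OF R tm])
  have Nt: "t_ideal (IntDom E) N" using tm by (simp add: t_maximal_def)
  let ?M = "trace_poly E N"
  note M = int_prime_trace[OF E N]
  define q where "q = {c\<in>E. [:c:] \<in> ?M}"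
  have q: "prime_ideal E q" unfolding q_def by (rule const_trace_prime[OF M trace_zero[OF N]])
  have qE: "x \<in> q \<Longrightarrow> x \<in> E" for x by (simp add: q_def)
  have "comparable_at E ?M"
  proof (cases "\<exists>d\<in>q. d \<noteq> 0")
    case False
    then show ?thesis using comparable_at_generic[OF E M] by (auto simp: q_def)
  next
    case True
    then obtain d where d: "d \<in> q" "d \<noteq> 0" by blast
    \<comment> \<open>If no member contained \<open>q\<close>, constants of \<open>q\<close> outside
      each \<open>p\<close> would be admissible test polynomials.\<close>
    have "\<exists>p\<in>PP. q \<subseteq> p"
    proof (rule ccontr)
      assume no: "\<not> ?thesis"
      show False
      proof (rule t_ideal_test[OF N Nt qE[OF d(1)] d(2)])
        show "[:d:] \<in> ?M" using d by (simp add: q_def)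
        fix p assume p: "p \<in> PP" "d \<in> p"
        obtain e where e: "e \<in> q" "e \<notin> p" using no p by blast
        have "poly z x \<in> loc E p" if "z * [:e:] \<in> IntPoly E" "x \<in> E" for z x
          using IntPoly_eval[OF that] mem_loc_of_mult[OF p(1) qE[OF e(1)] e(2), of "poly z x"] by (simp add: mult.commute)
        then show "\<exists>g\<in>?M. \<forall>z\<in>poly_over (quot_field E). z * g \<in> IntPoly E \<longrightarrow> (\<forall>x\<in>E. poly z x \<in> loc E p)"
          using e by (intro bexI[of _ "[:e:]"]) (auto simp: q_def)
      qed
    qed
    then obtain p0 where p0: "p0 \<in> PP" "q \<subseteq> p0" by blast
    show ?thesis
    proof (cases "\<exists>P\<in>Lambda0 E. q \<subseteq> P")
      case True
      then obtain P where P: "P \<in> Lambda0 E" "q \<subseteq> P" by blast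
      obtain a T where f: "finite_residue_prime E PP P a T" using Lambda0_finite_residue[OF P(1)] .
      interpret F: finite_residue_prime E PP P a T by (rule f)
      \<comment> \<open>Up to a factor outside \<open>P\<close>, a power of any \<open>b\<close> in
        \<open>P\<close> is a multiple of \<open>d\<close>, which belongs to
        \<open>q\<close>.\<close>
      have "P \<subseteq> q"
      proof
        fix b assume b: "b \<in> P"
        have bE: "b \<in> E" using b prime_ideal_mem[OF F.Pp] by blast
        obtain m where "b ^ m / d \<in> loc E P" using r[OF P(1)] b d qE unfolding rank_one_def by blast
        then obtain e s where es: "b ^ m / d = e / s" "e \<in> E" "s \<in> E" "s \<notin> P" "s \<noteq> 0" using F.Pp by (rule locE)
        have "s * b ^ m = e * d" using es d(2) by (simp add: frac_eq_eq mult.commute)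
        then have "s * b ^ m \<in> q" using prime_ideal_mult[OF q es(2) d(1)] by simp
        then have "b ^ m \<in> q" using prime_ideal_prime[OF q es(3) subring_power[OF E bE]] es(4) P(2) by blast
        then show "b \<in> q" by (rule prime_ideal_power[OF E q bE])
      qed
      then have "\<And>c. c \<in> E \<Longrightarrow> [:c:] \<in> ?M \<longleftrightarrow> c \<in> P" using P(2) by (auto simp: q_def)
      then show ?thesis by (rule comparable_at_rank_one[OF f r[OF P(1)] M])
    next
      case False
      \<comment> \<open>Here no member of the family above \<open>q\<close> lies in
        \<open>Lambda0\<close>, so all integer-valued polynomials have coefficients in the
        corresponding localizations.\<close>
      show ?thesis
      proof (rule gauss_comparable[OF N Nt q_def d p0])
        fix p assume "p \<in> PP" "q \<subseteq> p"
        then show "IntPoly E \<subseteq> poly_over (loc E p)" using IntPoly_sub_loc False d by blast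
      qed
    qed
  qed
  then show "valuation_domain (loc (IntDom E) N)" by (rule valuation_loc_IntDom[OF E N])
qed

end

theorem theorem3p1:
  fixes D :: "'a::field set"
  assumes "subring D" and "Krull_type D"
  shows "PvMD (IntDom D) \<longleftrightarrow> Pruefer (IntDom (D0 D))"
proof -
  obtain PP where "krull_family D PP" using Krull_type_family[OF assms] .
  then interpret krull_family D PP .
  show ?thesis
  proof (cases "\<forall>P\<in>Lambda0 D. rank_one P")
    case True
    then show ?thesis using rank_one_PvMD rank_one_Pruefer by blast
  next
    case False
    then show ?thesis using not_rank_one by blast
  qed
qed

end
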